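(* Let $\mathcal{X}$ and $\mathcal{A}$ be Borel spaces, $\mathcal{D}\subseteq\mathcal{X}\times\mathcal{A}$ a Borel set with sections $D(x):=\{a:(x,a)\in\mathcal{D}\}$, $\mathrm{P}(\cdot\mid x,a)$ a transition kernel from $\mathcal{D}$ to $\mathcal{X}$, $i_{\max}\in\mathbb{N}$, $\mathcal{U}:[0,\infty)^{i_{\max}}\to\mathbb{R}$, $\mathbf{C}=(C^1,\dots,C^{i_{\max}})$ with $C^i:\mathcal{X}\times\mathcal{A}\times\mathcal{X}\to\mathbb{R}$, and $\boldsymbol\beta\in(0,1)^{i_{\max}}$. Assume: (i) $\mathcal{U}$ is continuous and componentwise increasing; (ii) each $D(x)$ is compact; (iii) if $x_n\to x$ and $a_n\in D(x_n)$ then $(a_n)$ has an accumulation point in $D(x)$; (iv) each $C^i$ is lower semi-continuous with $\underline c\le C^i\le\bar c$ for constants $\underline c,\bar c>0$; (v) $\mathrm{P}$ is weakly continuous. Products and quotients of vectors are componentwise, $\boldsymbol\beta^k$ is the componentwise power, and $\frac{1}{\mathbf{1}-\boldsymbol\beta}=\big(\frac{1}{1-\beta_1},\dots,\frac{1}{1-\beta_{i_{\max}}}\big)$. For augmented states $(x,\mathbf{d},\mathbf{z})\in\mathcal{X}\times[0,\infty)^{i_{\max}}\times(0,1]^{i_{\max}}$, let $$\tilde{\mathcal{V}}_\infty(x,\mathbf{d},\mathbf{z}):=\inf_{\tilde\pi}\tilde{\mathbb{E}}^{\tilde\pi}_{(x,\mathbf{d},\mathbf{z})}\Big[\mathcal{U}\Big(\mathbf{z}\cdot\sum_{k=0}^{\infty}\boldsymbol\beta^k\cdot\mathbf{C}(X_k,A_k,X_{k+1})+\mathbf{d}\Big)\Big],$$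 the infimum over history-dependent augmented policies. Let $\Delta$ be the set of lower semi-continuous $v:\mathcal{X}\times[0,\infty)^{i_{\max}}\times(0,1]^{i_{\max}}\to\mathbb{R}$ with $v(x,\cdot,\cdot)$ continuous and componentwise increasing for all $x$ and $v(x,\mathbf{d},\mathbf{z})\ge\mathcal{U}(\mathbf{d})$. For such $v$ and a decision rule $g$ (measurable, $g(x,\mathbf{d},\mathbf{z})\in D(x)$) let $$T_g[v](x,\mathbf{d},\mathbf{z})=\int v\big(x',\mathbf{z}\cdot\mathbf{C}(x,g(x,\mathbf{d},\mathbf{z}),x')+\mathbf{d},\mathbf{z}\cdot\boldsymbol\beta\big)\mathrm{P}(dx'\mid x,g(x,\mathbf{d},\mathbf{z})),\quad T[v](x,\mathbf{d},\mathbf{z})=\inf_{a\in D(x)}\int v\big(x',\mathbf{z}\cdot\mathbf{C}(x,a,x')+\mathbf{d},\mathbf{z}\cdot\boldsymbol\beta\big)\mathrm{P}(dx'\mid x,a).$$ Define $\underline b(\mathbf{d},\mathbf{z}):=\mathcal{U}\big(\mathbf{z}\cdot\frac{\underline c}{\mathbf{1}-\boldsymbol\beta}+\mathbf{d}\big)$, $\bar b(\mathbf{d},\mathbf{z}):=\mathcal{U}\big(\mathbf{z}\cdot\frac{\bar c}{\mathbf{1}-\boldsymbol\beta}+\mathbf{d}\big)$, regarded (like $\mathcal{U}$, via $(x,\mathbf{d},\mathbf{z})\mapsto\mathcal{U}(\mathbf{d})$) as functions on the augmented state space. Then: a) For every compact $K\subseteq[0,\infty)^{i_{\max}}$, as $n\to\infty$,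 $T^n[\underline b]\nearrow\tilde{\mathcal{V}}_\infty$, $T^n[\mathcal{U}]\nearrow\tilde{\mathcal{V}}_\infty$ and $T^n[\bar b]\searrow\tilde{\mathcal{V}}_\infty$ uniformly on $\mathcal{X}\times K\times(0,1)^{i_{\max}}$. b) $\tilde{\mathcal{V}}_\infty$ is the unique solution of: $v=T[v]$, $v\in\Delta$, and $\underline b(\cdot,\cdot)\le v(x,\cdot,\cdot)\le\bar b(\cdot,\cdot)$ for all $x\in\mathcal{X}$. c) There exists a decision rule $g^*$ with $T_{g^*}[\tilde{\mathcal{V}}_\infty]=T[\tilde{\mathcal{V}}_\infty]$. d) For such $g^*$, the history-dependent policy $f^*=(f^*_0,f^*_1,\dots)$ given by $f^*_n(h_n)=g^*\big(x_n,\sum_{k=0}^{n-1}\boldsymbol\beta^k\cdot\mathbf{C}(x_k,a_k,x_{k+1}),\boldsymbol\beta^n\big)$ is optimal for $\mathcal{V}_\infty(x):=\inf_\pi\mathbb{E}^\pi_x\big[\mathcal{U}\big(\sum_{n=0}^\infty\boldsymbol\beta^n\cdot\mathbf{C}(X_n,A_n,X_{n+1})\big)\big]$, the infimum over history-dependent policies of the original problem.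
   Context: Histories of the original problem: $\mathcal{H}_0=\mathcal{X}$, $\mathcal{H}_n=\mathcal{H}_{n-1}\times\mathcal{A}\times\mathcal{X}$, $h_n=(x_0,a_0,\dots,x_n)$; a history-dependent policy is $\pi=(f_0,f_1,\dots)$ with measurable $f_n:\mathcal{H}_n\to\mathcal{A}$, $f_n(h_n)\in D(x_n)$, inducing (Ionescu-Tulcea) a probability $\mathbb{P}^\pi_x$ with expectation $\mathbb{E}^\pi_x$ and processes $X_0=x$, $A_n=f_n(H_n)$, $X_{n+1}\sim\mathrm{P}(\cdot\mid X_n,A_n)$. Augmented policies are defined analogously on the augmented state space $\mathcal{X}\times\mathbb{R}^{i_{\max}}\times(0,1]^{i_{\max}}$, whose transition kernel is the pushforward of $\mathrm{P}(\cdot\mid x,a)$ under $x'\mapsto(x',\mathbf{z}\cdot\mathbf{C}(x,a,x')+\mathbf{d},\mathbf{z}\cdot\boldsymbol\beta)$; $\tilde{\mathbb{E}}^{\tilde\pi}$ is the induced expectation. $T^n$ denotes the $n$-fold iterate of $T$. *)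

theory Defs
  imports "HOL-Probability.Probability"
begin

definition lsc_on :: "'a::topological_space set \<Rightarrow> ('a \<Rightarrow> real) \<Rightarrow> bool" where
  "lsc_on S f \<longleftrightarrow> (\<forall>y. openin (top_of_set S) {p \<in> S. y < f p})"

definition sect :: "('x \<times> 'a) set \<Rightarrow> 'x \<Rightarrow> 'a set" where
  "sect D x = {a. (x, a) \<in> D}"

text \<open>A history h_n = (s_0,a_0,...,s_n) is represented by a pair of extensional
  sequences: states indexed by {..n}, actions indexed by {..<n}.\<close>
type_synonym ('s, 'a) hist = "(nat \<Rightarrow> 's) \<times> (nat \<Rightarrow> 'a)"

definition hist_space :: "'s measure \<Rightarrow> 'a measure \<Rightarrow> nat \<Rightarrow> ('s, 'a) hist measure" where
  "hist_space S A n = (\<Pi>\<^sub>M k\<in>{..n}. S) \<Otimes>\<^sub>M (\<Pi>\<^sub>M k\<in>{..<n}. A)"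

definition is_policy :: "'s measure \<Rightarrow> 'a measure \<Rightarrow> ('s \<Rightarrow> 'a set)
    \<Rightarrow> (nat \<Rightarrow> ('s, 'a) hist \<Rightarrow> 'a) \<Rightarrow> bool" where
  "is_policy S A Dx f \<longleftrightarrow>
     (\<forall>n. f n \<in> measurable (hist_space S A n) A \<and>
          (\<forall>h \<in> space (hist_space S A n). f n h \<in> Dx (fst h n)))"

primrec hist_law :: "'s measure \<Rightarrow> 'a measure \<Rightarrow> ('s \<Rightarrow> 'a \<Rightarrow> 's measure)
    \<Rightarrow> (nat \<Rightarrow> ('s, 'a) hist \<Rightarrow> 'a) \<Rightarrow> 's \<Rightarrow> nat \<Rightarrow> ('s, 'a) hist measure" where
  "hist_law S A Q f s 0 = return (hist_space S A 0) (\<lambda>k\<in>{..0}. s, \<lambda>k\<in>{..<0}. undefined)"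
| "hist_law S A Q f s (Suc n) =
     bind (hist_law S A Q f s n)
       (\<lambda>h. distr (Q (fst h n) (f n h)) (hist_space S A (Suc n))
               (\<lambda>s'. ((fst h)(Suc n := s'), (snd h)(n := f n h))))"

definition path_space :: "'s measure \<Rightarrow> 'a measure \<Rightarrow> ((nat \<Rightarrow> 's) \<times> (nat \<Rightarrow> 'a)) measure" where
  "path_space S A = (\<Pi>\<^sub>M k\<in>UNIV. S) \<Otimes>\<^sub>M (\<Pi>\<^sub>M k\<in>UNIV. A)"

definition hist_proj :: "nat \<Rightarrow> (nat \<Rightarrow> 's) \<times> (nat \<Rightarrow> 'a) \<Rightarrow> ('s, 'a) hist" where
  "hist_proj n \<omega> = (restrict (fst \<omega>) {..n}, restrict (snd \<omega>) {..<n})"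

text \<open>The probability measure on paths (X_0,X_1,...),(A_0,A_1,...) induced by the policy
  (Ionescu-Tulcea): the (unique) probability measure on the path space whose
  finite-dimensional marginals are the history laws.\<close>
definition path_law :: "'s measure \<Rightarrow> 'a measure \<Rightarrow> ('s \<Rightarrow> 'a \<Rightarrow> 's measure)
    \<Rightarrow> (nat \<Rightarrow> ('s, 'a) hist \<Rightarrow> 'a) \<Rightarrow> 's \<Rightarrow> ((nat \<Rightarrow> 's) \<times> (nat \<Rightarrow> 'a)) measure" where
  "path_law S A Q f s = (SOME M. sets M = sets (path_space S A) \<and> prob_space M \<and>
      (\<forall>n. distr M (hist_space S A n) (hist_proj n) = hist_law S A Q f s n))"

definition orig_cost ::
  "'x::polish_space set \<Rightarrow> 'a::polish_space set \<Rightarrow> ('x \<Rightarrow> 'a \<Rightarrow> 'x measure)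
   \<Rightarrow> ((real^'i) \<Rightarrow> real) \<Rightarrow> ('x \<Rightarrow> 'a \<Rightarrow> 'x \<Rightarrow> (real^'i::finite)) \<Rightarrow> real^'i
   \<Rightarrow> (nat \<Rightarrow> ('x, 'a) hist \<Rightarrow> 'a) \<Rightarrow> 'x \<Rightarrow> real" where
  "orig_cost Xs As P U C \<beta> f x =
     (\<integral>\<omega>. U (\<Sum>n. \<beta> ^ n * C (fst \<omega> n) (snd \<omega> n) (fst \<omega> (Suc n)))
        \<partial>path_law (restrict_space borel Xs) (restrict_space borel As) P f x)"

definition V_inf ::
  "'x::polish_space set \<Rightarrow> 'a::polish_space set \<Rightarrow> ('x \<times> 'a) set \<Rightarrow> ('x \<Rightarrow> 'a \<Rightarrow> 'x measure)
   \<Rightarrow> ((real^'i) \<Rightarrow> real) \<Rightarrow> ('x \<Rightarrow> 'a \<Rightarrow> 'x \<Rightarrow> (real^'i::finite)) \<Rightarrow> (real^'i) \<Rightarrow> 'x \<Rightarrow> real" where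
  "V_inf Xs As D P U C \<beta> x =
     (INF f \<in> {f. is_policy (restrict_space borel Xs) (restrict_space borel As) (sect D) f}.
        orig_cost Xs As P U C \<beta> f x)"

definition aug_states :: "'x set \<Rightarrow> ('x \<times> (real^'i::finite) \<times> (real^'i)) set" where
  "aug_states Xs = {(x, d, z). x \<in> Xs \<and> (\<forall>i. 0 \<le> d $ i) \<and> (\<forall>i. 0 < z $ i \<and> z $ i \<le> 1)}"

definition aug_space :: "'x::polish_space set \<Rightarrow> ('x \<times> (real^'i::finite) \<times> (real^'i)) measure" where
  "aug_space Xs = restrict_space borel (aug_states Xs)"

definition aug_kernel ::
  "'x::polish_space set \<Rightarrow> ('x \<Rightarrow> 'a \<Rightarrow> 'x measure) \<Rightarrow> ('x \<Rightarrow> 'a \<Rightarrow> 'x \<Rightarrow> (real^'i::finite))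
   \<Rightarrow> (real^'i) \<Rightarrow> 'x \<times> (real^'i) \<times> (real^'i) \<Rightarrow> 'a \<Rightarrow> ('x \<times> (real^'i) \<times> (real^'i)) measure" where
  "aug_kernel Xs P C \<beta> s a = (case s of (x, d, z) \<Rightarrow>
      distr (P x a) (aug_space Xs) (\<lambda>x'. (x', z * C x a x' + d, z * \<beta>)))"

definition aug_sect :: "('x \<times> 'a) set \<Rightarrow> 'x \<times> (real^'i) \<times> (real^'i) \<Rightarrow> 'a set" where
  "aug_sect D s = sect D (fst s)"

definition aug_cost ::
  "'x::polish_space set \<Rightarrow> 'a::polish_space set \<Rightarrow> ('x \<Rightarrow> 'a \<Rightarrow> 'x measure)
   \<Rightarrow> ((real^'i) \<Rightarrow> real) \<Rightarrow> ('x \<Rightarrow> 'a \<Rightarrow> 'x \<Rightarrow> (real^'i::finite)) \<Rightarrow> real^'i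
   \<Rightarrow> (nat \<Rightarrow> ('x \<times> (real^'i) \<times> (real^'i), 'a) hist \<Rightarrow> 'a) \<Rightarrow> 'x \<times> (real^'i) \<times> (real^'i) \<Rightarrow> real" where
  "aug_cost Xs As P U C \<beta> f s = (case s of (x, d, z) \<Rightarrow>
     (\<integral>\<omega>. U (z * (\<Sum>k. \<beta> ^ k * C (fst (fst \<omega> k)) (snd \<omega> k) (fst (fst \<omega> (Suc k)))) + d)
        \<partial>path_law (aug_space Xs) (restrict_space borel As) (aug_kernel Xs P C \<beta>) f s))"

definition V_aug ::
  "'x::polish_space set \<Rightarrow> 'a::polish_space set \<Rightarrow> ('x \<times> 'a) set \<Rightarrow> ('x \<Rightarrow> 'a \<Rightarrow> 'x measure)
   \<Rightarrow> ((real^'i) \<Rightarrow> real) \<Rightarrow> ('x \<Rightarrow> 'a \<Rightarrow> 'x \<Rightarrow> (real^'i::finite)) \<Rightarrow> real^'i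
   \<Rightarrow> 'x \<times> (real^'i) \<times> (real^'i) \<Rightarrow> real" where
  "V_aug Xs As D P U C \<beta> s =
     (INF f \<in> {f. is_policy (aug_space Xs) (restrict_space borel As) (aug_sect D) f}.
        aug_cost Xs As P U C \<beta> f s)"

definition is_decision_rule ::
  "'x::polish_space set \<Rightarrow> 'a::polish_space set \<Rightarrow> ('x \<times> 'a) set
   \<Rightarrow> ('x \<times> (real^'i::finite) \<times> (real^'i) \<Rightarrow> 'a) \<Rightarrow> bool" where
  "is_decision_rule Xs As D g \<longleftrightarrow>
     g \<in> measurable (aug_space Xs) (restrict_space borel As) \<and>
     (\<forall>(x, d, z) \<in> aug_states Xs. g (x, d, z) \<in> sect D x)"

definition T_g ::
  "('x \<Rightarrow> 'a \<Rightarrow> 'x measure) \<Rightarrow> ('x \<Rightarrow> 'a \<Rightarrow> 'x \<Rightarrow> (real^'i::finite)) \<Rightarrow> real^'i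
   \<Rightarrow> ('x \<times> (real^'i) \<times> (real^'i) \<Rightarrow> 'a)
   \<Rightarrow> ('x \<times> (real^'i) \<times> (real^'i) \<Rightarrow> real) \<Rightarrow> 'x \<times> (real^'i) \<times> (real^'i) \<Rightarrow> real" where
  "T_g P C \<beta> g v s = (case s of (x, d, z) \<Rightarrow>
     (\<integral>x'. v (x', z * C x (g (x, d, z)) x' + d, z * \<beta>) \<partial>P x (g (x, d, z))))"

definition T_op ::
  "('x \<times> 'a) set \<Rightarrow> ('x \<Rightarrow> 'a \<Rightarrow> 'x measure) \<Rightarrow> ('x \<Rightarrow> 'a \<Rightarrow> 'x \<Rightarrow> (real^'i::finite)) \<Rightarrow> real^'i
   \<Rightarrow> ('x \<times> (real^'i) \<times> (real^'i) \<Rightarrow> real) \<Rightarrow> 'x \<times> (real^'i) \<times> (real^'i) \<Rightarrow> real" where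
  "T_op D P C \<beta> v s = (case s of (x, d, z) \<Rightarrow>
     (INF a \<in> sect D x. \<integral>x'. v (x', z * C x a x' + d, z * \<beta>) \<partial>P x a))"

definition Delta :: "'x::polish_space set \<Rightarrow> ((real^'i::finite) \<Rightarrow> real)
    \<Rightarrow> ('x \<times> (real^'i) \<times> (real^'i) \<Rightarrow> real) set" where
  "Delta Xs U = {v. lsc_on (aug_states Xs) v \<and>
     (\<forall>x \<in> Xs.
        continuous_on {(d, z). (x, d, z) \<in> aug_states Xs} (\<lambda>(d, z). v (x, d, z)) \<and>
        (\<forall>d z d' z'. (x, d, z) \<in> aug_states Xs \<longrightarrow> (x, d', z') \<in> aug_states Xs \<longrightarrow>
            d \<le> d' \<longrightarrow> z \<le> z' \<longrightarrow> v (x, d, z) \<le> v (x, d', z'))) \<and>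
     (\<forall>(x, d, z) \<in> aug_states Xs. v (x, d, z) \<ge> U d)}"

definition bfun :: "((real^'i::finite) \<Rightarrow> real) \<Rightarrow> (real^'i) \<Rightarrow> real
    \<Rightarrow> 'x \<times> (real^'i) \<times> (real^'i) \<Rightarrow> real" where
  "bfun U \<beta> c s = (case s of (x, d, z) \<Rightarrow> U (z * (\<chi> i. c / (1 - \<beta> $ i)) + d))"

definition Ufun :: "((real^'i::finite) \<Rightarrow> real) \<Rightarrow> 'x \<times> (real^'i) \<times> (real^'i) \<Rightarrow> real" where
  "Ufun U s = U (fst (snd s))"

end

theory Submission
  imports Defs
begin

text \<open>The Bellman operator maps the lower semicontinuous, monotone functions between \<open>U\<close> and \<open>b_hi\<close>
  to themselves: weak continuity of \<open>P\<close> extends to lower semicontinuous integrands by approximating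
  them from below with Lipschitz functions, uniformly in the parameter. The quantity
  \<open>d + z c_hi / (1 - \<beta>)\<close> never increases along a transition while \<open>z\<close> shrinks geometrically, so
  uniform continuity of \<open>U\<close> on compact boxes makes the iterates started in \<open>U\<close> and \<open>b_hi\<close> approach
  each other uniformly; their common limit \<open>Vlim\<close> is the only fixed point. For every
  history-dependent policy the expectation of \<open>U\<close> at the \<open>n\<close>-th augmented state is at least the
  \<open>n\<close>-th iterate of \<open>U\<close>, so every policy costs at least \<open>Vlim\<close>. Under a minimizing decision rule
  the values of \<open>Vlim\<close> along the process have constant expectation and dominate those of \<open>U\<close>, which
  gives the reverse bound.\<close>

subsection \<open>Lower semicontinuous functions\<close>

text \<open>\<open>U\<close> is in general nonlinear, so there is no Bellman equation on
  \<open>Xs\<close> alone; carrying the accumulated cost \<open>d\<close> and the discount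
  \<open>z\<close> restores one. The price is that the cost \<open>C\<close>, only lower
  semicontinuous, now sits inside the argument of the unknown function, and lower semicontinuity
  does not survive composition in general. Hence the function class combines joint lower
  semicontinuity with monotonicity and continuity in \<open>(d, z)\<close>, and each property has to
  be carried through \<open>T\<close> and through the limit. No contraction argument is used:
  \<open>U\<close> is an arbitrary continuous increasing function, and the gap between the iterates
  closes only because late costs carry the factor \<beta>^n. The vectors c / (1 - \<beta>) are
  geometric series, the totals of a constant cost c; this makes \<open>b_lo\<close> a subsolution
  and \<open>b_hi\<close> a supersolution of the Bellman equation. A path law is defined as some
  measure with prescribed marginals, so such a measure has to be constructed before a cost can be
  evaluated.\<close>

lemma lsc_on_sequentiallyI:
  fixes f :: "'b::metric_space \<Rightarrow> real"
  assumes "\<And>y s p. (\<And>n::nat. s n \<in> S) \<Longrightarrow> (\<And>n. f (s n) \<le> y) \<Longrightarrow> p \<in> S \<Longrightarrow> s \<longlonglongrightarrow> p \<Longrightarrow> f p \<le> y"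
  shows "lsc_on S f"
  unfolding lsc_on_def
proof
  fix y
  have "\<exists>T. closed T \<and> {p \<in> S. f p \<le> y} = S \<inter> T"
  proof (intro exI conjI)
    show "closed (closure {p \<in> S. f p \<le> y})" by simp
    show "{p \<in> S. f p \<le> y} = S \<inter> closure {p \<in> S. f p \<le> y}"
    proof (intro equalityI subsetI IntI)
      fix p assume "p \<in> S \<inter> closure {p \<in> S. f p \<le> y}"
      then obtain s where "\<forall>n. s n \<in> {p \<in> S. f p \<le> y}" "s \<longlonglongrightarrow> p" "p \<in> S"
        using closure_sequential[of p "{p \<in> S. f p \<le> y}"] by auto
      then show "p \<in> {p \<in> S. f p \<le> y}" using assms[of s y p] by auto
    qed (auto intro: closure_subset[THEN subsetD])
  qed
  then obtain T where "closed T" "{p \<in> S. f p \<le> y} = S \<inter> T" by blast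
  then have "{p \<in> S. y < f p} = S \<inter> (- T)" "open (- T)"
    by (auto simp: not_le[symmetric])
  then show "openin (top_of_set S) {p \<in> S. y < f p}"
    by (auto simp: openin_open)
qed

lemma lsc_on_eventually_less:
  assumes "lsc_on S f" "p \<in> S" "y < f p" "s \<longlonglongrightarrow> p" "\<And>n::nat. s n \<in> S"
  shows "eventually (\<lambda>n. y < f (s n)) sequentially"
proof -
  from assms(1) obtain T where T: "open T" "{p \<in> S. y < f p} = S \<inter> T"
    unfolding lsc_on_def openin_open by blast
  then have "eventually (\<lambda>n. s n \<in> T) sequentially"
    using assms by (intro topological_tendstoD) auto
  then show ?thesis by eventually_elim (use T assms(5) in auto)
qed

lemma lsc_on_cong: "(\<And>p. p \<in> S \<Longrightarrow> f p = g p) \<Longrightarrow> lsc_on S f \<longleftrightarrow> lsc_on S g"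
  unfolding lsc_on_def by (simp cong: conj_cong)

lemma continuous_on_imp_lsc_on: "continuous_on S f \<Longrightarrow> lsc_on S f"
  unfolding lsc_on_def
proof
  fix y assume "continuous_on S f"
  then have "openin (top_of_set S) (S \<inter> f -` {y<..})"
    by (simp add: continuous_openin_preimage_gen)
  moreover have "S \<inter> f -` {y<..} = {p \<in> S. y < f p}" by auto
  ultimately show "openin (top_of_set S) {p \<in> S. y < f p}" by simp
qed

lemma lsc_on_borel_measurable:
  assumes "lsc_on S f" shows "f \<in> borel_measurable (restrict_space borel S)"
  unfolding borel_measurable_iff_greater
proof safe
  fix y
  from assms obtain T where "open T" "{p \<in> S. y < f p} = S \<inter> T"
    unfolding lsc_on_def openin_open by blast
  then show "{w \<in> space (restrict_space borel S). y < f w} \<in> sets (restrict_space borel S)"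
    by (auto simp: space_restrict_space sets_restrict_space)
qed

lemma lsc_on_SUP:
  assumes "\<And>n::nat. lsc_on S (f n)" and "\<And>p. p \<in> S \<Longrightarrow> (\<lambda>n. f n p) \<longlonglongrightarrow> g p"
    and "\<And>n p. p \<in> S \<Longrightarrow> f n p \<le> g p"
  shows "lsc_on S g"
  unfolding lsc_on_def
proof
  fix y
  have "{p \<in> S. y < g p} = (\<Union>n. {p \<in> S. y < f n p})"
  proof (intro equalityI subsetI)
    fix p assume p: "p \<in> {p \<in> S. y < g p}"
    with order_tendstoD(1)[OF assms(2)[of p], of y] obtain n where "y < f n p"
      by (force simp: eventually_sequentially)
    with p show "p \<in> (\<Union>n. {p \<in> S. y < f n p})" by auto
  qed (use assms(3) in \<open>auto intro: less_le_trans\<close>)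
  with assms(1) show "openin (top_of_set S) {p \<in> S. y < g p}"
    by (auto simp: lsc_on_def)
qed

text \<open>Among finitely many values of \<open>f\<close> one is least, so the sublevel sets at the
  values \<open>f b\<close> have the finite intersection property. By compactness they share a
  point, which is a minimizer.\<close>

lemma lsc_sublevels_attains_inf:
  fixes f :: "'b::t2_space \<Rightarrow> real"
  assumes K: "compact K" "K \<noteq> {}" and sub: "\<And>q. closed {a \<in> K. f a \<le> q}"
  shows "\<exists>a\<in>K. \<forall>b\<in>K. f a \<le> f b"
proof -
  have "K \<inter> (\<Inter>b\<in>K. {a \<in> K. f a \<le> f b}) \<noteq> {}"
  proof (rule compact_imp_fip_image[OF K(1)])
    fix B assume B: "finite B" "B \<subseteq> K"
    show "K \<inter> (\<Inter>b\<in>B. {a \<in> K. f a \<le> f b}) \<noteq> {}"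
    proof (cases "B = {}")
      case False
      then obtain b where "b \<in> B" "\<forall>b'\<in>B. f b \<le> f b'"
        using B(1) by (metis arg_min_if_finite linorder_not_le)
      with B show ?thesis by blast
    qed (use K in simp)
  qed (use sub in auto)
  then show ?thesis by blast
qed

text \<open>The infimal convolutions of a lower semicontinuous function with \<open>m \<cdot> dist\<close>, truncated at \<open>m\<close>.\<close>

lemma lsc_on_Lipschitz_approx:
  fixes f :: "'b::metric_space \<Rightarrow> real"
  assumes lsc: "lsc_on S f" and B: "\<And>p. p \<in> S \<Longrightarrow> B \<le> f p"
  obtains G :: "nat \<Rightarrow> 'b \<Rightarrow> real" where
    "\<And>m p. p \<in> S \<Longrightarrow> min B 0 \<le> G m p" "\<And>m p. G m p \<le> m" "\<And>m p. p \<in> S \<Longrightarrow> G m p \<le> f p"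
    "\<And>m p q. p \<in> S \<Longrightarrow> q \<in> S \<Longrightarrow> \<bar>G m p - G m q\<bar> \<le> m * dist p q"
    "\<And>p. p \<in> S \<Longrightarrow> (\<lambda>m. G m p) \<longlonglongrightarrow> f p"
proof -
  define F where "F m p = (INF q\<in>S. f q + real m * dist p q)" for m p
  have bdd: "bdd_below ((\<lambda>q. f q + real m * dist p q) ` S)" for m p
    using B by (intro bdd_belowI[of _ B]) (auto intro: add_increasing2)
  have F_le: "F m p \<le> f q + real m * dist p q" if "q \<in> S" for m p q
    unfolding F_def using that by (intro cINF_lower[OF bdd])
  have le_F: "c \<le> F m p" if "p \<in> S" "\<And>q. q \<in> S \<Longrightarrow> c \<le> f q + real m * dist p q" for c m p
    unfolding F_def using that by (intro cINF_greatest) auto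
  have B_le_F: "B \<le> F m p" if "p \<in> S" for m p
    using B that by (intro le_F) (auto intro: add_increasing2)
  have F_diff: "F m p \<le> F m q + m * dist p q" if "p \<in> S" "q \<in> S" for m p q
  proof -
    have "F m p - m * dist p q \<le> F m q"
    proof (rule le_F[OF that(2)])
      fix r assume "r \<in> S"
      have "dist p r \<le> dist p q + dist q r" by (rule dist_triangle)
      then have "real m * dist p r \<le> m * dist p q + m * dist q r"
        by (metis distrib_left mult_left_mono of_nat_0_le_iff)
      with F_le[OF \<open>r \<in> S\<close>, of m p] show "F m p - m * dist p q \<le> f r + m * dist q r" by simp
    qed
    then show ?thesis by simp
  qed
  have F_lim: "(\<lambda>m. F m p) \<longlonglongrightarrow> f p" if p: "p \<in> S" for p
  proof (rule order_tendstoI)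
    fix y assume y: "y < f p"
    define c where "c = (y + f p) / 2"
    have c: "y < c" "c < f p" using y by (auto simp: c_def)
    from lsc obtain T where T: "open T" "{p \<in> S. c < f p} = S \<inter> T"
      unfolding lsc_on_def openin_open by blast
    with p c obtain e where e: "e > 0" "ball p e \<subseteq> T" using open_contains_ball by blast
    \<comment> \<open>For \<open>q\<close> within distance \<open>e\<close> of \<open>p\<close> the
      value \<open>f q\<close> already exceeds \<open>c\<close>. Farther away the penalty is at
      least \<open>m * e\<close>, which makes up the difference between the lower bound
      \<open>B\<close> and \<open>c\<close>.\<close>
    have "eventually (\<lambda>m. (c - B) / e \<le> real m) sequentially" using filterlim_real_sequentially by (simp add: filterlim_at_top)
    then show "eventually (\<lambda>m. y < F m p) sequentially"
    proof eventually_elim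
      case (elim m)
      have "c \<le> F m p"
      proof (rule le_F[OF p])
        fix q assume q: "q \<in> S"
        show "c \<le> f q + m * dist p q"
        proof (cases "dist p q < e")
          case True
          then have "q \<in> T" using e by (auto simp: subset_eq)
          then have "c < f q" using T(2) q by blast
          moreover have "0 \<le> real m * dist p q" by simp
          ultimately show ?thesis by linarith
        next
          case False
          have "c - B \<le> m * e" using elim e by (simp add: field_simps)
          also have "\<dots> \<le> m * dist p q" using False by (intro mult_left_mono) auto
          finally show ?thesis using B[OF q] by simp
        qed
      qed
      with c show ?case by simp
    qed
  next
    fix y assume "f p < y"
    then show "eventually (\<lambda>m. F m p < y) sequentially"
      using F_le[OF p, of _ p] by (intro always_eventually allI) (metis add_0_right dist_self le_less_trans mult_zero_right)
  qed
  show thesis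
  \<comment> \<open>The truncation at \<open>m\<close> makes the approximants bounded, as weak
    convergence requires. It can push them below \<open>B\<close> when \<open>m < B\<close>, hence
    the lower bound \<open>min B 0\<close>.\<close>
  proof (rule that[of "\<lambda>m p. min (F m p) m"])
    fix m p q assume pq: "p \<in> S" "q \<in> S"
    have "F m p \<le> F m q + m * dist p q" "F m q \<le> F m p + m * dist p q"
      using F_diff[OF pq, of m] F_diff[OF pq(2,1), of m] by (auto simp: dist_commute)
    then show "\<bar>min (F m p) m - min (F m q) m\<bar> \<le> m * dist p q" by (auto simp: min_def)
  next
    fix p assume p: "p \<in> S"
    have "eventually (\<lambda>m. f p \<le> real m) sequentially" using filterlim_real_sequentially by (simp add: filterlim_at_top)
    then have "eventually (\<lambda>m. F m p = min (F m p) m) sequentially"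
    proof eventually_elim
      case (elim m)
      then show ?case using F_le[OF p, of m p] by simp
    qed
    from Lim_transform_eventually[OF F_lim[OF p] this] show "(\<lambda>m. min (F m p) m) \<longlonglongrightarrow> f p" .
  next
    fix m p assume p: "p \<in> S"
    show "min (F m p) m \<le> f p" using F_le[OF p, of m p] by simp
    show "min B 0 \<le> min (F m p) m" using B_le_F[OF p, of m] by auto
  qed simp
qed

text \<open>A portmanteau inequality in which the integrand moves together with the measure. For a
  Lipschitz approximant, freezing the parameter at \<open>y0\<close> costs at most
  \<open>m * dist (y n) y0\<close> uniformly in \<open>x\<close>; what remains is a fixed bounded
  continuous integrand, to which weak convergence applies.\<close>

lemma integral_lsc_liminf:
  fixes h :: "'y::metric_space \<Rightarrow> 'x::metric_space \<Rightarrow> real"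
  assumes lsc: "lsc_on (Y \<times> X) (\<lambda>(y, x). h y x)" and B: "\<And>y x. y \<in> Y \<Longrightarrow> x \<in> X \<Longrightarrow> B \<le> h y x"
    and y: "\<And>n. y n \<in> Y" "y0 \<in> Y" "y \<longlonglongrightarrow> y0"
    and \<mu>: "\<And>n. prob_space (\<mu> n)" "prob_space \<mu>0"
    and sets: "\<And>n. sets (\<mu> n) = sets (restrict_space borel X)" "sets \<mu>0 = sets (restrict_space borel X)"
    and weak: "\<And>w::'x \<Rightarrow> real. continuous_on X w \<Longrightarrow> bounded (w ` X) \<Longrightarrow>
                  (\<lambda>n. \<integral>x. w x \<partial>\<mu> n) \<longlonglongrightarrow> (\<integral>x. w x \<partial>\<mu>0)"
    and int: "\<And>n. integrable (\<mu> n) (h (y n))" "integrable \<mu>0 (h y0)"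
    and c: "c < (\<integral>x. h y0 x \<partial>\<mu>0)"
  shows "eventually (\<lambda>n. c < (\<integral>x. h (y n) x \<partial>\<mu> n)) sequentially"
proof -
  have B': "B \<le> (\<lambda>(y, x). h y x) p" if "p \<in> Y \<times> X" for p
    using B that by auto
  obtain G where G: "\<And>m p. p \<in> Y \<times> X \<Longrightarrow> min B 0 \<le> G m p" "\<And>m p. G m p \<le> real m"
      "\<And>m p. p \<in> Y \<times> X \<Longrightarrow> G m p \<le> (\<lambda>(y, x). h y x) p"
      "\<And>m p q. p \<in> Y \<times> X \<Longrightarrow> q \<in> Y \<times> X \<Longrightarrow> \<bar>G m p - G m q\<bar> \<le> m * dist p q"
      "\<And>p. p \<in> Y \<times> X \<Longrightarrow> (\<lambda>m. G m p) \<longlonglongrightarrow> (\<lambda>(y, x). h y x) p"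
    using lsc_on_Lipschitz_approx[OF lsc B'] by metis
  have space: "space (\<mu> n) = X" "space \<mu>0 = X" for n
    using sets_eq_imp_space_eq[OF sets(1)] sets_eq_imp_space_eq[OF sets(2)] by (auto simp: space_restrict_space)
  have cont: "continuous_on X (\<lambda>x. G m (v, x))" if "v \<in> Y" for m v
  proof (rule continuous_onI)
    fix x e assume x: "x \<in> X" and e: "(0::real) < e"
    show "\<exists>d>0. \<forall>x'\<in>X. dist x' x < d \<longrightarrow> dist (G m (v, x')) (G m (v, x)) \<le> e"
    proof (intro exI conjI ballI impI)
      show "0 < e / (real m + 1)" using e by simp
      fix x' assume x': "x' \<in> X" "dist x' x < e / (real m + 1)"
      have "dist (G m (v, x')) (G m (v, x)) \<le> m * dist x' x"
        using G(4)[of "(v, x')" "(v, x)" m] that x x' by (simp add: dist_real_def dist_Pair_Pair)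
      also have "\<dots> \<le> (m + 1) * dist x' x" by (simp add: algebra_simps)
      also have "\<dots> \<le> e" using x'(2) by (simp add: field_simps)
      finally show "dist (G m (v, x')) (G m (v, x)) \<le> e" .
    qed
  qed
  have bdd: "\<bar>G m (v, x)\<bar> \<le> \<bar>B\<bar> + m" if "v \<in> Y" "x \<in> X" for m v x
    using G(1)[of "(v, x)" m] G(2)[of m "(v, x)"] that by auto
  have meas: "(\<lambda>x. G m (v, x)) \<in> borel_measurable N"
    if "v \<in> Y" "sets N = sets (restrict_space borel X)" for m v N
    using borel_measurable_continuous_on_restrict[OF cont[OF that(1)]]
    by (simp add: measurable_cong_sets[OF that(2) refl])
  have intG: "integrable N (\<lambda>x. G m (v, x))"
    if "v \<in> Y" "sets N = sets (restrict_space borel X)" "prob_space N" for m v N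
  proof -
    interpret N: prob_space N by fact
    show ?thesis using meas[OF that(1,2)] bdd[OF that(1)] sets_eq_imp_space_eq[OF that(2)]
      by (intro N.integrable_const_bound[of _ "\<bar>B\<bar> + m"] AE_I2) (auto simp: space_restrict_space)
  qed
  \<comment> \<open>Under the limit measure the approximants exhaust \<open>h y0\<close>, so one
    fixed \<open>m\<close> already has integral above \<open>c\<close>.\<close>
  have "(\<lambda>m. \<integral>x. G m (y0, x) \<partial>\<mu>0) \<longlonglongrightarrow> (\<integral>x. h y0 x \<partial>\<mu>0)"
  proof (rule integral_dominated_convergence[where w="\<lambda>x. \<bar>B\<bar> + \<bar>h y0 x\<bar>"])
    interpret prob_space \<mu>0 by fact
    show "integrable \<mu>0 (\<lambda>x. \<bar>B\<bar> + \<bar>h y0 x\<bar>)" using int(2) by auto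
    show "AE x in \<mu>0. (\<lambda>m. G m (y0, x)) \<longlonglongrightarrow> h y0 x"
      using G(5)[of "(y0, _)"] y(2) space by (intro AE_I2) auto
    show "AE x in \<mu>0. norm (G m (y0, x)) \<le> \<bar>B\<bar> + \<bar>h y0 x\<bar>" for m
      using G(1,3)[of "(y0, _)" m] y(2) space by (intro AE_I2) (fastforce simp: abs_if)
  qed (use meas y(2) sets int(2) in auto)
  from order_tendstoD(1)[OF this c] obtain m where m: "c < (\<integral>x. G m (y0, x) \<partial>\<mu>0)"
    by (force simp: eventually_sequentially)
  have w: "(\<lambda>n. \<integral>x. G m (y0, x) \<partial>\<mu> n) \<longlonglongrightarrow> (\<integral>x. G m (y0, x) \<partial>\<mu>0)"
    using cont[OF y(2)] bdd[OF y(2)] by (intro weak boundedI[of _ "\<bar>B\<bar> + m"]) auto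
  have "(\<lambda>n. (\<integral>x. G m (y0, x) \<partial>\<mu> n) - m * dist (y n) y0) \<longlonglongrightarrow> (\<integral>x. G m (y0, x) \<partial>\<mu>0) - m * dist y0 y0"
    by (intro tendsto_intros w y(3))
  then have "eventually (\<lambda>n. c < (\<integral>x. G m (y0, x) \<partial>\<mu> n) - m * dist (y n) y0) sequentially"
    using m by (intro order_tendstoD(1)) auto
  then show ?thesis
  proof eventually_elim
    case (elim n)
    interpret \<mu>: prob_space "\<mu> n" by fact
    have "(\<integral>x. G m (y0, x) \<partial>\<mu> n) - m * dist (y n) y0 = (\<integral>x. G m (y0, x) - m * dist (y n) y0 \<partial>\<mu> n)"
      using intG[OF y(2) sets(1) \<mu>(1), of n m] by (simp add: \<mu>.prob_space)
    also have "\<dots> \<le> (\<integral>x. h (y n) x \<partial>\<mu> n)"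
    proof (rule integral_mono)
      fix x assume "x \<in> space (\<mu> n)"
      then have "x \<in> X" by (simp add: space)
      then show "G m (y0, x) - m * dist (y n) y0 \<le> h (y n) x"
        using G(4)[of "(y n, x)" "(y0, x)" m] G(3)[of "(y n, x)" m] y by (force simp: dist_Pair_Pair)
    qed (use intG[OF y(2) sets(1) \<mu>(1), of n m] int(1) in auto)
    finally show ?case using elim by simp
  qed
qed

subsection \<open>Measurable selection of minimizers\<close>

definition argmin_set :: "('s \<Rightarrow> 'a set) \<Rightarrow> ('s \<Rightarrow> 'a \<Rightarrow> real) \<Rightarrow> 's \<Rightarrow> 'a set" where
  "argmin_set E L s = {a \<in> E s. \<forall>b\<in>E s. L s a \<le> L s b}"

lemma argmin_set_compact_nonempty:
  fixes E :: "'s \<Rightarrow> 'a::t2_space set"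
  assumes E: "compact (E s)" "E s \<noteq> {}" and sub: "\<And>q. closed {a \<in> E s. L s a \<le> q}"
  shows "compact (argmin_set E L s)" "argmin_set E L s \<noteq> {}"
proof -
  obtain a where a: "a \<in> E s" "\<forall>b\<in>E s. L s a \<le> L s b"
    using lsc_sublevels_attains_inf[OF E, of "L s"] sub by blast
  then show "argmin_set E L s \<noteq> {}" by (auto simp: argmin_set_def)
  from a have "argmin_set E L s = E s \<inter> {b \<in> E s. L s b \<le> L s a}"
    by (auto simp: argmin_set_def intro: order_trans)
  then show "compact (argmin_set E L s)" using compact_Int_closed[OF E(1) sub] by simp
qed

text \<open>The minimizers miss \<open>F\<close> exactly when some rational level is reached on
  \<open>E s\<close> but not on \<open>E s \<inter> F\<close>: the minimum over
  \<open>E s \<inter> F\<close> is attained, hence strictly larger, and a rational fits in the gap.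
  This writes the complement as a countable union of measurable sets.\<close>

lemma argmin_set_hits_measurable:
  fixes E :: "'s \<Rightarrow> 'a::t2_space set"
  assumes E: "\<And>s. s \<in> space M \<Longrightarrow> compact (E s)" "\<And>s. s \<in> space M \<Longrightarrow> E s \<noteq> {}"
    and sub: "\<And>s q. s \<in> space M \<Longrightarrow> closed {a \<in> E s. L s a \<le> q}"
    and meas: "\<And>q F. closed F \<Longrightarrow> {s \<in> space M. \<exists>a\<in>E s \<inter> F. L s a \<le> q} \<in> sets M"
    and F: "closed F"
  shows "{s \<in> space M. argmin_set E L s \<inter> F \<noteq> {}} \<in> sets M"
proof -
  let ?A = "\<lambda>q F. {s \<in> space M. \<exists>a\<in>E s \<inter> F. L s a \<le> q}"
  have "argmin_set E L s \<inter> F = {} \<longleftrightarrow> s \<in> (\<Union>q\<in>\<rat>. ?A q UNIV - ?A q F)" if s: "s \<in> space M" for s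
  proof
    assume *: "argmin_set E L s \<inter> F = {}"
    obtain a where a: "a \<in> E s" using E(2)[OF s] by blast
    show "s \<in> (\<Union>q\<in>\<rat>. ?A q UNIV - ?A q F)"
    proof (cases "E s \<inter> F = {}")
      case True
      obtain q where "q \<in> \<rat>" "L s a \<le> q" using Rats_dense_in_real[of "L s a" "L s a + 1"] by auto
      with a s True show ?thesis by auto
    next
      case False
      have "{b \<in> E s \<inter> F. L s b \<le> q} = {b \<in> E s. L s b \<le> q} \<inter> F" for q by auto
      then have "closed {b \<in> E s \<inter> F. L s b \<le> q}" for q using sub[OF s, of q] F by auto
      from lsc_sublevels_attains_inf[OF compact_Int_closed[OF E(1)[OF s] F] False this]
      obtain b where b: "b \<in> E s \<inter> F" "\<forall>c\<in>E s \<inter> F. L s b \<le> L s c" by blast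
      with * have "b \<notin> argmin_set E L s" by blast
      with b obtain c where c: "c \<in> E s" "L s c < L s b" by (auto simp: argmin_set_def not_le)
      from Rats_dense_in_real[OF c(2)] obtain q where "q \<in> \<rat>" "L s c < q" "q < L s b" by blast
      with b c s show ?thesis by (intro UN_I[of q]) force+
    qed
  next
    assume "s \<in> (\<Union>q\<in>\<rat>. ?A q UNIV - ?A q F)"
    then obtain q c where qc: "c \<in> E s" "L s c \<le> q" "\<And>a. a \<in> E s \<inter> F \<Longrightarrow> \<not> L s a \<le> q" by auto
    show "argmin_set E L s \<inter> F = {}"
    proof (rule ccontr)
      assume "argmin_set E L s \<inter> F \<noteq> {}"
      then obtain a where "a \<in> E s \<inter> F" "L s a \<le> L s c"
        using qc(1) by (auto simp: argmin_set_def)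
      with qc(2) qc(3)[of a] show False by simp
    qed
  qed
  then have "{s \<in> space M. argmin_set E L s \<inter> F \<noteq> {}} = space M - (\<Union>q\<in>\<rat>. ?A q UNIV - ?A q F)"
    by blast
  moreover have "(\<Union>q\<in>\<rat>. ?A q UNIV - ?A q F) \<in> sets M"
    using meas[OF F] meas[OF closed_UNIV] by (intro sets.countable_UN'' countable_rat sets.Diff) auto
  ultimately show ?thesis by auto
qed

text \<open>A selector is obtained by minimizing lexicographically: first \<open>L s\<close>, then the distances to
  the points of a dense sequence. The latter are measurable functions of the parameter, and they
  determine the selector as a measurable map.\<close>

lemma measurable_argmin_selector:
  fixes E :: "'s \<Rightarrow> 'a::polish_space set" and L :: "'s \<Rightarrow> 'a \<Rightarrow> real"
  assumes E: "\<And>s. s \<in> space M \<Longrightarrow> compact (E s)" "\<And>s. s \<in> space M \<Longrightarrow> E s \<noteq> {}"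
    and sub: "\<And>s q. s \<in> space M \<Longrightarrow> closed {a \<in> E s. L s a \<le> q}"
    and meas: "\<And>q F. closed F \<Longrightarrow> {s \<in> space M. \<exists>a\<in>E s \<inter> F. L s a \<le> q} \<in> sets M"
  obtains g where "g \<in> borel_measurable M"
    "\<And>s. s \<in> space M \<Longrightarrow> g s \<in> E s" "\<And>s b. s \<in> space M \<Longrightarrow> b \<in> E s \<Longrightarrow> L s (g s) \<le> L s b"
proof -
  obtain Q :: "'a set" where Q: "countable Q" "\<And>X. open X \<Longrightarrow> X \<noteq> {} \<Longrightarrow> \<exists>d\<in>Q. d \<in> X"
    using countable_dense_setE by blast
  then have "Q \<noteq> {}" by (metis empty_iff open_UNIV UNIV_not_empty)
  define p where "p = from_nat_into Q"
  have p: "range p = Q" unfolding p_def using Q(1) \<open>Q \<noteq> {}\<close> by (rule range_from_nat_into[rotated])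
  define A where "A = rec_nat (argmin_set E L) (\<lambda>k B. argmin_set B (\<lambda>s. dist (p k)))"
  have A: "A 0 = argmin_set E L" "A (Suc k) = argmin_set (A k) (\<lambda>s. dist (p k))" for k
    by (simp_all add: A_def)
  \<comment> \<open>Measurable hitting of closed sets is the property that reproduces itself: the
    sublevel condition on \<open>dist (p k)\<close> is absorbed by testing \<open>A k\<close>
    against \<open>F \<inter> cball (p k) q\<close>.\<close>
  have inv: "(\<forall>s\<in>space M. compact (A k s) \<and> A k s \<noteq> {}) \<and>
      (\<forall>F. closed F \<longrightarrow> {s \<in> space M. A k s \<inter> F \<noteq> {}} \<in> sets M)" for k
  proof (induction k)
    case 0
    then show ?case unfolding A
      using argmin_set_compact_nonempty[of E _ L, OF E sub] argmin_set_hits_measurable[OF E sub meas] by auto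
  next
    case (Suc k)
    have sub': "closed {a \<in> A k s. dist (p k) a \<le> q}" if "s \<in> space M" for s q
    proof -
      have "{a \<in> A k s. dist (p k) a \<le> q} = A k s \<inter> cball (p k) q" by auto
      with Suc that show ?thesis by (auto intro: compact_imp_closed)
    qed
    have meas': "{s \<in> space M. \<exists>a\<in>A k s \<inter> F. dist (p k) a \<le> q} \<in> sets M" if "closed F" for q F
    proof -
      have "{s \<in> space M. \<exists>a\<in>A k s \<inter> F. dist (p k) a \<le> q} =
          {s \<in> space M. A k s \<inter> (F \<inter> cball (p k) q) \<noteq> {}}" by auto
      with Suc that show ?thesis by (simp add: closed_Int)
    qed
    show ?case unfolding A
      using argmin_set_compact_nonempty[of "A k" _ "\<lambda>s. dist (p k)", OF _ _ sub']
        argmin_set_hits_measurable[of M "A k", OF _ _ sub' meas'] Suc by auto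
  qed
  have dec: "A (Suc k) s \<subseteq> A k s" for k s unfolding A argmin_set_def by auto
  have dec': "A n s \<subseteq> A k s" if "k \<le> n" for k n s
    using that dec by (induction rule: dec_induct) blast+
  \<comment> \<open>The sets \<open>A k s\<close> decrease and are compact and nonempty, so they
    have a common point.\<close>
  have "\<exists>a. \<forall>k. a \<in> A k s" if s: "s \<in> space M" for s
  proof -
    have "A 0 s \<inter> (\<Inter>k\<in>UNIV. A k s) \<noteq> {}"
    proof (rule compact_imp_fip_image)
      fix I :: "nat set" assume I: "finite I" "I \<subseteq> UNIV"
      have "A (Max (insert 0 I)) s \<subseteq> A 0 s \<inter> (\<Inter>k\<in>I. A k s)"
        using I dec'[of _ "Max (insert 0 I)" s] by (intro Int_greatest INT_greatest) auto
      moreover have "A (Max (insert 0 I)) s \<noteq> {}" using inv s by simp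
      ultimately show "A 0 s \<inter> (\<Inter>k\<in>I. A k s) \<noteq> {}" by force
    qed (use inv s in \<open>auto intro: compact_imp_closed\<close>)
    then show ?thesis by blast
  qed
  then obtain g where g: "\<And>s k. s \<in> space M \<Longrightarrow> g s \<in> A k s" by metis
  \<comment> \<open>As a member of \<open>A (Suc k) s\<close>, the point \<open>g s\<close> realizes
    the distance from \<open>p k\<close> to \<open>A k s\<close>. It lies within \<open>r\<close> of
    \<open>p k\<close> exactly when \<open>A k s\<close> meets that ball.\<close>
  have g_cball: "{s \<in> space M. dist (p k) (g s) \<le> r} \<in> sets M" for k r
  proof -
    have "dist (p k) (g s) \<le> r \<longleftrightarrow> A k s \<inter> cball (p k) r \<noteq> {}" if "s \<in> space M" for s
      using g[OF that, of k] g[OF that, of "Suc k"] unfolding A argmin_set_def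
      by (auto intro: order_trans)
    then have "{s \<in> space M. dist (p k) (g s) \<le> r} = {s \<in> space M. A k s \<inter> cball (p k) r \<noteq> {}}"
      by auto
    with inv show ?thesis by simp
  qed
  have "g \<in> borel_measurable M"
  proof (rule borel_measurableI)
    fix W :: "'a set" assume W: "open W"
    let ?I = "{(k, q). q \<in> \<rat> \<and> cball (p k) q \<subseteq> W}"
    have "g -` W \<inter> space M = (\<Union>(k, q)\<in>?I. {s \<in> space M. dist (p k) (g s) \<le> q})"
    proof (intro equalityI subsetI)
      fix s assume s: "s \<in> g -` W \<inter> space M"
      with W obtain e where e: "e > 0" "ball (g s) e \<subseteq> W" by (force simp: open_contains_ball)
      obtain k where k: "dist (g s) (p k) < e / 3"
        using Q(2)[of "ball (g s) (e / 3)"] e p by auto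
      \<comment> \<open>A radius above \<open>e / 3\<close> puts \<open>g s\<close> into the ball
        around \<open>p k\<close>; a radius below \<open>2 * e / 3\<close> keeps that ball within
        distance \<open>e\<close> of \<open>g s\<close>.\<close>
      obtain q where q: "q \<in> \<rat>" "e / 3 < q" "q < 2 * e / 3"
        using Rats_dense_in_real[of "e / 3" "2 * e / 3"] e by auto
      have "cball (p k) q \<subseteq> ball (g s) e"
      proof
        fix a assume "a \<in> cball (p k) q"
        then show "a \<in> ball (g s) e"
          using dist_triangle[of "g s" a "p k"] k q by (simp add: dist_commute)
      qed
      with s e k q show "s \<in> (\<Union>(k, q)\<in>?I. {s \<in> space M. dist (p k) (g s) \<le> q})"
        by (intro UN_I[of "(k, q)"]) (auto simp: dist_commute)
    next
      fix s assume "s \<in> (\<Union>(k, q)\<in>?I. {s \<in> space M. dist (p k) (g s) \<le> q})"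
      then show "s \<in> g -` W \<inter> space M" by (force simp: subset_eq)
    qed
    moreover have "countable ?I"
      by (rule countable_subset[of _ "UNIV \<times> \<rat>"]) (auto intro: countable_SIGMA countable_rat)
    ultimately show "g -` W \<inter> space M \<in> sets M"
      using g_cball by (auto intro!: sets.countable_UN'')
  qed
  moreover have "g s \<in> argmin_set E L s" if "s \<in> space M" for s
    using g[OF that, of 0] by (simp add: A)
  ultimately show thesis
    by (intro that[of g]) (auto simp: argmin_set_def)
qed

subsection \<open>The augmented Markov decision process\<close>

lemma tendsto_vec_times:
  fixes f g :: "'b \<Rightarrow> real^'i"
  assumes "(f \<longlongrightarrow> a) F" "(g \<longlongrightarrow> b) F" shows "((\<lambda>x. f x * g x) \<longlongrightarrow> a * b) F"
  by (rule vec_tendstoI) (auto intro!: tendsto_mult tendsto_vec_nth assms)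

lemma continuous_on_vec_times:
  fixes f g :: "'b::topological_space \<Rightarrow> real^'i"
  shows "continuous_on S f \<Longrightarrow> continuous_on S g \<Longrightarrow> continuous_on S (\<lambda>x. f x * g x)"
  unfolding continuous_on_def by (blast intro: tendsto_vec_times)

lemma borel_measurable_vecI:
  fixes f :: "'b \<Rightarrow> real^'i"
  assumes "\<And>i. (\<lambda>x. f x $ i) \<in> borel_measurable M" shows "f \<in> borel_measurable M"
  using assms by (subst borel_measurable_euclidean_space) (auto simp: Basis_vec_def inner_axis)

lemma borel_measurable_vec_nth [measurable (raw)]:
  fixes f :: "'b \<Rightarrow> real^'i"
  assumes "f \<in> borel_measurable M" shows "(\<lambda>x. f x $ i) \<in> borel_measurable M"
  using assms by (intro borel_measurable_continuous_on[where f="\<lambda>x. x $ i"] continuous_intros)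

lemma borel_measurable_vec_times [measurable (raw)]:
  fixes f g :: "'b \<Rightarrow> real^'i"
  assumes [measurable]: "f \<in> borel_measurable M" "g \<in> borel_measurable M"
  shows "(\<lambda>x. f x * g x) \<in> borel_measurable M"
  by (rule borel_measurable_vecI) simp

lemma power_vec_nth: "(x ^ n) $ i = (x $ i) ^ n" for x :: "real^'i"
  by (induction n) auto

lemma vec_le_iff: "x \<le> y \<longleftrightarrow> (\<forall>i. x $ i \<le> y $ i)" for x y :: "real^'i"
  by (simp add: less_eq_vec_def)

text \<open>\<open>Xs_ne\<close> sets aside the empty state space, which is settled directly at the
  end. A state and an admissible action are what yield \<open>c_lo \<le> c_hi\<close> from the cost
  bounds.\<close>

locale exp_utility_mdp =
  fixes Xs :: "'x::polish_space set" and As :: "'a::polish_space set"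
    and D :: "('x \<times> 'a) set"
    and P :: "'x \<Rightarrow> 'a \<Rightarrow> 'x measure"
    and U :: "(real^'i::finite) \<Rightarrow> real"
    and C :: "'x \<Rightarrow> 'a \<Rightarrow> 'x \<Rightarrow> (real^'i)"
    and \<beta> :: "(real^'i)"
    and c_lo c_hi :: real
  assumes Xs_ne: "Xs \<noteq> {}"
    and D_sub: "D \<subseteq> Xs \<times> As"
    and D_ne: "\<forall>x \<in> Xs. sect D x \<noteq> {}"
    and P_kernel: "(\<lambda>(x, a). P x a) \<in> measurable (restrict_space borel D)
                      (subprob_algebra (restrict_space borel Xs))"
    and P_prob: "\<forall>(x, a) \<in> D. prob_space (P x a)"
    and beta: "\<forall>i. 0 < \<beta> $ i \<and> \<beta> $ i < 1"
    and U_cont: "continuous_on {d. \<forall>i. 0 \<le> d $ i} U"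
    and U_mono: "\<forall>d d'. (\<forall>i. 0 \<le> d $ i) \<longrightarrow> d \<le> d' \<longrightarrow> U d \<le> U d'"
    and D_compact: "\<forall>x \<in> Xs. compact (sect D x)"
    and D_acc: "\<forall>xs x as. (\<forall>n. xs n \<in> Xs) \<longrightarrow> x \<in> Xs \<longrightarrow> xs \<longlonglongrightarrow> x \<longrightarrow>
                   (\<forall>n. as n \<in> sect D (xs n)) \<longrightarrow>
                   (\<exists>a \<in> sect D x. \<exists>r. strict_mono r \<and> (as \<circ> r) \<longlonglongrightarrow> a)"
    and C_lsc: "\<forall>i. lsc_on (Xs \<times> As \<times> Xs) (\<lambda>(x, a, x'). C x a x' $ i)"
    and c_pos: "0 < c_lo"
    and C_bounds: "\<forall>x \<in> Xs. \<forall>a \<in> As. \<forall>x' \<in> Xs. \<forall>i. c_lo \<le> C x a x' $ i \<and> C x a x' $ i \<le> c_hi"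
    and P_weak: "\<forall>w. continuous_on Xs w \<and> bounded (w ` Xs) \<longrightarrow>
                   continuous_on D (\<lambda>(x, a). \<integral>x'. (w x' :: real) \<partial>P x a)"
begin

abbreviation BX where "BX \<equiv> restrict_space borel Xs"
abbreviation BA where "BA \<equiv> restrict_space borel As"
abbreviation Aug :: "('x \<times> (real^'i) \<times> (real^'i)) set" where "Aug \<equiv> aug_states Xs"
abbreviation T where "T \<equiv> T_op D P C \<beta>"

definition step :: "'x \<times> (real^'i) \<times> (real^'i) \<Rightarrow> 'a \<Rightarrow> 'x \<Rightarrow> 'x \<times> (real^'i) \<times> (real^'i)" where
  "step s a x' = (x', snd (snd s) * C (fst s) a x' + fst (snd s), snd (snd s) * \<beta>)"

text \<open>The action-value function of dynamic programming: act once with \<open>a\<close>, then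
  collect \<open>v\<close>.\<close>

definition L :: "('x \<times> (real^'i) \<times> (real^'i) \<Rightarrow> real) \<Rightarrow> 'x \<times> (real^'i) \<times> (real^'i) \<Rightarrow> 'a \<Rightarrow> real" where
  "L v s a = (\<integral>x'. v (step s a x') \<partial>P (fst s) a)"

text \<open>The upper bound, added to the conditions of \<open>Delta\<close>, makes \<open>v\<close>
  bounded over all successors of a given state. This gives integrability, and the bound is inherited
  by \<open>T v\<close>.\<close>

definition Delta_le :: "('x \<times> (real^'i) \<times> (real^'i) \<Rightarrow> real) set" where
  "Delta_le = {v \<in> Delta Xs U. \<forall>s\<in>Aug. v s \<le> bfun U \<beta> c_hi s}"

lemma T_eq_L: "T v s = (INF a\<in>sect D (fst s). L v s a)"
  by (cases s) (simp add: T_op_def L_def step_def)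

lemma T_g_eq_L: "T_g P C \<beta> g v s = L v s (g s)"
  by (cases s) (simp add: T_g_def L_def step_def)

lemma sectD: assumes "a \<in> sect D x" shows "(x, a) \<in> D" "x \<in> Xs" "a \<in> As"
  using assms D_sub by (auto simp: sect_def)

lemma c_hi: "c_lo \<le> c_hi" "0 < c_hi"
proof -
  obtain x a where "x \<in> Xs" "a \<in> sect D x" using Xs_ne D_ne by blast
  then have "c_lo \<le> C x a x $ undefined" "C x a x $ undefined \<le> c_hi" using sectD C_bounds by auto
  then show "c_lo \<le> c_hi" "0 < c_hi" using c_pos by auto
qed

lemma C_le: "x \<in> Xs \<Longrightarrow> a \<in> As \<Longrightarrow> x' \<in> Xs \<Longrightarrow> C x a x' $ i \<le> c_hi"
  and C_ge: "x \<in> Xs \<Longrightarrow> a \<in> As \<Longrightarrow> x' \<in> Xs \<Longrightarrow> c_lo \<le> C x a x' $ i"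
  and C_nonneg: "x \<in> Xs \<Longrightarrow> a \<in> As \<Longrightarrow> x' \<in> Xs \<Longrightarrow> 0 \<le> C x a x' $ i"
  using C_bounds c_pos by (auto intro: order_trans less_imp_le)

lemma AugI: "x \<in> Xs \<Longrightarrow> (\<And>i. 0 \<le> d $ i) \<Longrightarrow> (\<And>i. 0 < z $ i) \<Longrightarrow> (\<And>i. z $ i \<le> 1) \<Longrightarrow> (x, d, z) \<in> Aug"
  by (simp add: aug_states_def)

lemma AugD:
  assumes "s \<in> Aug"
  shows "fst s \<in> Xs" "0 \<le> fst (snd s) $ i" "0 < snd (snd s) $ i" "snd (snd s) $ i \<le> 1"
    "0 \<le> snd (snd s) $ i"
  using assms by (auto simp: aug_states_def less_imp_le)

lemma U_monoD: "(\<And>i. 0 \<le> d $ i) \<Longrightarrow> (\<And>i. d $ i \<le> d' $ i) \<Longrightarrow> U d \<le> U d'"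
  using U_mono by (simp add: vec_le_iff)

lemma step_Aug:
  assumes s: "s \<in> Aug" and a: "a \<in> As" and x': "x' \<in> Xs"
  shows "step s a x' \<in> Aug"
  unfolding step_def
proof (rule AugI[OF x'])
  fix i
  show "0 \<le> (snd (snd s) * C (fst s) a x' + fst (snd s)) $ i"
    using AugD(1)[OF s] AugD(2,3)[OF s, of i] C_nonneg[OF _ a x', of "fst s"] by simp
  show "0 < (snd (snd s) * \<beta>) $ i" using AugD(3)[OF s, of i] beta by simp
  show "(snd (snd s) * \<beta>) $ i \<le> 1"
    using AugD(3,4)[OF s, of i] beta[rule_format, of i] by (simp add: mult_le_one)
qed

section \<open>Measurability of the kernel, the cost and the augmented transition\<close>

lemma space_BX: "space BX = Xs" and space_BA: "space BA = As"
  by (simp_all add: space_restrict_space)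

lemma P_facts:
  assumes "a \<in> sect D x"
  shows "prob_space (P x a)" "sets (P x a) = sets BX" "space (P x a) = Xs"
proof -
  have "(x, a) \<in> space (restrict_space borel D)" using sectD(1)[OF assms] by (simp add: space_restrict_space)
  from subprob_measurableD(2)[OF P_kernel this] show "sets (P x a) = sets BX" by simp
  from sets_eq_imp_space_eq[OF this] show "space (P x a) = Xs" by (simp add: space_BX)
  show "prob_space (P x a)" using P_prob sectD(1)[OF assms] by auto
qed

lemma measurable_C [measurable (raw)]:
  assumes [measurable]: "f \<in> M \<rightarrow>\<^sub>M BX" "g \<in> M \<rightarrow>\<^sub>M BA" "h \<in> M \<rightarrow>\<^sub>M BX"
  shows "(\<lambda>\<omega>. C (f \<omega>) (g \<omega>) (h \<omega>)) \<in> borel_measurable M"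
proof (rule borel_measurable_vecI)
  fix i
  have [measurable]: "f \<in> borel_measurable M" "g \<in> borel_measurable M" "h \<in> borel_measurable M"
    using assms by (auto simp: measurable_restrict_space2_iff)
  have "(\<lambda>\<omega>. (f \<omega>, g \<omega>, h \<omega>)) \<in> M \<rightarrow>\<^sub>M restrict_space borel (Xs \<times> As \<times> Xs)"
    using assms[THEN measurable_space] by (intro measurable_restrict_space2) (auto simp: space_BX space_BA)
  from measurable_compose[OF this lsc_on_borel_measurable[OF C_lsc[rule_format, of i]]]
  show "(\<lambda>\<omega>. C (f \<omega>) (g \<omega>) (h \<omega>) $ i) \<in> borel_measurable M" by simp
qed

lemma measurable_aug_space:
  assumes "f \<in> M \<rightarrow>\<^sub>M BX" "g \<in> borel_measurable M" "h \<in> borel_measurable M"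
    and "\<And>\<omega>. \<omega> \<in> space M \<Longrightarrow> (f \<omega>, g \<omega>, h \<omega>) \<in> Aug"
  shows "(\<lambda>\<omega>. (f \<omega>, g \<omega>, h \<omega>)) \<in> M \<rightarrow>\<^sub>M aug_space Xs"
  unfolding aug_space_def
  using assms by (intro measurable_restrict_space2 borel_measurable_Pair) (auto simp: measurable_restrict_space2_iff)

lemma measurable_step:
  assumes s: "s \<in> M \<rightarrow>\<^sub>M aug_space Xs" and [measurable]: "a \<in> M \<rightarrow>\<^sub>M BA" "x' \<in> M \<rightarrow>\<^sub>M BX"
  shows "(\<lambda>\<omega>. step (s \<omega>) (a \<omega>) (x' \<omega>)) \<in> M \<rightarrow>\<^sub>M aug_space Xs"
proof -
  have s_Aug: "s \<omega> \<in> Aug" if "\<omega> \<in> space M" for \<omega>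
    using s that unfolding aug_space_def by (auto simp: measurable_restrict_space2_iff)
  have [measurable]: "s \<in> borel_measurable M" using s unfolding aug_space_def by (auto simp: measurable_restrict_space2_iff)
  have [measurable]: "(\<lambda>\<omega>. fst (s \<omega>)) \<in> M \<rightarrow>\<^sub>M BX"
    using AugD(1)[OF s_Aug] by (intro measurable_restrict_space2 borel_measurable_continuous_on[of fst]) (auto intro: continuous_intros)
  have [measurable]: "(\<lambda>\<omega>. fst (snd (s \<omega>))) \<in> borel_measurable M" "(\<lambda>\<omega>. snd (snd (s \<omega>))) \<in> borel_measurable M"
    by (intro borel_measurable_continuous_on[where f="\<lambda>s. fst (snd s)"]
          borel_measurable_continuous_on[where f="\<lambda>s. snd (snd s)"] continuous_intros; measurable)+
  show ?thesis unfolding step_def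
    using step_Aug[OF s_Aug, unfolded step_def] measurable_space[OF assms(2)] measurable_space[OF assms(3)]
    by (intro measurable_aug_space) (auto simp: space_BX space_BA)
qed

text \<open>Here c / (1 - \<beta>) is the total of a constant cost \<open>c\<close>. Paying at most
  \<open>c\<close> now and \<open>c\<close> ever after, discounted by \<beta>, is no more than
  paying \<open>c\<close> forever: \<beta> t + c = t for t = c / (1 - \<beta>).\<close>

lemma step_le_ub:
  assumes "s \<in> Aug" "a \<in> As" "x' \<in> Xs" "0 \<le> c" "C (fst s) a x' $ i \<le> c"
  shows "snd (snd (step s a x')) $ i * (c / (1 - \<beta> $ i)) + fst (snd (step s a x')) $ i
     \<le> snd (snd s) $ i * (c / (1 - \<beta> $ i)) + fst (snd s) $ i"
proof -
  have "snd (snd s) $ i * (\<beta> $ i * (c / (1 - \<beta> $ i)) + C (fst s) a x' $ i)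
      \<le> snd (snd s) $ i * (\<beta> $ i * (c / (1 - \<beta> $ i)) + c)"
    using assms AugD(3)[OF assms(1), of i] by (intro mult_left_mono) auto
  also have "\<beta> $ i * (c / (1 - \<beta> $ i)) + c = c / (1 - \<beta> $ i)"
    using beta[rule_format, of i] by (simp add: field_simps)
  finally show ?thesis by (simp add: step_def algebra_simps)
qed

lemma step_ge_lb:
  assumes "s \<in> Aug" "c \<le> C (fst s) a x' $ i"
  shows "snd (snd s) $ i * (c / (1 - \<beta> $ i)) + fst (snd s) $ i
     \<le> snd (snd (step s a x')) $ i * (c / (1 - \<beta> $ i)) + fst (snd (step s a x')) $ i"
proof -
  have "snd (snd s) $ i * (\<beta> $ i * (c / (1 - \<beta> $ i)) + c)
      \<le> snd (snd s) $ i * (\<beta> $ i * (c / (1 - \<beta> $ i)) + C (fst s) a x' $ i)"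
    using assms AugD(3)[OF assms(1), of i] by (intro mult_left_mono) auto
  also have "\<beta> $ i * (c / (1 - \<beta> $ i)) + c = c / (1 - \<beta> $ i)"
    using beta[rule_format, of i] by (simp add: field_simps)
  finally show ?thesis by (simp add: step_def algebra_simps)
qed

lemma bfun_eq: "bfun U \<beta> c s = U (snd (snd s) * (\<chi> i. c / (1 - \<beta> $ i)) + fst (snd s))"
  by (cases s) (simp add: bfun_def)

lemma bfun_arg_nonneg:
  assumes "s \<in> Aug" "0 \<le> c"
  shows "0 \<le> (snd (snd s) * (\<chi> i. c / (1 - \<beta> $ i)) + fst (snd s)) $ i"
  using AugD(2,3)[OF assms(1), of i] assms(2) beta[rule_format, of i] by (auto intro!: add_nonneg_nonneg)

text \<open>The supersolution property holds along every single transition, before any integration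
  over \<open>x'\<close>; \<open>bfun_lo_step\<close> is the matching subsolution property.\<close>

lemma bfun_hi_step: "s \<in> Aug \<Longrightarrow> a \<in> As \<Longrightarrow> x' \<in> Xs \<Longrightarrow> bfun U \<beta> c_hi (step s a x') \<le> bfun U \<beta> c_hi s"
  unfolding bfun_eq using bfun_arg_nonneg[OF step_Aug, of s a x' c_hi] step_le_ub[of s a x' c_hi] c_hi(2) C_le[of "fst s" a x'] AugD(1)[of s]
  by (intro U_monoD) auto

lemma bfun_lo_step: "s \<in> Aug \<Longrightarrow> a \<in> As \<Longrightarrow> x' \<in> Xs \<Longrightarrow> bfun U \<beta> c_lo s \<le> bfun U \<beta> c_lo (step s a x')"
  unfolding bfun_eq using bfun_arg_nonneg[of s c_lo] step_ge_lb[of s c_lo a x'] c_pos C_ge[of "fst s" a x'] AugD(1)[of s]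
  by (intro U_monoD) auto

lemma Ufun_step: "s \<in> Aug \<Longrightarrow> a \<in> As \<Longrightarrow> x' \<in> Xs \<Longrightarrow> Ufun U s \<le> Ufun U (step s a x')"
  unfolding Ufun_def
  using C_nonneg[of "fst s" a x'] AugD[of s] by (intro U_monoD) (auto simp: step_def less_imp_le)

lemma Delta_leD:
  assumes "v \<in> Delta_le"
  shows "lsc_on Aug v"
    and "x \<in> Xs \<Longrightarrow> continuous_on {(d, z). (x, d, z) \<in> Aug} (\<lambda>(d, z). v (x, d, z))"
    and "(x, d, z) \<in> Aug \<Longrightarrow> (x, d', z') \<in> Aug \<Longrightarrow> d \<le> d' \<Longrightarrow> z \<le> z' \<Longrightarrow> v (x, d, z) \<le> v (x, d', z')"
    and "s \<in> Aug \<Longrightarrow> Ufun U s \<le> v s" and "s \<in> Aug \<Longrightarrow> v s \<le> bfun U \<beta> c_hi s"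
proof -
  show "v (x, d, z) \<le> v (x, d', z')" if *: "(x, d, z) \<in> Aug" "(x, d', z') \<in> Aug" "d \<le> d'" "z \<le> z'"
  proof -
    have "x \<in> Xs" using AugD(1)[OF *(1)] by simp
    with * assms show ?thesis unfolding Delta_le_def Delta_def by blast
  qed
qed (use assms in \<open>auto simp: Delta_le_def Delta_def Ufun_def\<close>)

lemma Delta_leI:
  assumes "lsc_on Aug v"
    and "\<And>x. x \<in> Xs \<Longrightarrow> continuous_on {(d, z). (x, d, z) \<in> Aug} (\<lambda>(d, z). v (x, d, z))"
    and "\<And>x d z d' z'. (x, d, z) \<in> Aug \<Longrightarrow> (x, d', z') \<in> Aug \<Longrightarrow> d \<le> d' \<Longrightarrow> z \<le> z' \<Longrightarrow> v (x, d, z) \<le> v (x, d', z')"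
    and "\<And>s. s \<in> Aug \<Longrightarrow> Ufun U s \<le> v s" and "\<And>s. s \<in> Aug \<Longrightarrow> v s \<le> bfun U \<beta> c_hi s"
  shows "v \<in> Delta_le"
  using assms unfolding Delta_le_def Delta_def Ufun_def by fastforce

lemma Ufun_ge: "s \<in> Aug \<Longrightarrow> U 0 \<le> Ufun U s"
  unfolding Ufun_def using AugD(2)[of s] by (intro U_monoD) auto

lemma Delta_le_measurable: "v \<in> Delta_le \<Longrightarrow> v \<in> borel_measurable (aug_space Xs)"
  unfolding aug_space_def by (rule lsc_on_borel_measurable[OF Delta_leD(1)])

text \<open>The bound is free of \<open>x'\<close> and \<open>a\<close>. Below, costs are
  nonnegative and \<open>U\<close> is increasing; above, \<open>b_hi\<close> does not grow along a
  transition.\<close>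

lemma Delta_le_step_bound:
  assumes "v \<in> Delta_le" "s \<in> Aug" "a \<in> As" "x' \<in> Xs"
  shows "\<bar>v (step s a x')\<bar> \<le> \<bar>U 0\<bar> + \<bar>bfun U \<beta> c_hi s\<bar>"
  using Delta_leD(4,5)[OF assms(1) step_Aug[OF assms(2-4)]] Ufun_ge[OF step_Aug[OF assms(2-4)]] bfun_hi_step[OF assms(2-4)] by linarith

lemma space_aug_space: "space (aug_space Xs) = Aug"
  by (simp add: aug_space_def space_restrict_space)

lemma Delta_le_step_measurable:
  assumes "v \<in> Delta_le" "s \<in> Aug" "a \<in> sect D (fst s)"
  shows "(\<lambda>x'. v (step s a x')) \<in> borel_measurable (P (fst s) a)"
proof (rule measurable_compose[OF measurable_step Delta_le_measurable[OF assms(1)]])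
  show "(\<lambda>x. x) \<in> P (fst s) a \<rightarrow>\<^sub>M BX" using P_facts(2)[OF assms(3)] by (simp add: measurable_ident_sets)
qed (use assms sectD(3)[OF assms(3)] in \<open>auto simp: space_aug_space space_BA\<close>)

lemma Delta_le_step_integrable:
  assumes "v \<in> Delta_le" "s \<in> Aug" "a \<in> sect D (fst s)"
  shows "integrable (P (fst s) a) (\<lambda>x'. v (step s a x'))"
proof -
  interpret prob_space "P (fst s) a" using P_facts(1)[OF assms(3)] .
  show ?thesis
    using Delta_le_step_bound[OF assms(1,2) sectD(3)[OF assms(3)]] P_facts(3)[OF assms(3)] Delta_le_step_measurable[OF assms]
    by (intro integrable_const_bound[of _ "\<bar>U 0\<bar> + \<bar>bfun U \<beta> c_hi s\<bar>"] AE_I2) auto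
qed

end

subsection \<open>The Bellman operator\<close>

context exp_utility_mdp
begin

abbreviation Gr :: "(('x \<times> (real^'i) \<times> (real^'i)) \<times> 'a) set" where
  "Gr \<equiv> {(s, a). s \<in> Aug \<and> a \<in> sect D (fst s)}"

text \<open>Since \<open>v\<close> is increasing and continuous in its second argument, the merely lower
  semicontinuous cost \<open>C\<close> may be replaced by a slightly smaller constant along the sequence.\<close>

lemma lsc_integrand:
  assumes v: "v \<in> Delta_le"
  shows "lsc_on (Gr \<times> Xs) (\<lambda>(y, x'). v (step (fst y) (snd y) x'))"
proof (rule lsc_on_sequentiallyI)
  fix c q p
  assume q: "\<And>n::nat. q n \<in> Gr \<times> Xs" and le: "\<And>n. (\<lambda>(y, x'). v (step (fst y) (snd y) x')) (q n) \<le> c"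
    and p: "p \<in> Gr \<times> Xs" and lim: "q \<longlonglongrightarrow> p"
  define xn an x'n dn zn where qn: "xn n = fst (fst (fst (q n)))" "an n = snd (fst (q n))" "x'n n = snd (q n)"
    "dn n = fst (snd (fst (fst (q n))))" "zn n = snd (snd (fst (fst (q n))))" for n
  obtain x d z a x' where p_eq: "p = (((x, d, z), a), x')" by (metis prod.exhaust)
  have q_eq: "q n = (((xn n, dn n, zn n), an n), x'n n)" for n by (simp add: qn)
  have lims: "xn \<longlonglongrightarrow> x" "an \<longlonglongrightarrow> a" "x'n \<longlonglongrightarrow> x'" "dn \<longlonglongrightarrow> d" "zn \<longlonglongrightarrow> z"
    unfolding qn using lim unfolding p_eq by (auto intro!: tendsto_eq_intros)
  from p have s: "(x, d, z) \<in> Aug" and a: "a \<in> sect D x" and x': "x' \<in> Xs" by (auto simp: p_eq)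
  have sn: "(xn n, dn n, zn n) \<in> Aug" and an: "an n \<in> sect D (xn n)" and x'n: "x'n n \<in> Xs" for n
    using q[of n] by (auto simp: q_eq)
  have x: "x \<in> Xs" "\<And>i. 0 \<le> d $ i" "\<And>i. 0 < z $ i" "\<And>i. z $ i \<le> 1" "\<And>i. 0 \<le> z $ i" using AugD[OF s] by auto
  have xn: "xn n \<in> Xs" "\<And>i. 0 \<le> dn n $ i" "\<And>i. 0 < zn n $ i" "\<And>i. zn n $ i \<le> 1" "\<And>i. 0 \<le> zn n $ i" for n using AugD[OF sn[of n]] by auto
  \<comment> \<open>The limiting cost is lowered by 1 / (k + 1), so that lower semicontinuity puts
    it strictly below the costs along the sequence from some index on. The cut at 0 keeps the
    perturbed states in \<open>Aug\<close>.\<close>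
  define w :: "nat \<Rightarrow> real^'i" where "w k = (\<chi> i. max 0 (C x a x' $ i - inverse (real (Suc k))))" for k
  have w: "0 \<le> w k $ i" for k i by (simp add: w_def)
  have zb: "0 < z $ i * \<beta> $ i" "z $ i * \<beta> $ i \<le> 1" for i
    using x(3,4)[of i] beta[rule_format, of i] by (auto intro: mult_le_one)
  have znb: "0 < zn n $ i * \<beta> $ i" "zn n $ i * \<beta> $ i \<le> 1" for i n
    using xn(3,4)[of n i] beta[rule_format, of i] by (auto intro: mult_le_one)
  have Augk: "(x', z * w k + d, z * \<beta>) \<in> Aug" "(x'n n, zn n * w k + dn n, zn n * \<beta>) \<in> Aug" for k n
    using x xn zb znb x'n x' w by (auto intro!: AugI add_nonneg_nonneg mult_nonneg_nonneg)
  have "v (x', z * w k + d, z * \<beta>) \<le> c" for k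
  proof (rule ccontr)
    assume "\<not> v (x', z * w k + d, z * \<beta>) \<le> c"
    then have "eventually (\<lambda>n. c < v (x'n n, zn n * w k + dn n, zn n * \<beta>)) sequentially"
      using Augk by (intro lsc_on_eventually_less[OF Delta_leD(1)[OF v], of "(x', z * w k + d, z * \<beta>)"])
        (auto intro!: tendsto_Pair tendsto_add tendsto_vec_times tendsto_const lims)
    \<comment> \<open>There are finitely many components, so one index serves all of them.\<close>
    moreover have "eventually (\<lambda>n. \<forall>i. w k $ i \<le> C (xn n) (an n) (x'n n) $ i) sequentially"
    proof (rule eventually_all_finite)
      fix i
      have "eventually (\<lambda>n. C x a x' $ i - inverse (real (Suc k)) < (\<lambda>(x, a, x'). C x a x' $ i) (xn n, an n, x'n n)) sequentially"
        using x x' sectD(3)[OF a] xn x'n sectD(3)[OF an]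
        by (intro lsc_on_eventually_less[OF C_lsc[rule_format], of "(x, a, x')"]) (auto intro!: tendsto_Pair lims)
      then show "eventually (\<lambda>n. w k $ i \<le> C (xn n) (an n) (x'n n) $ i) sequentially"
        by eventually_elim (use C_nonneg xn x'n sectD(3)[OF an] in \<open>auto simp: w_def\<close>)
    qed
    ultimately have "eventually (\<lambda>n. False) sequentially"
    proof eventually_elim
      case (elim n)
      have "v (x'n n, zn n * w k + dn n, zn n * \<beta>) \<le> v (step (xn n, dn n, zn n) (an n) (x'n n))"
        unfolding step_def
      proof (rule Delta_leD(3)[OF v])
        show "(x'n n, snd (snd (xn n, dn n, zn n)) * C (fst (xn n, dn n, zn n)) (an n) (x'n n) + fst (snd (xn n, dn n, zn n)), snd (snd (xn n, dn n, zn n)) * \<beta>) \<in> Aug"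
          using step_Aug[OF sn sectD(3)[OF an] x'n] by (simp add: step_def)
      qed (use Augk elim xn(5)[of n] in \<open>auto simp: vec_le_iff intro!: mult_left_mono\<close>)
      also have "\<dots> \<le> c" using le[of n] by (simp add: q_eq)
      finally show ?case using elim by simp
    qed
    then show False by simp
  qed
  \<comment> \<open>Continuity of \<open>v\<close> in its second argument removes the perturbation
    as \<open>k\<close> grows.\<close>
  moreover have "(\<lambda>k. v (x', z * w k + d, z * \<beta>)) \<longlonglongrightarrow> v (x', z * C x a x' + d, z * \<beta>)"
  proof -
    have "w \<longlonglongrightarrow> C x a x'"
    proof (rule vec_tendstoI)
      fix i
      have "(\<lambda>k. max 0 (C x a x' $ i - inverse (real (Suc k)))) \<longlonglongrightarrow> max 0 (C x a x' $ i - 0)"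
        by (intro tendsto_intros LIMSEQ_inverse_real_of_nat)
      then show "(\<lambda>k. w k $ i) \<longlonglongrightarrow> C x a x' $ i"
        using C_nonneg[OF x(1) sectD(3)[OF a] x', of i] by (simp add: w_def)
    qed
    then have "(\<lambda>k. (z * w k + d, z * \<beta>)) \<longlonglongrightarrow> (z * C x a x' + d, z * \<beta>)"
      by (intro tendsto_Pair tendsto_add tendsto_vec_times tendsto_const)
    from continuous_on_tendsto_compose[OF Delta_leD(2)[OF v x'] this]
    show ?thesis using Augk step_Aug[OF s sectD(3)[OF a] x'] by (simp add: step_def)
  qed
  ultimately have "v (x', z * C x a x' + d, z * \<beta>) \<le> c"
    by (intro LIMSEQ_le_const2) auto
  then show "(\<lambda>(y, x'). v (step (fst y) (snd y) x')) p \<le> c" by (simp add: p_eq step_def)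
qed

text \<open>Joint lower semicontinuity of \<open>L v\<close> in state and action, in sequential
  form. The state-action pair is the parameter of the integrand, and weak continuity of
  \<open>P\<close> supplies the convergence of the measures.\<close>

lemma L_eventually_less:
  assumes v: "v \<in> Delta_le" and s: "\<And>n. sn n \<in> Aug" "s \<in> Aug" "sn \<longlonglongrightarrow> s"
    and a: "\<And>n. an n \<in> sect D (fst (sn n))" "a \<in> sect D (fst s)" "an \<longlonglongrightarrow> a"
    and c: "c < L v s a"
  shows "eventually (\<lambda>n. c < L v (sn n) (an n)) sequentially"
proof -
  have "eventually (\<lambda>n. c < (\<integral>x'. v (step (fst (sn n, an n)) (snd (sn n, an n)) x') \<partial>P (fst (sn n)) (an n))) sequentially"
  proof (rule integral_lsc_liminf[OF lsc_integrand[OF v], where B="U 0" and ?y0.0="(s, a)" and ?\<mu>0.0="P (fst s) a"])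
    fix w :: "'x \<Rightarrow> real" assume "continuous_on Xs w" "bounded (w ` Xs)"
    then have "continuous_on D (\<lambda>(x, a). \<integral>x'. w x' \<partial>P x a)" using P_weak by blast
    from continuous_on_tendsto_compose[OF this tendsto_Pair[OF tendsto_fst[OF s(3)] a(3)]]
    show "(\<lambda>n. \<integral>x. w x \<partial>P (fst (sn n)) (an n)) \<longlonglongrightarrow> (\<integral>x. w x \<partial>P (fst s) a)"
      using sectD(1)[OF a(1)] sectD(1)[OF a(2)] by simp
  next
    fix y x' assume "y \<in> Gr" "x' \<in> Xs"
    then have "step (fst y) (snd y) x' \<in> Aug" using sectD by (auto intro!: step_Aug)
    from Ufun_ge[OF this] Delta_leD(4)[OF v this] show "U 0 \<le> v (step (fst y) (snd y) x')" by simp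
  qed (use assms P_facts Delta_le_step_integrable[OF v] in \<open>auto intro!: tendsto_Pair simp: L_def\<close>)
  then show ?thesis by (simp add: L_def)
qed

text \<open>\<open>D_acc\<close> extracts a convergent subsequence of actions with an admissible
  limit, and \<open>L_eventually_less\<close> keeps the value of the limit below \<open>q\<close>. A
  general closed \<open>F\<close> serves the measurable selection; \<open>F = UNIV\<close> gives the
  lower semicontinuity of \<open>T v\<close>.\<close>

lemma L_sublevel_limit:
  assumes v: "v \<in> Delta_le" and s: "\<And>n::nat. sn n \<in> Aug" "s \<in> Aug" "sn \<longlonglongrightarrow> s" and F: "closed F"
    and hit: "\<And>n. \<exists>a\<in>sect D (fst (sn n)) \<inter> F. L v (sn n) a \<le> q"
  shows "\<exists>a\<in>sect D (fst s) \<inter> F. L v s a \<le> q"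
proof -
  from hit obtain an where an: "\<And>n. an n \<in> sect D (fst (sn n))" "\<And>n. an n \<in> F" "\<And>n. L v (sn n) (an n) \<le> q"
    by (metis IntD1 IntD2)
  obtain a r where a: "a \<in> sect D (fst s)" "strict_mono r" "(an \<circ> r) \<longlonglongrightarrow> a"
    using D_acc[rule_format, of "\<lambda>n. fst (sn n)" "fst s" an] AugD(1)[OF s(1)] AugD(1)[OF s(2)] tendsto_fst[OF s(3)] an(1) by auto
  have "a \<in> F" using closed_sequentially[OF F _ a(3)] an(2) by auto
  moreover have "L v s a \<le> q"
  proof (rule ccontr)
    assume "\<not> L v s a \<le> q"
    then have "eventually (\<lambda>n. q < L v ((sn \<circ> r) n) ((an \<circ> r) n)) sequentially"
      using s an a LIMSEQ_subseq_LIMSEQ[OF s(3) a(2)] by (intro L_eventually_less[OF v]) (auto simp: comp_def)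
    then obtain n where "q < L v (sn (r n)) (an (r n))" by (force simp: eventually_sequentially)
    with an(3)[of "r n"] show False by simp
  qed
  ultimately show ?thesis using a(1) by blast
qed

lemma L_sublevel_closed:
  assumes v: "v \<in> Delta_le" and s: "s \<in> Aug"
  shows "closed {a \<in> sect D (fst s). L v s a \<le> q}"
  unfolding closed_sequential_limits
proof (intro allI impI, elim conjE)
  fix an a assume an: "\<forall>n. an n \<in> {a \<in> sect D (fst s). L v s a \<le> q}" "an \<longlonglongrightarrow> a"
  have "closed (sect D (fst s))" using D_compact AugD(1)[OF s] by (auto intro: compact_imp_closed)
  with an have a: "a \<in> sect D (fst s)" using closed_sequentially by blast
  have "L v s a \<le> q"
  proof (rule ccontr)
    assume "\<not> L v s a \<le> q"
    then have "eventually (\<lambda>n. q < L v s (an n)) sequentially"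
      using s an a by (intro L_eventually_less[OF v]) auto
    then obtain n where "q < L v s (an n)" by (force simp: eventually_sequentially)
    with an(1) show False by (auto simp: not_less[symmetric])
  qed
  with a show "a \<in> {a \<in> sect D (fst s). L v s a \<le> q}" by simp
qed

text \<open>By \<open>L_sublevel_limit\<close> the set is even relatively closed in
  \<open>Aug\<close>.\<close>

lemma L_sublevel_hits_measurable:
  assumes v: "v \<in> Delta_le" and F: "closed F"
  shows "{s \<in> space (aug_space Xs). \<exists>a\<in>sect D (fst s) \<inter> F. L v s a \<le> q} \<in> sets (aug_space Xs)"
proof -
  let ?H = "{s \<in> Aug. \<exists>a\<in>sect D (fst s) \<inter> F. L v s a \<le> q}"
  have "?H = Aug \<inter> closure ?H"
  proof (intro equalityI subsetI IntI)
    fix s assume s: "s \<in> Aug \<inter> closure ?H"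
    then obtain sn where "\<forall>n. sn n \<in> ?H" "sn \<longlonglongrightarrow> s" using closure_sequential[of s ?H] by auto
    with s show "s \<in> ?H" using L_sublevel_limit[OF v, of sn s, OF _ _ _ F] by auto
  qed (auto intro: closure_subset[THEN subsetD])
  also have "\<dots> \<in> sets (aug_space Xs)"
    unfolding aug_space_def sets_restrict_space by auto
  finally show ?thesis by (simp add: space_aug_space)
qed

lemma T_attained:
  assumes v: "v \<in> Delta_le" and s: "s \<in> Aug"
  obtains a where "a \<in> sect D (fst s)" "T v s = L v s a" "\<And>b. b \<in> sect D (fst s) \<Longrightarrow> L v s a \<le> L v s b"
proof -
  have "compact (sect D (fst s))" "sect D (fst s) \<noteq> {}"
    using D_compact D_ne AugD(1)[OF s] by auto
  from lsc_sublevels_attains_inf[OF this L_sublevel_closed[OF v s]] obtain a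
    where a: "a \<in> sect D (fst s)" "\<And>b. b \<in> sect D (fst s) \<Longrightarrow> L v s a \<le> L v s b" by blast
  then have "T v s = L v s a" unfolding T_eq_L by (intro cInf_eq_minimum) auto
  with a that show thesis by blast
qed

lemma T_le_L: "v \<in> Delta_le \<Longrightarrow> s \<in> Aug \<Longrightarrow> a \<in> sect D (fst s) \<Longrightarrow> T v s \<le> L v s a"
  by (metis T_attained)

section \<open>Monotonicity of the one-step operators\<close>

lemma L_ge:
  assumes "v \<in> Delta_le" "s \<in> Aug" "a \<in> sect D (fst s)" "\<And>x'. x' \<in> Xs \<Longrightarrow> c \<le> v (step s a x')"
  shows "c \<le> L v s a"
  unfolding L_def using P_facts[OF assms(3)] assms(4)
  by (intro prob_space.integral_ge_const Delta_le_step_integrable[OF assms(1-3)]) auto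

lemma L_le:
  assumes "v \<in> Delta_le" "s \<in> Aug" "a \<in> sect D (fst s)" "\<And>x'. x' \<in> Xs \<Longrightarrow> v (step s a x') \<le> c"
  shows "L v s a \<le> c"
  unfolding L_def using P_facts[OF assms(3)] assms(4)
  by (intro prob_space.integral_le_const Delta_le_step_integrable[OF assms(1-3)]) auto

text \<open>Two states with the same first component share the transition measure. This covers both
  the comparison of two functions at one state and the monotonicity in
  \<open>(d, z)\<close>.\<close>

lemma L_mono:
  assumes "v \<in> Delta_le" "w \<in> Delta_le" "s \<in> Aug" "t \<in> Aug" "fst s = fst t" "a \<in> sect D (fst s)"
    "\<And>x'. x' \<in> Xs \<Longrightarrow> v (step s a x') \<le> w (step t a x') + e"
  shows "L v s a \<le> L w t a + e"
proof -
  interpret prob_space "P (fst t) a" using P_facts(1) assms(5,6) by simp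
  have int: "integrable (P (fst t) a) (\<lambda>x'. w (step t a x'))" "integrable (P (fst t) a) (\<lambda>x'. v (step s a x'))"
    using Delta_le_step_integrable assms by metis+
  have "L v s a \<le> (\<integral>x'. w (step t a x') + e \<partial>P (fst t) a)"
    unfolding L_def assms(5) using assms P_facts(3)[OF assms(6)] int by (intro integral_mono) auto
  also have "\<dots> = L w t a + e" using int by (simp add: L_def prob_space)
  finally show ?thesis .
qed

text \<open>An additive error passes through \<open>T\<close> unchanged, since transitions are
  probability measures. The comparison is required only at the successors of \<open>s\<close>, so it
  can be propagated inside an invariant region.\<close>

lemma T_mono_add:
  assumes "v \<in> Delta_le" "w \<in> Delta_le" "s \<in> Aug"
    "\<And>a x'. a \<in> sect D (fst s) \<Longrightarrow> x' \<in> Xs \<Longrightarrow> v (step s a x') \<le> w (step s a x') + e"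
  shows "T v s \<le> T w s + e"
proof -
  obtain a where a: "a \<in> sect D (fst s)" "T w s = L w s a" using T_attained[OF assms(2,3)] .
  have "T v s \<le> L v s a" using T_le_L[OF assms(1,3) a(1)] .
  also have "\<dots> \<le> L w s a + e" using L_mono[OF assms(1,2,3,3) refl a(1)] assms(4)[OF a(1)] by blast
  finally show ?thesis using a by simp
qed

lemma T_mono:
  assumes "v \<in> Delta_le" "w \<in> Delta_le" "s \<in> Aug" "\<And>s. s \<in> Aug \<Longrightarrow> v s \<le> w s"
  shows "T v s \<le> T w s"
  using T_mono_add[OF assms(1-3), of 0] assms(4) step_Aug[OF assms(3)] sectD(3) by simp

text \<open>One half of continuity is inherited from \<open>Aug\<close>. The other half is natural
  for infima of functions continuous in \<open>(d, z)\<close>, which is how both \<open>T v\<close>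
  and the limit of the decreasing iterates arise.\<close>

lemma section_continuousI:
  fixes v :: "'x \<times> (real^'i) \<times> (real^'i) \<Rightarrow> real"
  assumes lsc: "lsc_on Aug v"
    and usc: "\<And>pn p c. (\<And>n::nat. (x, pn n) \<in> Aug) \<Longrightarrow> (x, p) \<in> Aug \<Longrightarrow> pn \<longlonglongrightarrow> p \<Longrightarrow> v (x, p) < c \<Longrightarrow>
      eventually (\<lambda>n. v (x, pn n) < c) sequentially"
  shows "continuous_on {(d, z). (x, d, z) \<in> Aug} (\<lambda>(d, z). v (x, d, z))"
proof (unfold continuous_on_sequentially, intro ballI allI impI, elim conjE)
  fix p pn assume p: "p \<in> {(d, z). (x, d, z) \<in> Aug}" and pn: "\<forall>n::nat. pn n \<in> {(d, z). (x, d, z) \<in> Aug}" "pn \<longlonglongrightarrow> p"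
  have "(\<lambda>n. v (x, pn n)) \<longlonglongrightarrow> v (x, p)"
  proof (rule order_tendstoI)
    fix c assume "c < v (x, p)"
    then show "eventually (\<lambda>n. c < v (x, pn n)) sequentially"
      using p pn by (intro lsc_on_eventually_less[OF lsc, of "(x, p)"]) (auto intro!: tendsto_Pair)
  next
    fix c assume "v (x, p) < c"
    then show "eventually (\<lambda>n. v (x, pn n) < c) sequentially" using p pn by (intro usc) auto
  qed
  then show "((\<lambda>(d, z). v (x, d, z)) \<circ> pn) \<longlonglongrightarrow> (\<lambda>(d, z). v (x, d, z)) p"
    by (simp add: comp_def case_prod_beta)
qed

lemma U_affine_continuous:
  assumes "\<And>i. 0 \<le> w $ i"
  shows "continuous_on Aug (\<lambda>s. U (snd (snd s) * w + fst (snd s)))"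
proof (rule continuous_on_compose2[OF U_cont])
  show "continuous_on Aug (\<lambda>s. snd (snd s) * w + fst (snd s))"
    by (intro continuous_on_vec_times continuous_intros)
  show "(\<lambda>s. snd (snd s) * w + fst (snd s)) ` Aug \<subseteq> {d. \<forall>i. 0 \<le> d $ i}"
    using assms AugD by (auto intro!: add_nonneg_nonneg mult_nonneg_nonneg)
qed

text \<open>The weight \<open>w = 0\<close> gives \<open>Ufun U\<close>, and
  \<open>w = c / (1 - \<beta>)\<close> gives \<open>bfun U \<beta> c\<close>, so the starting points
  of all three iterations are treated at once.\<close>

lemma U_affine_Delta_le:
  assumes w: "\<And>i. 0 \<le> w $ i" "\<And>i. w $ i \<le> c_hi / (1 - \<beta> $ i)"
  shows "(\<lambda>s. U (snd (snd s) * w + fst (snd s))) \<in> Delta_le"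
proof (rule Delta_leI)
  have nonneg: "0 \<le> snd (snd s) $ i * w $ i" if "s \<in> Aug" for s i
    using w(1) AugD(5)[OF that, of i] by simp
  show "lsc_on Aug (\<lambda>s. U (snd (snd s) * w + fst (snd s)))"
    by (rule continuous_on_imp_lsc_on[OF U_affine_continuous[OF w(1)]])
  show "continuous_on {(d, z). (x, d, z) \<in> Aug} (\<lambda>(d, z). U (snd (snd (x, d, z)) * w + fst (snd (x, d, z))))" for x
  proof -
    have "continuous_on {(d, z). (x, d, z) \<in> Aug} (\<lambda>p. (\<lambda>s. U (snd (snd s) * w + fst (snd s))) (x, p))"
      by (rule continuous_on_compose2[OF U_affine_continuous[OF w(1)]]) (auto intro!: continuous_intros)
    then show ?thesis by (simp add: case_prod_beta)
  qed
  show "Ufun U s \<le> U (snd (snd s) * w + fst (snd s))" if "s \<in> Aug" for s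
    unfolding Ufun_def using nonneg[OF that] AugD[OF that] by (intro U_monoD) auto
  show "U (snd (snd s) * w + fst (snd s)) \<le> bfun U \<beta> c_hi s" if "s \<in> Aug" for s
    unfolding bfun_eq using nonneg[OF that] AugD(2)[OF that] mult_left_mono[OF w(2) AugD(5)[OF that]]
    by (intro U_monoD) auto
  show "U (snd (snd (x, d, z)) * w + fst (snd (x, d, z))) \<le> U (snd (snd (x, d', z')) * w + fst (snd (x, d', z')))"
    if "(x, d, z) \<in> Aug" "(x, d', z') \<in> Aug" "d \<le> d'" "z \<le> z'" for x d z d' z'
    using nonneg[OF that(1)] AugD(2)[OF that(1)] that(3,4) w
    by (intro U_monoD) (auto intro!: add_nonneg_nonneg add_mono mult_right_mono simp: vec_le_iff)
qed

lemma Ufun_Delta_le: "Ufun U \<in> Delta_le"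
  using U_affine_Delta_le[of 0] beta c_hi by (simp add: Ufun_def[abs_def] less_imp_le)

lemma bfun_Delta_le: "0 \<le> c \<Longrightarrow> c \<le> c_hi \<Longrightarrow> bfun U \<beta> c \<in> Delta_le"
  using U_affine_Delta_le[of "\<chi> i. c / (1 - \<beta> $ i)"] beta
  by (simp add: bfun_eq[abs_def] less_imp_le divide_right_mono)

lemma bfun_lo_Delta_le: "bfun U \<beta> c_lo \<in> Delta_le" and bfun_hi_Delta_le: "bfun U \<beta> c_hi \<in> Delta_le"
  using bfun_Delta_le c_hi c_pos by auto

text \<open>With \<open>x\<close> and \<open>a\<close> fixed the measure does not move, so dominated
  convergence suffices. The dominating constant exists because \<open>b_hi\<close> converges, hence
  is bounded, along the sequence.\<close>

lemma L_tendsto: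
  assumes v: "v \<in> Delta_le" and s: "\<And>n::nat. (x, pn n) \<in> Aug" "(x, p) \<in> Aug" "pn \<longlonglongrightarrow> p" and a: "a \<in> sect D x"
  shows "(\<lambda>n. L v (x, pn n) a) \<longlonglongrightarrow> L v (x, p) a"
proof -
  interpret prob_space "P x a" using P_facts(1)[OF a] .
  have b: "bfun U \<beta> c_hi \<in> Delta_le" by (rule bfun_hi_Delta_le)
  have x: "x \<in> Xs" using AugD(1)[OF s(2)] by simp
  have "(\<lambda>n. bfun U \<beta> c_hi (x, pn n)) \<longlonglongrightarrow> bfun U \<beta> c_hi (x, p)"
    using continuous_on_tendsto_compose[OF Delta_leD(2)[OF b x] s(3)] s by (auto simp: case_prod_beta)
  then have "Bseq (\<lambda>n. bfun U \<beta> c_hi (x, pn n))" by (auto intro: convergent_imp_Bseq convergentI)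
  then obtain B where B: "\<And>n. \<bar>bfun U \<beta> c_hi (x, pn n)\<bar> \<le> B" by (auto simp: Bseq_def)
  show ?thesis unfolding L_def fst_conv
  proof (rule integral_dominated_convergence[where w="\<lambda>_. \<bar>U 0\<bar> + B"])
    show "AE x' in P x a. norm (v (step (x, pn n) a x')) \<le> \<bar>U 0\<bar> + B" for n
      using Delta_le_step_bound[OF v s(1) sectD(3)[OF a], of _ n] B[of n] P_facts(3)[OF a] by (intro AE_I2) fastforce
    show "AE x' in P x a. (\<lambda>n. v (step (x, pn n) a x')) \<longlonglongrightarrow> v (step (x, p) a x')"
    proof (rule AE_I2)
      fix x' assume "x' \<in> space (P x a)"
      then have x': "x' \<in> Xs" using P_facts(3)[OF a] by simp
      have "(\<lambda>n. (snd (pn n) * C x a x' + fst (pn n), snd (pn n) * \<beta>)) \<longlonglongrightarrow> (snd p * C x a x' + fst p, snd p * \<beta>)"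
        by (intro tendsto_Pair tendsto_add tendsto_vec_times tendsto_const tendsto_snd tendsto_fst s(3))
      from continuous_on_tendsto_compose[OF Delta_leD(2)[OF v x'] this]
      show "(\<lambda>n. v (step (x, pn n) a x')) \<longlonglongrightarrow> v (step (x, p) a x')"
        using step_Aug[OF s(1) sectD(3)[OF a] x'] step_Aug[OF s(2) sectD(3)[OF a] x'] by (simp add: step_def)
    qed
  qed (use Delta_le_step_measurable[OF v s(1)] Delta_le_step_measurable[OF v s(2)] a in auto)
qed

lemma lsc_T: assumes v: "v \<in> Delta_le" shows "lsc_on Aug (T v)"
proof (rule lsc_on_sequentiallyI)
  fix c sn s assume s: "\<And>n::nat. sn n \<in> Aug" "s \<in> Aug" "sn \<longlonglongrightarrow> s" and le: "\<And>n. T v (sn n) \<le> c"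
  have "\<exists>a\<in>sect D (fst s) \<inter> UNIV. L v s a \<le> c"
  proof (rule L_sublevel_limit[OF v s closed_UNIV])
    fix n
    obtain a where "a \<in> sect D (fst (sn n))" "T v (sn n) = L v (sn n) a" using T_attained[OF v s(1)] .
    with le[of n] show "\<exists>a\<in>sect D (fst (sn n)) \<inter> UNIV. L v (sn n) a \<le> c" by auto
  qed
  then show "T v s \<le> c" using T_le_L[OF v s(2)] by (auto intro: order_trans)
qed

lemma T_Delta_le: assumes v: "v \<in> Delta_le" shows "T v \<in> Delta_le"
proof (rule Delta_leI)
  show "lsc_on Aug (T v)" using lsc_T[OF v] .
  show "continuous_on {(d, z). (x, d, z) \<in> Aug} (\<lambda>(d, z). T v (x, d, z))" for x
  proof (rule section_continuousI[OF lsc_T[OF v]])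
    fix pn p c assume s: "\<And>n::nat. (x, pn n) \<in> Aug" "(x, p) \<in> Aug" "pn \<longlonglongrightarrow> p" and c: "T v (x, p) < c"
    \<comment> \<open>The action optimal at the limit is admissible along the whole sequence because
      \<open>x\<close> is fixed; its value bounds \<open>T v\<close> from above.\<close>
    obtain a where a: "a \<in> sect D (fst (x, p))" "T v (x, p) = L v (x, p) a" using T_attained[OF v s(2)] .
    have "eventually (\<lambda>n. L v (x, pn n) a < c) sequentially"
      using L_tendsto[OF v s] a c by (intro order_tendstoD(2)) auto
    then show "eventually (\<lambda>n. T v (x, pn n) < c) sequentially"
    proof eventually_elim
      case (elim n)
      with T_le_L[OF v s(1)[of n], of a] a(1) show ?case by simp
    qed
  qed
  show "T v (x, d, z) \<le> T v (x, d', z')" if *: "(x, d, z) \<in> Aug" "(x, d', z') \<in> Aug" "d \<le> d'" "z \<le> z'" for x d z d' z'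
  proof -
    \<comment> \<open>An action optimal at the larger state is admissible at the smaller one, both
      having first component \<open>x\<close>.\<close>
    obtain a where a: "a \<in> sect D (fst (x, d', z'))" "T v (x, d', z') = L v (x, d', z') a" using T_attained[OF v *(2)] .
    then have a': "a \<in> sect D x" by simp
    have "T v (x, d, z) \<le> L v (x, d, z) a" using T_le_L[OF v *(1)] a by simp
    also have "\<dots> \<le> L v (x, d', z') a + 0"
    proof (rule L_mono[OF v v *(1,2)])
      fix x' assume x': "x' \<in> Xs"
      have "0 \<le> C x a x' $ i" for i using C_nonneg[OF _ sectD(3)[OF a'] x'] sectD(2)[OF a'] by simp
      moreover have "0 \<le> \<beta> $ i" for i using beta by (simp add: less_imp_le)
      ultimately show "v (step (x, d, z) a x') \<le> v (step (x, d', z') a x') + 0"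
        using step_Aug[OF *(1) sectD(3)[OF a'] x'] step_Aug[OF *(2) sectD(3)[OF a'] x'] *(3,4) unfolding step_def add_0_right
        by (intro Delta_leD(3)[OF v]) (auto simp: vec_le_iff intro!: add_mono mult_right_mono)
    qed (use a in auto)
    finally show ?thesis using a by simp
  qed
  show "Ufun U s \<le> T v s" if s: "s \<in> Aug" for s
  proof -
    obtain a where a: "a \<in> sect D (fst s)" "T v s = L v s a" using T_attained[OF v s] .
    show ?thesis unfolding a(2)
      using Ufun_step[OF s sectD(3)[OF a(1)]] Delta_leD(4)[OF v step_Aug[OF s sectD(3)[OF a(1)]]]
      by (intro L_ge[OF v s a(1)]) (auto intro: order_trans)
  qed
  show "T v s \<le> bfun U \<beta> c_hi s" if s: "s \<in> Aug" for s
  proof -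
    obtain a where a: "a \<in> sect D (fst s)" "T v s = L v s a" using T_attained[OF v s] .
    show ?thesis unfolding a(2)
      using bfun_hi_step[OF s sectD(3)[OF a(1)]] Delta_leD(5)[OF v step_Aug[OF s sectD(3)[OF a(1)]]]
      by (intro L_le[OF v s a(1)]) (auto intro: order_trans)
  qed
qed

lemma funpow_T_Delta_le: "v \<in> Delta_le \<Longrightarrow> (T ^^ n) v \<in> Delta_le"
  by (induction n) (auto intro: T_Delta_le)

lemma funpow_T_mono:
  assumes "v \<in> Delta_le" "w \<in> Delta_le" "\<And>s. s \<in> Aug \<Longrightarrow> v s \<le> w s"
  shows "s \<in> Aug \<Longrightarrow> (T ^^ n) v s \<le> (T ^^ n) w s"
proof (induction n arbitrary: s)
  case (Suc n)
  then show ?case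
    using T_mono[OF funpow_T_Delta_le[OF assms(1)] funpow_T_Delta_le[OF assms(2)] Suc.prems Suc.IH] by simp
qed (simp add: assms(3))

lemma ex_optimal_decision_rule:
  assumes v: "v \<in> Delta_le"
  shows "\<exists>g. is_decision_rule Xs As D g \<and> (\<forall>s\<in>Aug. T_g P C \<beta> g v s = T v s)"
proof -
  have 1: "\<And>s. s \<in> space (aug_space Xs :: ('x \<times> (real^'i) \<times> (real^'i)) measure) \<Longrightarrow> compact (sect D (fst s))"
    "\<And>s. s \<in> space (aug_space Xs :: ('x \<times> (real^'i) \<times> (real^'i)) measure) \<Longrightarrow> sect D (fst s) \<noteq> {}"
    using D_compact D_ne AugD(1) by (auto simp: space_aug_space)
  have 2: "\<And>s q. s \<in> space (aug_space Xs) \<Longrightarrow> closed {a \<in> sect D (fst s). L v s a \<le> q}"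
    using L_sublevel_closed[OF v] by (simp add: space_aug_space)
  obtain g where g: "g \<in> borel_measurable (aug_space Xs)"
    "\<And>s. s \<in> space (aug_space Xs) \<Longrightarrow> g s \<in> sect D (fst s)"
    "\<And>s b. s \<in> space (aug_space Xs) \<Longrightarrow> b \<in> sect D (fst s) \<Longrightarrow> L v s (g s) \<le> L v s b"
    using measurable_argmin_selector[OF 1 2 L_sublevel_hits_measurable[OF v]] by blast
  note g = g[unfolded space_aug_space]
  have "T v s = L v s (g s)" if "s \<in> Aug" for s
    unfolding T_eq_L using g(2,3)[OF that] by (intro cInf_eq_minimum) auto
  moreover have "g \<in> aug_space Xs \<rightarrow>\<^sub>M BA"
    using g(1) sectD(3)[OF g(2)] by (intro measurable_restrict_space2) (auto simp: space_aug_space)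
  ultimately show ?thesis
    using g(2) by (intro exI[of _ g]) (force simp: is_decision_rule_def T_g_eq_L)
qed

end

subsection \<open>Value iteration\<close>

context exp_utility_mdp
begin

abbreviation b_lo :: "'x \<times> (real^'i) \<times> (real^'i) \<Rightarrow> real" where "b_lo \<equiv> bfun U \<beta> c_lo"
abbreviation b_hi :: "'x \<times> (real^'i) \<times> (real^'i) \<Rightarrow> real" where "b_hi \<equiv> bfun U \<beta> c_hi"

lemma bfun_lo_le_T: assumes s: "s \<in> Aug" shows "b_lo s \<le> T b_lo s"
proof -
  obtain a where a: "a \<in> sect D (fst s)" "T b_lo s = L b_lo s a" using T_attained[OF bfun_lo_Delta_le s] .
  show ?thesis unfolding a(2)
    by (intro L_ge[OF bfun_lo_Delta_le s a(1)] bfun_lo_step s sectD(3)[OF a(1)])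
qed

lemma funpow_T_lo_Suc: "s \<in> Aug \<Longrightarrow> (T ^^ n) b_lo s \<le> (T ^^ Suc n) b_lo s"
  using funpow_T_mono[OF bfun_lo_Delta_le T_Delta_le[OF bfun_lo_Delta_le] bfun_lo_le_T, of s n]
  by (simp add: funpow_swap1)

lemma funpow_T_Ufun_Suc: "s \<in> Aug \<Longrightarrow> (T ^^ n) (Ufun U) s \<le> (T ^^ Suc n) (Ufun U) s"
  using funpow_T_mono[OF Ufun_Delta_le T_Delta_le[OF Ufun_Delta_le] Delta_leD(4)[OF T_Delta_le[OF Ufun_Delta_le]], of s n]
  by (simp add: funpow_swap1)

lemma funpow_T_hi_Suc: "s \<in> Aug \<Longrightarrow> (T ^^ Suc n) b_hi s \<le> (T ^^ n) b_hi s"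
  using funpow_T_mono[OF T_Delta_le[OF bfun_hi_Delta_le] bfun_hi_Delta_le Delta_leD(5)[OF T_Delta_le[OF bfun_hi_Delta_le]], of s n]
  by (simp add: funpow_swap1)

lemma funpow_T_Ufun_le_lo: "s \<in> Aug \<Longrightarrow> (T ^^ n) (Ufun U) s \<le> (T ^^ n) b_lo s"
  by (rule funpow_T_mono[OF Ufun_Delta_le bfun_lo_Delta_le Delta_leD(4)[OF bfun_lo_Delta_le]])

lemma funpow_T_lo_le_hi: "s \<in> Aug \<Longrightarrow> (T ^^ n) b_lo s \<le> (T ^^ n) b_hi s"
  by (rule funpow_T_mono[OF bfun_lo_Delta_le bfun_hi_Delta_le Delta_leD(5)[OF bfun_lo_Delta_le]])

lemma incseq_funpow_T_Ufun: "s \<in> Aug \<Longrightarrow> incseq (\<lambda>n. (T ^^ n) (Ufun U) s)"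
  using funpow_T_Ufun_Suc by (intro incseq_SucI)

lemma decseq_funpow_T_hi: "s \<in> Aug \<Longrightarrow> decseq (\<lambda>n. (T ^^ n) b_hi s)"
  using funpow_T_hi_Suc by (intro decseq_SucI)

lemma funpow_T_Ufun_le_hi:
  assumes s: "s \<in> Aug" shows "(T ^^ n) (Ufun U) s \<le> (T ^^ m) b_hi s"
proof -
  have "(T ^^ n) (Ufun U) s \<le> (T ^^ max n m) (Ufun U) s"
    using incseqD[OF incseq_funpow_T_Ufun[OF s], of n "max n m"] by simp
  also have "\<dots> \<le> (T ^^ max n m) b_hi s"
    using funpow_T_Ufun_le_lo[OF s] funpow_T_lo_le_hi[OF s] by (rule order_trans)
  also have "\<dots> \<le> (T ^^ m) b_hi s"
    using decseqD[OF decseq_funpow_T_hi[OF s], of m "max n m"] by simp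
  finally show ?thesis .
qed

text \<open>The set of states with \<open>d + z c_hi / (1 - \<beta>) \<le> R\<close> is invariant under transitions,
  while the discount \<open>z\<close> shrinks by \<open>\<beta>\<close> in each step.\<close>

lemma funpow_T_le_add_on_region:
  assumes v: "v \<in> Delta_le" and w: "w \<in> Delta_le"
    and base: "\<And>s. s \<in> Aug \<Longrightarrow> (\<And>i. snd (snd s) $ i * (c_hi / (1 - \<beta> $ i)) + fst (snd s) $ i \<le> R) \<Longrightarrow>
      (\<And>i. snd (snd s) $ i \<le> \<beta> $ i ^ n) \<Longrightarrow> v s \<le> w s + e"
  shows "s \<in> Aug \<Longrightarrow> (\<And>i. snd (snd s) $ i * (c_hi / (1 - \<beta> $ i)) + fst (snd s) $ i \<le> R) \<Longrightarrow>
    (\<And>i. snd (snd s) $ i \<le> \<beta> $ i ^ k) \<Longrightarrow> k + j = n \<Longrightarrow> (T ^^ j) v s \<le> (T ^^ j) w s + e"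
proof (induction j arbitrary: s k)
  case 0
  then show ?case using base[OF 0(1)] by simp
next
  case (Suc j)
  have "T ((T ^^ j) v) s \<le> T ((T ^^ j) w) s + e"
  proof (rule T_mono_add[OF funpow_T_Delta_le[OF v] funpow_T_Delta_le[OF w] Suc.prems(1)])
    fix a x' assume a: "a \<in> sect D (fst s)" and x': "x' \<in> Xs"
    show "(T ^^ j) v (step s a x') \<le> (T ^^ j) w (step s a x') + e"
    \<comment> \<open>One transition tightens the discount bound from exponent \<open>k\<close> to
      \<open>Suc k\<close> and uses up one of the remaining iterations, so their sum stays
      \<open>n\<close>; \<open>base\<close> applies when none remain.\<close>
    proof (rule Suc.IH[where k="Suc k"])
      show "step s a x' \<in> Aug" using step_Aug[OF Suc.prems(1) sectD(3)[OF a] x'] .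
      show "snd (snd (step s a x')) $ i * (c_hi / (1 - \<beta> $ i)) + fst (snd (step s a x')) $ i \<le> R" for i
        using step_le_ub[OF Suc.prems(1) sectD(3)[OF a] x' less_imp_le[OF c_hi(2)] C_le[OF AugD(1)[OF Suc.prems(1)] sectD(3)[OF a] x'], of i]
          Suc.prems(2)[of i] by simp
      have "snd (snd s) $ i * \<beta> $ i \<le> \<beta> $ i ^ k * \<beta> $ i" for i
        using Suc.prems(3)[of i] beta by (intro mult_right_mono) (auto simp: less_imp_le)
      then show "snd (snd (step s a x')) $ i \<le> \<beta> $ i ^ Suc k" for i by (simp add: step_def mult.commute)
      show "Suc k + j = n" using Suc.prems(4) by simp
    qed
  qed
  then show ?case by simp
qed

text \<open>On the region both arguments of \<open>U\<close> lie in the box with upper corner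
  \<open>R\<close>. They differ by \<open>z c_hi / (1 - \<beta>)\<close>, whose l1 norm is at most
  the sum of \<beta>^n c_hi / (1 - \<beta>) over the components and tends to 0; uniform continuity
  of \<open>U\<close> on the box does the rest.\<close>

lemma bfun_hi_le_Ufun_add:
  assumes e: "e > 0"
  shows "eventually (\<lambda>n. \<forall>s\<in>Aug. (\<forall>i. snd (snd s) $ i * (c_hi / (1 - \<beta> $ i)) + fst (snd s) $ i \<le> R) \<longrightarrow>
    (\<forall>i. snd (snd s) $ i \<le> \<beta> $ i ^ n) \<longrightarrow> b_hi s \<le> Ufun U s + e) sequentially"
proof -
  let ?B = "cbox 0 (\<chi> i. R) :: (real^'i) set"
  have "continuous_on ?B U"
    by (rule continuous_on_subset[OF U_cont]) (auto simp: mem_box_cart)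
  then have "uniformly_continuous_on ?B U" by (intro compact_uniformly_continuous) auto
  with e obtain \<delta> where \<delta>: "\<delta> > 0" "\<And>d d'. d \<in> ?B \<Longrightarrow> d' \<in> ?B \<Longrightarrow> dist d' d < \<delta> \<Longrightarrow> dist (U d') (U d) < e"
    unfolding uniformly_continuous_on_def by metis
  have "(\<lambda>n. \<Sum>i\<in>UNIV. \<beta> $ i ^ n * (c_hi / (1 - \<beta> $ i))) \<longlonglongrightarrow> (\<Sum>i\<in>UNIV. 0 * (c_hi / (1 - \<beta> $ i)))"
    using beta by (intro tendsto_sum tendsto_mult tendsto_const LIMSEQ_realpow_zero) (auto simp: less_imp_le)
  then have "eventually (\<lambda>n. (\<Sum>i\<in>UNIV. \<beta> $ i ^ n * (c_hi / (1 - \<beta> $ i))) < \<delta>) sequentially"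
    using \<delta>(1) by (intro order_tendstoD(2)) auto
  then show ?thesis
  proof eventually_elim
    case (elim n)
    show ?case
    proof (intro ballI impI)
      fix s :: "'x \<times> (real^'i) \<times> (real^'i)"
      assume s: "s \<in> Aug" and R: "\<forall>i. snd (snd s) $ i * (c_hi / (1 - \<beta> $ i)) + fst (snd s) $ i \<le> R"
        and z: "\<forall>i. snd (snd s) $ i \<le> \<beta> $ i ^ n"
      define d w where "d = fst (snd s)" and "w = snd (snd s) * (\<chi> i. c_hi / (1 - \<beta> $ i))"
      have w: "0 \<le> w $ i" "w $ i \<le> \<beta> $ i ^ n * (c_hi / (1 - \<beta> $ i))" "w $ i + d $ i \<le> R" "0 \<le> d $ i" for i
      proof -
        have c: "0 \<le> c_hi / (1 - \<beta> $ i)" using beta[rule_format, of i] c_hi by simp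
        show "0 \<le> w $ i" using mult_nonneg_nonneg[OF AugD(5)[OF s, of i] c] by (simp add: w_def)
        show "w $ i \<le> \<beta> $ i ^ n * (c_hi / (1 - \<beta> $ i))"
          using mult_right_mono[OF z[rule_format, of i] c] by (simp add: w_def)
        show "w $ i + d $ i \<le> R" using R by (simp add: w_def d_def)
        show "0 \<le> d $ i" using AugD(2)[OF s] by (simp add: d_def)
      qed
      have "dist (U (w + d)) (U d) < e"
      proof (rule \<delta>(2))
        show "d \<in> ?B" "w + d \<in> ?B"
          using w(1,3,4) by (auto simp: mem_box_cart) (metis add_increasing2 order_trans le_add_same_cancel2)
        have "dist (w + d) d = norm w" by (simp add: dist_norm)
        also have "\<dots> \<le> (\<Sum>i\<in>UNIV. \<bar>w $ i\<bar>)" by (rule norm_le_l1_cart)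
        also have "\<dots> \<le> (\<Sum>i\<in>UNIV. \<beta> $ i ^ n * (c_hi / (1 - \<beta> $ i)))"
          using w(1,2) by (intro sum_mono) simp
        finally show "dist (w + d) d < \<delta>" using elim by simp
      qed
      then show "b_hi s \<le> Ufun U s + e"
        by (simp add: bfun_eq Ufun_def w_def d_def dist_real_def)
    qed
  qed
qed

lemma funpow_T_gap:
  assumes K: "compact K" and e: "e > 0"
  shows "eventually (\<lambda>n. \<forall>s\<in>Aug. fst (snd s) \<in> K \<longrightarrow> (T ^^ n) b_hi s \<le> (T ^^ n) (Ufun U) s + e) sequentially"
proof -
  from compact_imp_bounded[OF K] obtain R0 where R0: "\<And>d. d \<in> K \<Longrightarrow> norm d \<le> R0"
    unfolding bounded_iff by blast
  \<comment> \<open>\<open>R0\<close> bounds the components of \<open>d\<close> in \<open>K\<close>.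
    Since z \<le> 1, each component of \<open>z c_hi / (1 - \<beta>)\<close> is at most one summand
    of the added sum.\<close>
  define R where "R = R0 + (\<Sum>i\<in>UNIV. c_hi / (1 - \<beta> $ i))"
  show ?thesis using bfun_hi_le_Ufun_add[OF e, of R]
  proof eventually_elim
    case (elim n)
    show ?case
    proof (intro ballI impI)
      fix s :: "'x \<times> (real^'i) \<times> (real^'i)" assume s: "s \<in> Aug" and K: "fst (snd s) \<in> K"
      show "(T ^^ n) b_hi s \<le> (T ^^ n) (Ufun U) s + e"
      proof (rule funpow_T_le_add_on_region[OF bfun_hi_Delta_le Ufun_Delta_le _ s, where R=R and k=0])
        fix i
        have c: "0 \<le> c_hi / (1 - \<beta> $ i)" for i using beta[rule_format, of i] c_hi by simp
        have "fst (snd s) $ i \<le> R0" using R0[OF K] component_le_norm_cart[of "fst (snd s)" i] by simp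
        moreover have "snd (snd s) $ i * (c_hi / (1 - \<beta> $ i)) \<le> 1 * (c_hi / (1 - \<beta> $ i))"
          using AugD(4)[OF s] c by (intro mult_right_mono)
        moreover have "c_hi / (1 - \<beta> $ i) \<le> (\<Sum>i\<in>UNIV. c_hi / (1 - \<beta> $ i))"
          using c by (intro member_le_sum) auto
        ultimately show "snd (snd s) $ i * (c_hi / (1 - \<beta> $ i)) + fst (snd s) $ i \<le> R"
          by (simp add: R_def)
        show "snd (snd s) $ i \<le> \<beta> $ i ^ 0" using AugD(4)[OF s] by simp
      qed (use elim in auto)
    qed
  qed
qed

text \<open>The limit is taken from below because the increasing iterates yield lower semicontinuity
  of the limit and are also the lower bounds available for arbitrary policies. Convergence is
  established on \<open>Aug\<close>.\<close>

definition Vlim :: "'x \<times> (real^'i) \<times> (real^'i) \<Rightarrow> real" where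
  "Vlim s = lim (\<lambda>n. (T ^^ n) (Ufun U) s)"

lemma funpow_T_Ufun_tendsto:
  assumes s: "s \<in> Aug" shows "(\<lambda>n. (T ^^ n) (Ufun U) s) \<longlonglongrightarrow> Vlim s"
proof -
  have "\<forall>n. (T ^^ n) (Ufun U) s \<le> b_hi s" using funpow_T_Ufun_le_hi[OF s, of _ 0] by simp
  from incseq_convergent[OF incseq_funpow_T_Ufun[OF s] this]
  obtain l where "(\<lambda>n. (T ^^ n) (Ufun U) s) \<longlonglongrightarrow> l" by blast
  then show ?thesis unfolding Vlim_def by (simp add: limI)
qed

lemma Vlim_ge: "s \<in> Aug \<Longrightarrow> (T ^^ n) (Ufun U) s \<le> Vlim s"
  by (rule incseq_le[OF incseq_funpow_T_Ufun funpow_T_Ufun_tendsto])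

lemma Vlim_le: "s \<in> Aug \<Longrightarrow> Vlim s \<le> (T ^^ n) b_hi s"
  by (rule LIMSEQ_le_const2[OF funpow_T_Ufun_tendsto]) (auto intro: funpow_T_Ufun_le_hi)

text \<open>Stated for any sequence squeezed between the two extreme iterations, so that the three
  uniform limits are instances.\<close>

lemma funpow_T_uniform_limit:
  assumes K: "compact K" and S: "S \<subseteq> Aug" "\<And>s. s \<in> S \<Longrightarrow> fst (snd s) \<in> K"
    and F: "\<And>n s. s \<in> S \<Longrightarrow> (T ^^ n) (Ufun U) s \<le> F n s" "\<And>n s. s \<in> S \<Longrightarrow> F n s \<le> (T ^^ n) b_hi s"
  shows "uniform_limit S F Vlim sequentially"
  unfolding uniform_limit_iff
proof (intro allI impI)
  fix e :: real assume "e > 0"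
  then have "e / 2 > 0" by simp
  from funpow_T_gap[OF K this] show "eventually (\<lambda>n. \<forall>s\<in>S. dist (F n s) (Vlim s) < e) sequentially"
  proof eventually_elim
    case (elim n)
    show ?case
    proof
      fix s assume s: "s \<in> S"
      with S(1) S(2)[OF s] elim have "(T ^^ n) b_hi s \<le> (T ^^ n) (Ufun U) s + e / 2" "s \<in> Aug" by auto
      with Vlim_ge[of s n] Vlim_le[of s n] F[OF s, of n] \<open>e > 0\<close> show "dist (F n s) (Vlim s) < e"
        by (simp add: dist_real_def abs_less_iff)
    qed
  qed
qed

lemma funpow_T_hi_tendsto:
  assumes s: "s \<in> Aug" shows "(\<lambda>n. (T ^^ n) b_hi s) \<longlonglongrightarrow> Vlim s"
  using funpow_T_uniform_limit[of "{fst (snd s)}" "{s}" "\<lambda>n. (T ^^ n) b_hi"] s funpow_T_Ufun_le_hi[OF s]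
  by (auto intro: tendsto_uniform_limitI)

lemma Vlim_Delta_le: "Vlim \<in> Delta_le"
proof (rule Delta_leI)
  note D = funpow_T_Delta_le[OF Ufun_Delta_le] funpow_T_Delta_le[OF bfun_hi_Delta_le]
  show lsc: "lsc_on Aug Vlim"
    by (rule lsc_on_SUP[OF Delta_leD(1)[OF D(1)] funpow_T_Ufun_tendsto Vlim_ge])
  show "continuous_on {(d, z). (x, d, z) \<in> Aug} (\<lambda>(d, z). Vlim (x, d, z))" if x: "x \<in> Xs" for x
  proof (rule section_continuousI[OF lsc])
    fix pn p c assume p: "\<And>n::nat. (x, pn n) \<in> Aug" "(x, p) \<in> Aug" "pn \<longlonglongrightarrow> p" and c: "Vlim (x, p) < c"
    \<comment> \<open>Some iterate from above is already below \<open>c\<close> at \<open>p\<close>;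
      it is continuous in \<open>(d, z)\<close> and dominates \<open>Vlim\<close>.\<close>
    obtain m where m: "(T ^^ m) b_hi (x, p) < c"
      using order_tendstoD(2)[OF funpow_T_hi_tendsto[OF p(2)] c] by (force simp: eventually_sequentially)
    have "(\<lambda>n. (T ^^ m) b_hi (x, pn n)) \<longlonglongrightarrow> (T ^^ m) b_hi (x, p)"
      using continuous_on_tendsto_compose[OF Delta_leD(2)[OF D(2) x] p(3)] p(1,2) by (simp add: case_prod_beta)
    from order_tendstoD(2)[OF this m] show "eventually (\<lambda>n. Vlim (x, pn n) < c) sequentially"
      by eventually_elim (rule le_less_trans[OF Vlim_le[OF p(1)]])
  qed
  show "Vlim (x, d, z) \<le> Vlim (x, d', z')" if "(x, d, z) \<in> Aug" "(x, d', z') \<in> Aug" "d \<le> d'" "z \<le> z'" for x d z d' z'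
    using Delta_leD(3)[OF D(1) that]
    by (intro LIMSEQ_le[OF funpow_T_Ufun_tendsto[OF that(1)] funpow_T_Ufun_tendsto[OF that(2)]]) auto
  show "Ufun U s \<le> Vlim s" if "s \<in> Aug" for s using Vlim_ge[OF that, of 0] by simp
  show "Vlim s \<le> b_hi s" if "s \<in> Aug" for s using Vlim_le[OF that, of 0] by simp
qed

text \<open>Applying \<open>T\<close> to the bounds on \<open>Vlim\<close> shifts both iterations by
  one step, and both still converge to \<open>Vlim\<close>. This squeeze replaces an interchange of
  the limit with the infimum and the integral.\<close>

lemma T_Vlim: assumes s: "s \<in> Aug" shows "T Vlim s = Vlim s"
proof (rule antisym)
  note D = funpow_T_Delta_le[OF Ufun_Delta_le] funpow_T_Delta_le[OF bfun_hi_Delta_le]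
  have "T Vlim s \<le> (T ^^ Suc n) b_hi s" for n
    using T_mono[OF Vlim_Delta_le D(2) s Vlim_le] by simp
  then show "T Vlim s \<le> Vlim s"
    by (intro LIMSEQ_le_const[OF LIMSEQ_Suc[OF funpow_T_hi_tendsto[OF s]]]) auto
  have "(T ^^ Suc n) (Ufun U) s \<le> T Vlim s" for n
    using T_mono[OF D(1) Vlim_Delta_le s Vlim_ge] by simp
  then show "Vlim s \<le> T Vlim s"
    by (intro LIMSEQ_le_const2[OF LIMSEQ_Suc[OF funpow_T_Ufun_tendsto[OF s]]]) auto
qed

lemma T_fixpoint_unique:
  assumes v: "v \<in> Delta_le" and fixpt: "\<And>s. s \<in> Aug \<Longrightarrow> v s = T v s" and s: "s \<in> Aug"
  shows "v s = Vlim s"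
proof -
  \<comment> \<open>The iterates agree with \<open>v\<close> on \<open>Aug\<close> only, so the
    equality is pushed through \<open>T\<close> by monotonicity in both directions.\<close>
  have eq: "(T ^^ n) v s = v s" if "s \<in> Aug" for n s
    using that
  proof (induction n arbitrary: s)
    case (Suc n)
    note D = funpow_T_Delta_le[OF v, of n]
    have "T ((T ^^ n) v) s = T v s"
      using T_mono[OF D v Suc.prems] T_mono[OF v D Suc.prems] Suc.IH by (intro antisym) auto
    with fixpt[OF Suc.prems] show ?case by simp
  qed simp
  have "(T ^^ n) (Ufun U) s \<le> v s" "v s \<le> (T ^^ n) b_hi s" for n
    using funpow_T_mono[OF Ufun_Delta_le v Delta_leD(4)[OF v] s, of n]
      funpow_T_mono[OF v bfun_hi_Delta_le Delta_leD(5)[OF v] s, of n] eq[OF s, of n] by auto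
  then show ?thesis
    by (intro antisym LIMSEQ_le_const[OF funpow_T_hi_tendsto[OF s]] LIMSEQ_le_const2[OF funpow_T_Ufun_tendsto[OF s]]) auto
qed

lemma Vlim_ge_lo: assumes s: "s \<in> Aug" shows "b_lo s \<le> Vlim s"
proof -
  have "incseq (\<lambda>n. (T ^^ n) b_lo s)" using funpow_T_lo_Suc[OF s] by (rule incseq_SucI)
  then have "b_lo s \<le> (T ^^ n) b_lo s" for n using incseqD[of _ 0 n] by fastforce
  then have "b_lo s \<le> (T ^^ n) b_hi s" for n using funpow_T_lo_le_hi[OF s, of n] by (rule order_trans)
  then show ?thesis by (intro LIMSEQ_le_const[OF funpow_T_hi_tendsto[OF s]]) auto
qed

end

subsection \<open>History laws and path laws of a policy\<close>

text \<open>The state space is abstract so that original and augmented states can both be inserted.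
  Measurability of the kernel is asked on admissible pairs, matching \<open>P\<close>, which is a
  kernel on \<open>D\<close>.\<close>

locale controlled_process =
  fixes S :: "'s measure" and A :: "'a measure" and Dx :: "'s \<Rightarrow> 'a set"
    and Q :: "'s \<Rightarrow> 'a \<Rightarrow> 's measure" and f :: "nat \<Rightarrow> ('s, 'a) hist \<Rightarrow> 'a"
  assumes Q_kernel: "(\<lambda>(s, a). Q s a) \<in> restrict_space (S \<Otimes>\<^sub>M A) {(s, a). a \<in> Dx s} \<rightarrow>\<^sub>M subprob_algebra S"
    and Q_prob: "\<And>s a. s \<in> space S \<Longrightarrow> a \<in> Dx s \<Longrightarrow> prob_space (Q s a)"
    and policy: "is_policy S A Dx f"
begin

lemma policy_measurable [measurable]: "f n \<in> hist_space S A n \<rightarrow>\<^sub>M A"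
  and policy_in: "h \<in> space (hist_space S A n) \<Longrightarrow> f n h \<in> Dx (fst h n)"
  using policy by (auto simp: is_policy_def)

lemma measurable_hist_state: "k \<le> n \<Longrightarrow> (\<lambda>h. fst h k) \<in> hist_space S A n \<rightarrow>\<^sub>M S"
  unfolding hist_space_def by measurable

lemma measurable_hist_action: "k < n \<Longrightarrow> (\<lambda>h. snd h k) \<in> hist_space S A n \<rightarrow>\<^sub>M A"
  unfolding hist_space_def by measurable

definition trans :: "nat \<Rightarrow> ('s, 'a) hist \<Rightarrow> 's measure" where
  "trans n h = Q (fst h n) (f n h)"

definition extend :: "nat \<Rightarrow> ('s, 'a) hist \<Rightarrow> 's \<Rightarrow> ('s, 'a) hist" where
  "extend n h s' = ((fst h)(Suc n := s'), (snd h)(n := f n h))"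

definition hist_kernel :: "nat \<Rightarrow> ('s, 'a) hist \<Rightarrow> ('s, 'a) hist measure" where
  "hist_kernel n h = distr (trans n h) (hist_space S A (Suc n)) (extend n h)"

lemma measurable_trans: "trans n \<in> hist_space S A n \<rightarrow>\<^sub>M prob_algebra S"
proof (rule measurable_prob_algebraI)
  fix h assume h: "h \<in> space (hist_space S A n)"
  show "prob_space (trans n h)"
    using measurable_space[OF measurable_hist_state[OF order_refl] h] policy_in[OF h] unfolding trans_def by (rule Q_prob)
next
  have "(\<lambda>h. (fst h n, f n h)) \<in> hist_space S A n \<rightarrow>\<^sub>M restrict_space (S \<Otimes>\<^sub>M A) {(s, a). a \<in> Dx s}"
    using policy_in by (intro measurable_restrict_space2 measurable_Pair measurable_hist_state policy_measurable) auto
  from measurable_compose[OF this Q_kernel] show "trans n \<in> hist_space S A n \<rightarrow>\<^sub>M subprob_algebra S"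
    by (simp add: trans_def[abs_def])
qed

lemma trans_facts:
  assumes "h \<in> space (hist_space S A n)"
  shows "prob_space (trans n h)" "sets (trans n h) = sets S"
  using measurable_space[OF measurable_trans assms] by (auto simp: space_prob_algebra)

lemma measurable_extend: "(\<lambda>(h, s'). extend n h s') \<in> hist_space S A n \<Otimes>\<^sub>M S \<rightarrow>\<^sub>M hist_space S A (Suc n)"
proof -
  have [measurable]: "(\<lambda>x. f n (fst x)) \<in> hist_space S A n \<Otimes>\<^sub>M S \<rightarrow>\<^sub>M A" by measurable
  have 1: "(\<lambda>x. fst (fst x)) \<in> hist_space S A n \<Otimes>\<^sub>M S \<rightarrow>\<^sub>M (\<Pi>\<^sub>M k\<in>{..n}. S)"
    and 2: "(\<lambda>x. snd (fst x)) \<in> hist_space S A n \<Otimes>\<^sub>M S \<rightarrow>\<^sub>M (\<Pi>\<^sub>M k\<in>{..<n}. A)"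
    unfolding hist_space_def by measurable
  have "(\<lambda>x. ((fst (fst x))(Suc n := snd x), (snd (fst x))(n := f n (fst x)))) \<in> hist_space S A n \<Otimes>\<^sub>M S \<rightarrow>\<^sub>M hist_space S A (Suc n)"
    unfolding hist_space_def[of S A "Suc n"]
    by (intro measurable_Pair measurable_fun_upd[OF _ 1] measurable_fun_upd[OF _ 2]) (auto, measurable)
  then show ?thesis by (simp add: extend_def case_prod_beta)
qed

lemma measurable_extend': "h \<in> space (hist_space S A n) \<Longrightarrow> extend n h \<in> S \<rightarrow>\<^sub>M hist_space S A (Suc n)"
  using measurable_compose[OF measurable_Pair1' measurable_extend] by simp

lemma measurable_hist_kernel: "hist_kernel n \<in> hist_space S A n \<rightarrow>\<^sub>M prob_algebra (hist_space S A (Suc n))"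
  unfolding hist_kernel_def[abs_def] by (intro measurable_distr_prob_space2[OF measurable_trans measurable_extend])

lemma hist_law_Suc: "hist_law S A Q f s (Suc n) = hist_law S A Q f s n \<bind> hist_kernel n"
  by (simp add: hist_kernel_def[abs_def] trans_def extend_def[abs_def])

definition hist0 :: "'s \<Rightarrow> ('s, 'a) hist" where
  "hist0 s = (\<lambda>k\<in>{..0}. s, \<lambda>k\<in>{..<0}. undefined)"

lemma hist0_in_space: "s \<in> space S \<Longrightarrow> hist0 s \<in> space (hist_space S A 0)"
  by (auto simp: hist0_def hist_space_def space_pair_measure space_PiM)

lemma hist_law_space:
  assumes "s \<in> space S" shows "hist_law S A Q f s n \<in> space (prob_algebra (hist_space S A n))"
proof (induction n)
  case 0
  show ?case unfolding hist_law.simps hist0_def[symmetric]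
    using prob_space_return[OF hist0_in_space[OF assms]] by (simp add: space_prob_algebra)
next
  case (Suc n)
  show ?case unfolding hist_law_Suc
    using prob_space_bind'[OF Suc measurable_hist_kernel] sets_bind'[OF Suc measurable_hist_kernel]
    by (simp add: space_prob_algebra)
qed

lemma hist_law_facts:
  assumes "s \<in> space S"
  shows "prob_space (hist_law S A Q f s n)" "sets (hist_law S A Q f s n) = sets (hist_space S A n)"
    "space (hist_law S A Q f s n) = space (hist_space S A n)"
  using hist_law_space[OF assms, of n] by (auto simp: space_prob_algebra dest: sets_eq_imp_space_eq)

lemma integral_hist_kernel:
  assumes w: "w \<in> borel_measurable (hist_space S A (Suc n))" and h: "h \<in> space (hist_space S A n)"
  shows "(\<integral>h'. (w h' :: real) \<partial>hist_kernel n h) = (\<integral>s'. w (extend n h s') \<partial>trans n h)"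
  unfolding hist_kernel_def
  using w measurable_extend'[OF h] trans_facts(2)[OF h]
  by (intro integral_distr) (simp_all cong: measurable_cong_sets)

text \<open>The tower property: the newest state is integrated out given the history before
  it.\<close>

lemma integral_hist_law_Suc:
  fixes w :: "('s, 'a) hist \<Rightarrow> real"
  assumes s: "s \<in> space S" and w: "w \<in> borel_measurable (hist_space S A (Suc n))"
    and B: "\<And>h. h \<in> space (hist_space S A (Suc n)) \<Longrightarrow> \<bar>w h\<bar> \<le> B"
  shows "(\<integral>h. w h \<partial>hist_law S A Q f s (Suc n)) = (\<integral>h. (\<integral>s'. w (extend n h s') \<partial>trans n h) \<partial>hist_law S A Q f s n)"
    and "(\<lambda>h. \<integral>s'. w (extend n h s') \<partial>trans n h) \<in> borel_measurable (hist_space S A n)"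
proof -
  interpret prob_space "hist_law S A Q f s n" using hist_law_facts(1)[OF s] .
  note sets = hist_law_facts(2)[OF s]
  have "(\<integral>h. w h \<partial>hist_law S A Q f s (Suc n)) = (\<integral>h. (\<integral>h'. w h' \<partial>hist_kernel n h) \<partial>hist_law S A Q f s n)"
    unfolding hist_law_Suc
  proof (rule integral_bind[OF w B, where B'=1])
    show "hist_kernel n \<in> hist_law S A Q f s n \<rightarrow>\<^sub>M subprob_algebra (hist_space S A (Suc n))"
      using measurable_prob_algebraD[OF measurable_hist_kernel] by (simp cong: measurable_cong_sets add: sets)
    show "AE h in hist_law S A Q f s n. emeasure (hist_kernel n h) (space (hist_kernel n h)) \<le> ennreal 1"
      using measurable_space[OF measurable_hist_kernel] hist_law_facts(3)[OF s]
      by (intro AE_I2) (auto simp: space_prob_algebra prob_space.emeasure_space_1)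
  qed unfold_locales
  also have "\<dots> = (\<integral>h. (\<integral>s'. w (extend n h s') \<partial>trans n h) \<partial>hist_law S A Q f s n)"
    using integral_hist_kernel[OF w] hist_law_facts(3)[OF s] by (intro Bochner_Integration.integral_cong) auto
  finally show "(\<integral>h. w h \<partial>hist_law S A Q f s (Suc n)) = (\<integral>h. (\<integral>s'. w (extend n h s') \<partial>trans n h) \<partial>hist_law S A Q f s n)" .
  have "(\<lambda>h. \<integral>h'. w h' \<partial>hist_kernel n h) \<in> borel_measurable (hist_space S A n)"
    using measurable_compose[OF measurable_prob_algebraD[OF measurable_hist_kernel] integral_measurable_subprob_algebra[OF w]] .
  then show "(\<lambda>h. \<integral>s'. w (extend n h s') \<partial>trans n h) \<in> borel_measurable (hist_space S A n)"
    using integral_hist_kernel[OF w] by (simp cong: measurable_cong)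
qed

text \<open>As policies are deterministic, a history is a function of its states.\<close>

primrec hist_of :: "nat \<Rightarrow> (nat \<Rightarrow> 's) \<Rightarrow> ('s, 'a) hist" where
  "hist_of 0 \<omega> = hist0 (\<omega> 0)"
| "hist_of (Suc n) \<omega> = extend n (hist_of n \<omega>) (\<omega> (Suc n))"

lemma hist_of_cong: "(\<And>k. k \<le> n \<Longrightarrow> \<omega> k = \<omega>' k) \<Longrightarrow> hist_of n \<omega> = hist_of n \<omega>'"
  by (induction n) auto

lemma fst_hist_of: "fst (hist_of n \<omega>) = restrict \<omega> {..n}"
  by (induction n) (auto simp: hist0_def extend_def fun_eq_iff restrict_def le_Suc_eq)

lemma snd_hist_of: "snd (hist_of n \<omega>) = restrict (\<lambda>k. f k (hist_of k \<omega>)) {..<n}"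
  by (induction n) (auto simp: hist0_def extend_def fun_eq_iff restrict_def less_Suc_eq)

text \<open>The index set is general because histories are read both from finite initial segments
  and from full paths.\<close>

lemma measurable_hist_of: "{..n} \<subseteq> J \<Longrightarrow> hist_of n \<in> (\<Pi>\<^sub>M k\<in>J. S) \<rightarrow>\<^sub>M hist_space S A n"
proof (induction n)
  case 0
  then have "(\<lambda>\<omega>. hist0 (\<omega> 0)) \<in> (\<Pi>\<^sub>M k\<in>J. S) \<rightarrow>\<^sub>M hist_space S A 0"
    unfolding hist0_def hist_space_def
    by (intro measurable_Pair measurable_restrict measurable_component_singleton) auto
  then show ?case by simp
next
  case (Suc n)
  then have "{..n} \<subseteq> J" "Suc n \<in> J" by auto
  with Suc.IH have "(\<lambda>\<omega>. (hist_of n \<omega>, \<omega> (Suc n))) \<in> (\<Pi>\<^sub>M k\<in>J. S) \<rightarrow>\<^sub>M hist_space S A n \<Otimes>\<^sub>M S"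
    by (intro measurable_Pair measurable_component_singleton) auto
  from measurable_compose[OF this measurable_extend] show ?case by simp
qed

text \<open>Coordinate \<open>n\<close> is drawn given the coordinates below \<open>n\<close>.
  Coordinate 0 is therefore a point mass at the initial state, and coordinate \<open>Suc m\<close>
  uses the transition taken at time \<open>m\<close>.\<close>

definition path_kernel :: "'s \<Rightarrow> nat \<Rightarrow> (nat \<Rightarrow> 's) \<Rightarrow> 's measure" where
  "path_kernel s n \<omega> = (case n of 0 \<Rightarrow> return S s | Suc m \<Rightarrow> trans m (hist_of m \<omega>))"

lemma measurable_path_kernel:
  assumes "s \<in> space S"
  shows "path_kernel s n \<in> (\<Pi>\<^sub>M k\<in>{0..<n}. S) \<rightarrow>\<^sub>M prob_algebra S"
proof (cases n)
  case 0
  then show ?thesis using assms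
    by (simp add: path_kernel_def[abs_def] space_prob_algebra prob_space_return)
next
  case (Suc m)
  have "{..m} \<subseteq> {0..<n}" using Suc by auto
  from measurable_compose[OF measurable_hist_of[OF this] measurable_trans] Suc show ?thesis
    by (simp add: path_kernel_def[abs_def])
qed

section \<open>Existence of the path law\<close>

lemma measurable_hist_proj: "hist_proj n \<in> path_space S A \<rightarrow>\<^sub>M hist_space S A n"
  unfolding hist_proj_def path_space_def hist_space_def
  by (intro measurable_Pair measurable_restrict) measurable

text \<open>The Ionescu-Tulcea theorem gives a law on state paths; the actions, being functions of
  the states, are appended by a pushforward. This is what makes the choice in
  \<open>path_law\<close> meaningful.\<close>

lemma path_law_exists:
  assumes s: "s \<in> space S"
  shows "\<exists>M. sets M = sets (path_space S A) \<and> prob_space M \<and>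
    (\<forall>n. distr M (hist_space S A n) (hist_proj n) = hist_law S A Q f s n)"
proof -
  interpret IT: Ionescu_Tulcea "path_kernel s" "\<lambda>_. S"
  proof (rule Ionescu_Tulcea.intro)
    fix i
    show "path_kernel s i \<in> (\<Pi>\<^sub>M k\<in>{0..<i}. S) \<rightarrow>\<^sub>M subprob_algebra S"
      using measurable_prob_algebraD[OF measurable_path_kernel[OF s]] .
    fix x assume "x \<in> space (\<Pi>\<^sub>M k\<in>{0..<i}. S)"
    from measurable_space[OF measurable_path_kernel[OF s] this] show "prob_space (path_kernel s i x)"
      by (simp add: space_prob_algebra)
  qed
  \<comment> \<open>The only point of the product over the empty index set, from which the
    construction starts.\<close>
  let ?u = "\<lambda>_::nat. undefined :: 's"
  have u: "?u \<in> space (\<Pi>\<^sub>M k\<in>{0..<0}. S)" by (simp add: space_PiM)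
  have J: "{..n} \<subseteq> {0..<Suc n}" for n by auto
  have meas_H: "hist_of n \<in> IT.C 0 (Suc n) ?u \<rightarrow>\<^sub>M hist_space S A n" for n
    using measurable_hist_of[OF J] IT.sets_C[OF u, of "Suc n"] by (simp cong: measurable_cong_sets)
  \<comment> \<open>A history up to time \<open>n\<close> contains \<open>Suc n\<close> states,
    hence the shift in the index of \<open>IT.C\<close>.\<close>
  have law: "hist_law S A Q f s n = distr (IT.C 0 (Suc n) ?u) (hist_space S A n) (hist_of n)" for n
  proof (induction n)
    case 0
    have upd: "fun_upd ?u 0 \<in> S \<rightarrow>\<^sub>M (\<Pi>\<^sub>M k\<in>{0..<Suc 0}. S)"
      using u by (intro measurable_fun_upd[where J="{0..<0}"]) auto
    have "IT.C 0 (Suc 0) ?u = IT.eP 0 ?u"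
      using bind_return[OF IT.measurable_eP u] by simp
    also have "\<dots> = return (\<Pi>\<^sub>M k\<in>{0..<Suc 0}. S) (?u(0 := s))"
      unfolding IT.eP_def path_kernel_def using distr_return[OF upd s] by simp
    finally have C: "IT.C 0 (Suc 0) ?u = return (\<Pi>\<^sub>M k\<in>{0..<Suc 0}. S) (?u(0 := s))" .
    show ?case unfolding C
      using measurable_space[OF upd s] by (subst distr_return[OF measurable_hist_of[OF J]]) (auto simp: hist0_def)
  next
    case (Suc n)
    let ?C = "IT.C 0 (Suc n) ?u"
    have space_C: "space ?C = space (\<Pi>\<^sub>M k\<in>{0..<Suc n}. S)" using IT.space_C[OF u, of "Suc n"] by simp
    interpret C: prob_space ?C by (rule IT.prob_space_C[OF u])
    have eP: "IT.eP (Suc n) \<in> ?C \<rightarrow>\<^sub>M subprob_algebra (\<Pi>\<^sub>M k\<in>{0..<Suc (Suc n)}. S)"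
      using IT.measurable_eP[of "Suc n"] IT.sets_C[OF u, of "Suc n"] by (simp cong: measurable_cong_sets)
    have "hist_law S A Q f s (Suc n) = ?C \<bind> (\<lambda>\<omega>. hist_kernel n (hist_of n \<omega>))"
      unfolding hist_law_Suc Suc
      by (rule bind_distr[OF meas_H measurable_prob_algebraD[OF measurable_hist_kernel] C.not_empty])
    also have "\<dots> = ?C \<bind> (\<lambda>\<omega>. distr (IT.eP (Suc n) \<omega>) (hist_space S A (Suc n)) (hist_of (Suc n)))"
    proof (rule bind_cong[OF refl])
      fix \<omega> assume "\<omega> \<in> space ?C"
      then have \<omega>: "\<omega> \<in> space (\<Pi>\<^sub>M k\<in>{0..<Suc n}. S)" unfolding space_C .
      have H: "hist_of n \<omega> \<in> space (hist_space S A n)" using measurable_space[OF measurable_hist_of[OF J] \<omega>] .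
      have upd: "fun_upd \<omega> (Suc n) \<in> S \<rightarrow>\<^sub>M (\<Pi>\<^sub>M k\<in>{0..<Suc (Suc n)}. S)"
        using \<omega> by (intro measurable_fun_upd[where J="{0..<Suc n}"]) auto
      \<comment> \<open>\<open>hist_of n\<close> does not look at coordinate \<open>Suc n\<close>,
        so setting that coordinate amounts to extending the history.\<close>
      have comp: "hist_of (Suc n) \<circ> fun_upd \<omega> (Suc n) = extend n (hist_of n \<omega>)"
      proof
        fix s'
        have "hist_of n (fun_upd \<omega> (Suc n) s') = hist_of n \<omega>" by (rule hist_of_cong) auto
        then show "(hist_of (Suc n) \<circ> fun_upd \<omega> (Suc n)) s' = extend n (hist_of n \<omega>) s'" by simp
      qed
      have "distr (IT.eP (Suc n) \<omega>) (hist_space S A (Suc n)) (hist_of (Suc n))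
        = distr (trans n (hist_of n \<omega>)) (hist_space S A (Suc n)) (hist_of (Suc n) \<circ> fun_upd \<omega> (Suc n))"
        unfolding IT.eP_def path_kernel_def nat.case
        using upd trans_facts(2)[OF H] by (intro distr_distr measurable_hist_of[OF J]) (simp cong: measurable_cong_sets)
      then show "hist_kernel n (hist_of n \<omega>) = distr (IT.eP (Suc n) \<omega>) (hist_space S A (Suc n)) (hist_of (Suc n))"
        unfolding comp hist_kernel_def by simp
    qed
    also have "\<dots> = distr (?C \<bind> IT.eP (Suc n)) (hist_space S A (Suc n)) (hist_of (Suc n))"
      by (rule distr_bind[OF eP C.not_empty measurable_hist_of[OF J], symmetric])
    also have "?C \<bind> IT.eP (Suc n) = IT.C 0 (Suc (Suc n)) ?u"
      unfolding IT.C.simps(2)[of 0 "Suc n"] add_0 ..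
    finally show ?case .
  qed
  let ?path = "\<lambda>\<omega>. (\<omega>, \<lambda>k. f k (hist_of k \<omega>))"
  define M where "M = distr IT.PF.lim (path_space S A) ?path"
  have sets_lim: "sets IT.PF.lim = sets (\<Pi>\<^sub>M k\<in>UNIV. S)" by simp
  have path: "?path \<in> IT.PF.lim \<rightarrow>\<^sub>M path_space S A"
    unfolding path_space_def measurable_cong_sets[OF sets_lim refl]
    by (intro measurable_Pair measurable_ident_sets[OF refl] measurable_abs_UNIV
        measurable_compose[OF measurable_hist_of policy_measurable]) auto
  have restrict: "(\<lambda>\<omega>. restrict \<omega> J) \<in> IT.PF.lim \<rightarrow>\<^sub>M (\<Pi>\<^sub>M k\<in>J. S)" for J
    unfolding measurable_cong_sets[OF sets_lim refl] by (rule measurable_restrict_subset) simp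
  \<comment> \<open>The total mass of the limit measure is read off its marginal on the empty index
    set.\<close>
  have "prob_space (distr IT.PF.lim (\<Pi>\<^sub>M k\<in>{}. S) (\<lambda>\<omega>. restrict \<omega> {}))"
    unfolding IT.distr_lim[OF finite.emptyI] by (rule IT.PF.prob_space_P) auto
  then interpret lim: prob_space IT.PF.lim by (rule prob_space_distrD[OF restrict])
  have "prob_space M" unfolding M_def by (rule lim.prob_space_distr[OF path])
  moreover have "sets M = sets (path_space S A)" by (simp add: M_def)
  moreover have "distr M (hist_space S A n) (hist_proj n) = hist_law S A Q f s n" for n
  proof -
    have upto: "IT.up_to {0..<Suc n} = Suc n"
      using IT.up_to_iff_Ico[of "{0..<Suc n}" "Suc n"] IT.up_to_less[of "{0..<Suc n}" n] by auto
    have CI: "IT.CI {0..<Suc n} = IT.C 0 (Suc n) ?u"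
      using IT.distr_C[OF order_refl u, of "Suc n"] unfolding IT.CI_def upto by simp
    have "distr M (hist_space S A n) (hist_proj n) = distr IT.PF.lim (hist_space S A n) (hist_proj n \<circ> ?path)"
      unfolding M_def by (rule distr_distr[OF measurable_hist_proj path])
    also have "hist_proj n \<circ> ?path = hist_of n \<circ> (\<lambda>\<omega>. restrict \<omega> {0..<Suc n})"
    proof
      fix \<omega>
      have "hist_of n (restrict \<omega> {0..<Suc n}) = hist_of n \<omega>" by (rule hist_of_cong) auto
      then show "(hist_proj n \<circ> ?path) \<omega> = (hist_of n \<circ> (\<lambda>\<omega>. restrict \<omega> {0..<Suc n})) \<omega>"
        by (simp add: hist_proj_def prod_eq_iff fst_hist_of snd_hist_of)
    qed
    also have "distr IT.PF.lim (hist_space S A n) \<dots> = distr (distr IT.PF.lim (\<Pi>\<^sub>M k\<in>{0..<Suc n}. S) (\<lambda>\<omega>. restrict \<omega> {0..<Suc n})) (hist_space S A n) (hist_of n)"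
      by (intro distr_distr[symmetric] measurable_hist_of[OF J] restrict)
    also have "distr IT.PF.lim (\<Pi>\<^sub>M k\<in>{0..<Suc n}. S) (\<lambda>\<omega>. restrict \<omega> {0..<Suc n}) = IT.C 0 (Suc n) ?u"
      using IT.distr_lim[of "{0..<Suc n}"] CI by simp
    finally show ?thesis using law by simp
  qed
  ultimately show ?thesis by blast
qed

lemma path_law_facts:
  assumes s: "s \<in> space S"
  shows "sets (path_law S A Q f s) = sets (path_space S A)" "prob_space (path_law S A Q f s)"
    "distr (path_law S A Q f s) (hist_space S A n) (hist_proj n) = hist_law S A Q f s n"
  using someI_ex[OF path_law_exists[OF s]] unfolding path_law_def[symmetric] by auto

lemma integral_path_law_hist:
  assumes s: "s \<in> space S" and w: "w \<in> borel_measurable (hist_space S A n)"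
  shows "(\<integral>\<omega>. (w (hist_proj n \<omega>) :: real) \<partial>path_law S A Q f s) = (\<integral>h. w h \<partial>hist_law S A Q f s n)"
  unfolding path_law_facts(3)[OF s, symmetric]
  using measurable_hist_proj w path_law_facts(1)[OF s]
  by (intro integral_distr[symmetric]) (simp_all cong: measurable_cong_sets)

end

subsection \<open>Cost of a policy as a limit of Bellman iterates\<close>

lemma geometric_tail_bound:
  fixes b c :: real
  assumes "0 < b" "b < 1" "\<And>k. k < n \<Longrightarrow> x k \<le> c"
  shows "b ^ n * (c / (1 - b)) + (\<Sum>k<n. b ^ k * x k) \<le> c / (1 - b)"
  using assms(3)
proof (induction n)
  case (Suc n)
  have "(1 - b) * (c / (1 - b)) = c" using assms(2) by simp
  then have c: "c = c / (1 - b) - b * (c / (1 - b))" by (simp only: left_diff_distrib mult_1)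
  have "b ^ n * x n \<le> b ^ n * c" using Suc.prems[of n] assms(1) by (intro mult_left_mono) auto
  also have "b ^ n * c = b ^ n * (c / (1 - b) - b * (c / (1 - b)))" using c by simp
  also have "\<dots> = b ^ n * (c / (1 - b)) - b ^ Suc n * (c / (1 - b))"
    unfolding right_diff_distrib power_Suc2 by (simp only: mult.assoc)
  finally show ?case using Suc.IH Suc.prems by simp
qed simp

text \<open>Each component is dominated by a geometric series; this identifies the vector-valued
  infinite sum in the cost as a genuine limit.\<close>

lemma discounted_vec_sums:
  fixes \<beta> :: "real^'i" and x :: "nat \<Rightarrow> real^'i"
  assumes \<beta>: "\<And>i. 0 < \<beta> $ i" "\<And>i. \<beta> $ i < 1" and x: "\<And>k i. \<bar>x k $ i\<bar> \<le> c"
  shows "(\<lambda>n. \<Sum>k<n. \<beta> ^ k * x k) \<longlonglongrightarrow> (\<Sum>k. \<beta> ^ k * x k)"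
proof -
  have summable: "summable (\<lambda>k. \<beta> $ i ^ k * x k $ i)" for i
  proof (rule summable_comparison_test')
    show "summable (\<lambda>k. \<beta> $ i ^ k * c)"
      using \<beta>[of i] by (intro summable_mult2 summable_geometric) simp
    show "norm (\<beta> $ i ^ k * x k $ i) \<le> \<beta> $ i ^ k * c" if "k \<ge> 0" for k
      using x[of k i] \<beta>[of i] by (simp add: abs_mult mult_left_mono)
  qed
  have "(\<lambda>k. \<beta> ^ k * x k) sums (\<chi> i. \<Sum>k. \<beta> $ i ^ k * x k $ i)"
    unfolding sums_def
    using summable_LIMSEQ[OF summable] by (intro vec_tendstoI) (simp add: power_vec_nth)
  then show ?thesis by (intro summable_LIMSEQ sums_summable)
qed

text \<open>A controlled process on a state space \<open>S\<close> that projects onto the original one via \<open>p\<close>. Taking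
  \<open>p\<close> to be the identity and \<open>fst\<close> covers the original and the augmented problem, respectively. In
  the latter case, the accumulated cost and discount in \<open>aug\<close> below are recomputed from the history
  instead of being read off the state.\<close>

locale lifted_process =
  exp_utility_mdp Xs As D P U C \<beta> c_lo c_hi +
  controlled_process S "restrict_space borel As" "\<lambda>s. sect D (p s)" Q f
  for Xs :: "'x::polish_space set" and As :: "'a::polish_space set" and D :: "('x \<times> 'a) set"
    and P :: "'x \<Rightarrow> 'a \<Rightarrow> 'x measure" and U :: "(real^'i::finite) \<Rightarrow> real"
    and C :: "'x \<Rightarrow> 'a \<Rightarrow> 'x \<Rightarrow> (real^'i)" and \<beta> :: "(real^'i)" and c_lo c_hi :: real
    and S :: "'s measure" and p :: "'s \<Rightarrow> 'x" and Q :: "'s \<Rightarrow> 'a \<Rightarrow> 's measure"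
    and f :: "nat \<Rightarrow> ('s, 'a) hist \<Rightarrow> 'a" +
  fixes s0 :: 's and d0 z0 :: "real^'i"
  assumes p_measurable: "p \<in> S \<rightarrow>\<^sub>M BX"
    and distr_p: "\<And>s a. s \<in> space S \<Longrightarrow> a \<in> sect D (p s) \<Longrightarrow> distr (Q s a) BX p = P (p s) a"
    and s0: "s0 \<in> space S" and init_Aug: "(p s0, d0, z0) \<in> Aug"
begin

abbreviation law :: "nat \<Rightarrow> ('s, 'a) hist measure" where
  "law n \<equiv> hist_law S BA Q f s0 n"

definition cost_at :: "('s, 'a) hist \<Rightarrow> nat \<Rightarrow> real^'i" where
  "cost_at h k = C (p (fst h k)) (snd h k) (p (fst h (Suc k)))"

definition aug :: "nat \<Rightarrow> ('s, 'a) hist \<Rightarrow> 'x \<times> (real^'i) \<times> (real^'i)" where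
  "aug n h = (p (fst h n), z0 * (\<Sum>k<n. \<beta> ^ k * cost_at h k) + d0, z0 * \<beta> ^ n)"

lemma p_in_Xs: "s \<in> space S \<Longrightarrow> p s \<in> Xs"
  using measurable_space[OF p_measurable] by (simp add: space_BX)

lemma hist_in:
  assumes "h \<in> space (hist_space S BA n)"
  shows "k \<le> n \<Longrightarrow> fst h k \<in> space S" "k < n \<Longrightarrow> snd h k \<in> As"
  using measurable_space[OF measurable_hist_state assms] measurable_space[OF measurable_hist_action assms]
  by (simp_all add: space_BA)

lemma init: "p s0 \<in> Xs" "0 \<le> d0 $ i" "0 < z0 $ i" "z0 $ i \<le> 1" "0 \<le> z0 $ i"
  using AugD[OF init_Aug] by auto

lemma cost_at_bounds:
  assumes "h \<in> space (hist_space S BA n)" "k < n"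
  shows "0 \<le> cost_at h k $ i" "cost_at h k $ i \<le> c_hi"
  unfolding cost_at_def using assms hist_in[OF assms(1)]
  by (auto intro!: C_nonneg C_le p_in_Xs)

lemma aug_in_Aug:
  assumes h: "h \<in> space (hist_space S BA n)" shows "aug n h \<in> Aug"
  unfolding aug_def
proof (rule AugI)
  show "p (fst h n) \<in> Xs" using hist_in[OF h] p_in_Xs by simp
  fix i
  have b: "0 < \<beta> $ i" "\<beta> $ i < 1" using beta by auto
  show "0 \<le> (z0 * (\<Sum>k<n. \<beta> ^ k * cost_at h k) + d0) $ i"
    using init(2-5)[of i] b cost_at_bounds[OF h]
    by (auto simp: power_vec_nth intro!: add_nonneg_nonneg mult_nonneg_nonneg sum_nonneg)
  show "0 < (z0 * \<beta> ^ n) $ i" using init(2-5)[of i] b by (simp add: power_vec_nth)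
  show "(z0 * \<beta> ^ n) $ i \<le> 1" using init(2-5)[of i] b by (simp add: power_vec_nth mult_le_one power_le_one)
qed

text \<open>Cost paid so far plus the worst possible future never exceeds the worst total from the
  start. The resulting bound does not depend on \<open>n\<close>, so one constant dominates all
  expectations and the passage to infinite paths.\<close>

lemma bfun_aug_le:
  assumes h: "h \<in> space (hist_space S BA n)" shows "b_hi (aug n h) \<le> b_hi (p s0, d0, z0)"
  unfolding bfun_eq
proof (rule U_monoD)
  fix i
  show "0 \<le> (snd (snd (aug n h)) * (\<chi> i. c_hi / (1 - \<beta> $ i)) + fst (snd (aug n h))) $ i"
    using bfun_arg_nonneg[OF aug_in_Aug[OF h]] c_hi by simp
  have "z0 $ i * (\<beta> $ i ^ n * (c_hi / (1 - \<beta> $ i)) + (\<Sum>k<n. \<beta> $ i ^ k * cost_at h k $ i)) \<le> z0 $ i * (c_hi / (1 - \<beta> $ i))"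
    using geometric_tail_bound[of "\<beta> $ i" n "\<lambda>k. cost_at h k $ i" c_hi] beta cost_at_bounds[OF h] init(5)[of i]
    by (intro mult_left_mono) auto
  then show "(snd (snd (aug n h)) * (\<chi> i. c_hi / (1 - \<beta> $ i)) + fst (snd (aug n h))) $ i
    \<le> (snd (snd (p s0, d0, z0)) * (\<chi> i. c_hi / (1 - \<beta> $ i)) + fst (snd (p s0, d0, z0))) $ i"
    by (simp add: aug_def power_vec_nth distrib_left mult.assoc)
qed

definition bound where "bound = \<bar>U 0\<bar> + \<bar>b_hi (p s0, d0, z0)\<bar>"

lemma aug_bound:
  assumes "v \<in> Delta_le" "h \<in> space (hist_space S BA n)"
  shows "\<bar>v (aug n h)\<bar> \<le> bound"
  using Delta_leD(4,5)[OF assms(1) aug_in_Aug[OF assms(2)]] Ufun_ge[OF aug_in_Aug[OF assms(2)]] bfun_aug_le[OF assms(2)]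
  unfolding bound_def by linarith

lemma measurable_p_state: "k \<le> n \<Longrightarrow> (\<lambda>h. p (fst h k)) \<in> hist_space S BA n \<rightarrow>\<^sub>M BX"
  by (rule measurable_compose[OF measurable_hist_state p_measurable])

lemma measurable_cost_at: "k < n \<Longrightarrow> (\<lambda>h. cost_at h k) \<in> borel_measurable (hist_space S BA n)"
  unfolding cost_at_def by (intro measurable_C measurable_p_state measurable_hist_action) auto

lemma measurable_aug: "aug n \<in> hist_space S BA n \<rightarrow>\<^sub>M aug_space Xs"
  unfolding aug_def[abs_def]
  using aug_in_Aug[of _ n] unfolding aug_def
  by (intro measurable_aug_space measurable_p_state borel_measurable_add borel_measurable_vec_times
      borel_measurable_sum measurable_cost_at borel_measurable_const) auto

lemma measurable_comp_aug: "v \<in> Delta_le \<Longrightarrow> (\<lambda>h. v (aug n h)) \<in> borel_measurable (hist_space S BA n)"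
  by (rule measurable_compose[OF measurable_aug Delta_le_measurable])

section \<open>Expectations along a lifted process\<close>

lemma integrable_law:
  assumes "w \<in> borel_measurable (hist_space S BA n)" "\<And>h. h \<in> space (hist_space S BA n) \<Longrightarrow> \<bar>w h\<bar> \<le> B"
  shows "integrable (law n) (w :: _ \<Rightarrow> real)"
proof -
  interpret prob_space "law n" using hist_law_facts(1)[OF s0] .
  show ?thesis using assms hist_law_facts[OF s0, of n]
    by (intro integrable_const_bound[of _ B] AE_I2) (auto cong: measurable_cong_sets)
qed

lemma aug_extend:
  assumes "h \<in> space (hist_space S BA n)"
  shows "aug (Suc n) (extend n h s') = step (aug n h) (f n h) (p s')"
proof -
  have "(\<Sum>k<n. \<beta> ^ k * cost_at (extend n h s') k) = (\<Sum>k<n. \<beta> ^ k * cost_at h k)"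
    by (intro sum.cong) (auto simp: cost_at_def extend_def)
  moreover have "cost_at (extend n h s') n = C (p (fst h n)) (f n h) (p s')"
    by (simp add: cost_at_def extend_def)
  moreover have "fst (extend n h s') (Suc n) = s'" by (simp add: extend_def)
  ultimately show ?thesis by (simp add: aug_def step_def algebra_simps)
qed

text \<open>\<open>distr_p\<close> pushes the transition of the abstract state down to
  \<open>P\<close>, so only the projected state enters the expectation.\<close>

lemma integral_aug_extend:
  assumes v: "v \<in> Delta_le" and h: "h \<in> space (hist_space S BA n)"
  shows "(\<integral>s'. v (aug (Suc n) (extend n h s')) \<partial>trans n h) = L v (aug n h) (f n h)"
proof -
  have a: "f n h \<in> sect D (p (fst h n))" using policy_in[OF h] .
  have s: "fst h n \<in> space S" using hist_in[OF h] by simp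
  have "L v (aug n h) (f n h) = (\<integral>x'. v (step (aug n h) (f n h) x') \<partial>distr (trans n h) BX p)"
    using distr_p[OF s a] by (simp add: L_def trans_def aug_def)
  also have "\<dots> = (\<integral>s'. v (step (aug n h) (f n h) (p s')) \<partial>trans n h)"
  proof (rule integral_distr)
    show "p \<in> trans n h \<rightarrow>\<^sub>M BX" using p_measurable trans_facts(2)[OF h] by (simp cong: measurable_cong_sets)
    show "(\<lambda>x'. v (step (aug n h) (f n h) x')) \<in> borel_measurable BX"
      using Delta_le_step_measurable[OF v aug_in_Aug[OF h], of "f n h"] a P_facts(2)[OF a]
      by (simp add: aug_def cong: measurable_cong_sets)
  qed
  finally show ?thesis by (simp add: aug_extend[OF h])
qed

lemma expectation_step:
  assumes v: "v \<in> Delta_le"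
  shows "(\<integral>h. v (aug (Suc n) h) \<partial>law (Suc n)) = (\<integral>h. L v (aug n h) (f n h) \<partial>law n)"
    and "integrable (law n) (\<lambda>h. L v (aug n h) (f n h))"
proof -
  note * = integral_hist_law_Suc[OF s0 measurable_comp_aug[OF v] aug_bound[OF v], of n]
  note *(1)
  also have "(\<integral>h. (\<integral>s'. v (aug (Suc n) (extend n h s')) \<partial>trans n h) \<partial>law n) = (\<integral>h. L v (aug n h) (f n h) \<partial>law n)"
    using hist_law_facts(3)[OF s0, of n] integral_aug_extend[OF v]
    by (intro Bochner_Integration.integral_cong) auto
  finally show "(\<integral>h. v (aug (Suc n) h) \<partial>law (Suc n)) = (\<integral>h. L v (aug n h) (f n h) \<partial>law n)" .
  show "integrable (law n) (\<lambda>h. L v (aug n h) (f n h))"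
  proof (rule integrable_law)
    show "(\<lambda>h. L v (aug n h) (f n h)) \<in> borel_measurable (hist_space S BA n)"
      using *(2) integral_aug_extend[OF v] by (simp cong: measurable_cong)
    show "\<bar>L v (aug n h) (f n h)\<bar> \<le> bound" if h: "h \<in> space (hist_space S BA n)" for h
    proof -
      have a: "f n h \<in> sect D (fst (aug n h))" using policy_in[OF h] by (simp add: aug_def)
      have "U 0 \<le> L v (aug n h) (f n h)"
        by (intro L_ge[OF v aug_in_Aug[OF h] a] order_trans[OF Ufun_ge Delta_leD(4)[OF v]]
            step_Aug[OF aug_in_Aug[OF h] sectD(3)[OF a]])
      moreover have "L v (aug n h) (f n h) \<le> b_hi (aug n h)"
        by (intro L_le[OF v aug_in_Aug[OF h] a] order_trans[OF Delta_leD(5)[OF v] bfun_hi_step]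
            step_Aug[OF aug_in_Aug[OF h] sectD(3)[OF a]] aug_in_Aug[OF h] sectD(3)[OF a])
      ultimately show ?thesis using bfun_aug_le[OF h] unfolding bound_def by linarith
    qed
  qed
qed

lemma expectation_0:
  assumes v: "v \<in> Delta_le" shows "(\<integral>h. v (aug 0 h) \<partial>law 0) = v (p s0, d0, z0)"
proof -
  have "(\<integral>h. v (aug 0 h) \<partial>return (hist_space S BA 0) (hist0 s0)) = v (aug 0 (hist0 s0))"
    by (rule integral_return[OF hist0_in_space[OF s0] measurable_comp_aug[OF v]])
  then show ?thesis unfolding hist_law.simps hist0_def[symmetric]
    by (simp add: aug_def hist0_def)
qed

lemma expectation_ge: "v \<in> Delta_le \<Longrightarrow> (T ^^ n) v (p s0, d0, z0) \<le> (\<integral>h. v (aug n h) \<partial>law n)"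
proof (induction n arbitrary: v)
  case 0
  then show ?case by (simp add: expectation_0 del: hist_law.simps)
next
  case (Suc n)
  \<comment> \<open>The induction hypothesis is applied to \<open>T v\<close>, leaving one
    application of \<open>T\<close> at time \<open>n\<close>; there the infimum is at most the value
    of the action that the policy takes.\<close>
  have "(T ^^ n) (T v) (p s0, d0, z0) \<le> (\<integral>h. T v (aug n h) \<partial>law n)"
    by (rule Suc.IH[OF T_Delta_le[OF Suc.prems]])
  also have "\<dots> \<le> (\<integral>h. L v (aug n h) (f n h) \<partial>law n)"
  proof (rule integral_mono)
    show "integrable (law n) (\<lambda>h. T v (aug n h))"
      by (rule integrable_law[OF measurable_comp_aug aug_bound]) (intro T_Delta_le Suc.prems)+
    fix h assume "h \<in> space (law n)"
    then have h: "h \<in> space (hist_space S BA n)" using hist_law_facts(3)[OF s0] by simp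
    then show "T v (aug n h) \<le> L v (aug n h) (f n h)"
      using policy_in[OF h] by (intro T_le_L Suc.prems aug_in_Aug) (simp_all add: aug_def)
  qed (rule expectation_step(2)[OF Suc.prems])
  also have "\<dots> = (\<integral>h. v (aug (Suc n) h) \<partial>law (Suc n))" by (rule expectation_step(1)[OF Suc.prems, symmetric])
  finally show ?case by (simp add: funpow_swap1 del: hist_law.simps)
qed

text \<open>The martingale property: if the chosen actions preserve \<open>v\<close> in conditional
  expectation, every expectation equals the initial value.\<close>

lemma expectation_eq:
  assumes v: "v \<in> Delta_le" and opt: "\<And>n h. h \<in> space (hist_space S BA n) \<Longrightarrow> L v (aug n h) (f n h) = v (aug n h)"
  shows "(\<integral>h. v (aug n h) \<partial>law n) = v (p s0, d0, z0)"
proof (induction n)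
  case 0
  show ?case by (rule expectation_0[OF v])
next
  case (Suc n)
  have "(\<integral>h. v (aug (Suc n) h) \<partial>law (Suc n)) = (\<integral>h. v (aug n h) \<partial>law n)"
    unfolding expectation_step(1)[OF v] using opt hist_law_facts(3)[OF s0]
    by (intro Bochner_Integration.integral_cong) auto
  with Suc show ?case by simp
qed

definition total_cost :: real where
  "total_cost = (\<integral>\<omega>. U (z0 * (\<Sum>k. \<beta> ^ k * cost_at \<omega> k) + d0) \<partial>path_law S BA Q f s0)"

lemma Ufun_aug_hist_proj: "Ufun U (aug n (hist_proj n \<omega>)) = U (z0 * (\<Sum>k<n. \<beta> ^ k * cost_at \<omega> k) + d0)"
  by (auto simp: aug_def Ufun_def hist_proj_def cost_at_def intro!: arg_cong[where f=U] sum.cong)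

text \<open>The partial sums converge along every path, \<open>U\<close> is continuous at their
  limit, and \<open>bound\<close> dominates, so the truncated expectations converge.\<close>

lemma total_cost_limit: "(\<lambda>n. \<integral>h. Ufun U (aug n h) \<partial>law n) \<longlonglongrightarrow> total_cost"
proof -
  let ?M = "path_law S BA Q f s0"
  note sets_M = path_law_facts(1)[OF s0]
  interpret M: prob_space ?M using path_law_facts(2)[OF s0] .
  have proj: "hist_proj n \<in> ?M \<rightarrow>\<^sub>M hist_space S BA n" for n
    using measurable_hist_proj sets_M by (simp cong: measurable_cong_sets)
  note h = measurable_space[OF proj]
  let ?s = "\<lambda>n \<omega>. Ufun U (aug n (hist_proj n \<omega>))"
  have meas: "?s n \<in> borel_measurable ?M" for n
    by (rule measurable_compose[OF proj measurable_comp_aug[OF Ufun_Delta_le]])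
  have lim: "(\<lambda>n. ?s n \<omega>) \<longlonglongrightarrow> U (z0 * (\<Sum>k. \<beta> ^ k * cost_at \<omega> k) + d0)" if \<omega>: "\<omega> \<in> space ?M" for \<omega>
  proof -
    \<comment> \<open>The cost of stage \<open>k\<close> involves state \<open>k + 1\<close>, so its
      bounds come from the history at time \<open>Suc k\<close>.\<close>
    have b: "0 \<le> cost_at \<omega> k $ i" "cost_at \<omega> k $ i \<le> c_hi" for k i
      using cost_at_bounds[OF h[OF \<omega>, of "Suc k"], of k i] by (auto simp: hist_proj_def cost_at_def)
    have "(\<lambda>n. \<Sum>k<n. \<beta> ^ k * cost_at \<omega> k) \<longlonglongrightarrow> (\<Sum>k. \<beta> ^ k * cost_at \<omega> k)"
      using beta b by (intro discounted_vec_sums[where c=c_hi]) auto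
    then have lim: "(\<lambda>n. z0 * (\<Sum>k<n. \<beta> ^ k * cost_at \<omega> k) + d0) \<longlonglongrightarrow> z0 * (\<Sum>k. \<beta> ^ k * cost_at \<omega> k) + d0"
      by (intro tendsto_add tendsto_vec_times tendsto_const)
    have nonneg: "0 \<le> (z0 * (\<Sum>k<n. \<beta> ^ k * cost_at \<omega> k) + d0) $ i" for n i
      using init(2-5)[of i] b beta
      by (auto simp: power_vec_nth less_imp_le intro!: add_nonneg_nonneg mult_nonneg_nonneg sum_nonneg)
    have "0 \<le> (z0 * (\<Sum>k. \<beta> ^ k * cost_at \<omega> k) + d0) $ i" for i
      by (rule LIMSEQ_le_const[OF tendsto_vec_nth[OF lim, of i]]) (use nonneg in auto)
    then show ?thesis unfolding Ufun_aug_hist_proj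
      using nonneg by (intro continuous_on_tendsto_compose[OF U_cont lim]) auto
  qed
  have "(\<lambda>n. \<integral>\<omega>. ?s n \<omega> \<partial>?M) \<longlonglongrightarrow> total_cost"
    unfolding total_cost_def
  proof (rule integral_dominated_convergence[where w="\<lambda>_. bound"])
    show "(\<lambda>\<omega>. U (z0 * (\<Sum>k. \<beta> ^ k * cost_at \<omega> k) + d0)) \<in> borel_measurable ?M"
      using lim meas by (rule borel_measurable_LIMSEQ_real)
    show "AE \<omega> in ?M. norm (?s n \<omega>) \<le> bound" for n
      using aug_bound[OF Ufun_Delta_le h] by (intro AE_I2) simp
  qed (use meas lim in auto)
  then show ?thesis
    using integral_path_law_hist[OF s0 measurable_comp_aug[OF Ufun_Delta_le]] by simp
qed

lemma total_cost_ge: "Vlim (p s0, d0, z0) \<le> total_cost"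
  by (rule LIMSEQ_le[OF funpow_T_Ufun_tendsto[OF init_Aug] total_cost_limit])
     (auto intro: expectation_ge[OF Ufun_Delta_le] simp del: hist_law.simps)

lemma total_cost_eq:
  assumes opt: "\<And>n h. h \<in> space (hist_space S BA n) \<Longrightarrow> L Vlim (aug n h) (f n h) = Vlim (aug n h)"
  shows "total_cost = Vlim (p s0, d0, z0)"
proof (rule antisym[OF _ total_cost_ge])
  have "(\<integral>h. Ufun U (aug n h) \<partial>law n) \<le> Vlim (p s0, d0, z0)" for n
  proof -
    have "(\<integral>h. Ufun U (aug n h) \<partial>law n) \<le> (\<integral>h. Vlim (aug n h) \<partial>law n)"
      using hist_law_facts(3)[OF s0] Delta_leD(4)[OF Vlim_Delta_le aug_in_Aug]
      by (intro integral_mono integrable_law[OF measurable_comp_aug aug_bound] Ufun_Delta_le Vlim_Delta_le) auto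
    also have "\<dots> = Vlim (p s0, d0, z0)" by (rule expectation_eq[OF Vlim_Delta_le opt])
    finally show ?thesis .
  qed
  then show "total_cost \<le> Vlim (p s0, d0, z0)"
    by (intro LIMSEQ_le_const2[OF total_cost_limit]) auto
qed

end

subsection \<open>Optimal policies\<close>

lemma (in lifted_process) decision_rule_policy:
  assumes g: "is_decision_rule Xs As D g"
  shows "is_policy S BA (\<lambda>s. sect D (p s)) (\<lambda>n h. g (aug n h))"
  unfolding is_policy_def
proof (intro allI conjI ballI)
  fix n
  have "g \<in> aug_space Xs \<rightarrow>\<^sub>M BA" using g by (simp add: is_decision_rule_def)
  from measurable_compose[OF measurable_aug this] show "(\<lambda>h. g (aug n h)) \<in> hist_space S BA n \<rightarrow>\<^sub>M BA" .
  fix h assume "h \<in> space (hist_space S BA n)"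
  from aug_in_Aug[OF this] g show "g (aug n h) \<in> sect D (p (fst h n))"
    unfolding is_decision_rule_def aug_def by blast
qed

context exp_utility_mdp
begin

lemma decision_ruleD:
  assumes "is_decision_rule Xs As D g"
  shows "g \<in> aug_space Xs \<rightarrow>\<^sub>M BA" "s \<in> Aug \<Longrightarrow> g s \<in> sect D (fst s)"
  using assms by (auto simp: is_decision_rule_def)

lemma L_cong:
  assumes "\<And>s. s \<in> Aug \<Longrightarrow> v s = w s" "s \<in> Aug" "a \<in> sect D (fst s)"
  shows "L v s a = L w s a"
  unfolding L_def using P_facts(3)[OF assms(3)] assms(1)[OF step_Aug[OF assms(2) sectD(3)[OF assms(3)]]]
  by (intro Bochner_Integration.integral_cong) auto

lemma T_cong:
  assumes "\<And>s. s \<in> Aug \<Longrightarrow> v s = w s" "s \<in> Aug"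
  shows "T v s = T w s"
  unfolding T_eq_L using L_cong[OF assms] by (intro INF_cong) auto

lemma measurable_P:
  assumes "g \<in> M \<rightarrow>\<^sub>M BX" "a \<in> M \<rightarrow>\<^sub>M BA" "\<And>\<omega>. \<omega> \<in> space M \<Longrightarrow> a \<omega> \<in> sect D (g \<omega>)"
  shows "(\<lambda>\<omega>. P (g \<omega>) (a \<omega>)) \<in> M \<rightarrow>\<^sub>M subprob_algebra BX"
proof -
  have "(\<lambda>\<omega>. (g \<omega>, a \<omega>)) \<in> M \<rightarrow>\<^sub>M restrict_space borel D"
    using assms(1,2) sectD(1)[OF assms(3)]
    by (intro measurable_restrict_space2 borel_measurable_Pair) (auto simp: measurable_restrict_space2_iff)
  from measurable_compose[OF this P_kernel] show ?thesis by simp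
qed

section \<open>The original and the augmented problem as lifted processes\<close>

lemma lifted_process_orig:
  assumes f: "is_policy BX BA (sect D) f" and x: "x \<in> Xs"
  shows "lifted_process Xs As D P U C \<beta> c_lo c_hi BX (\<lambda>x. x) P f x 0 1"
proof -
  let ?R = "restrict_space (BX \<Otimes>\<^sub>M BA) {(s, a). a \<in> sect D s}"
  have "(\<lambda>\<omega>. P (fst \<omega>) (snd \<omega>)) \<in> ?R \<rightarrow>\<^sub>M subprob_algebra BX"
    by (intro measurable_P measurable_restrict_space1 measurable_fst measurable_snd) (auto simp: space_restrict_space)
  then have "(\<lambda>(s, a). P s a) \<in> ?R \<rightarrow>\<^sub>M subprob_algebra BX" by (simp add: case_prod_beta)
  from controlled_process.intro[OF this P_facts(1) f] have "controlled_process BX BA (sect D) P f" .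
  moreover have "distr (P s a) BX (\<lambda>x. x) = P s a" if "a \<in> sect D s" for s a
    using P_facts(2)[OF that, symmetric] by (rule distr_id2)
  moreover have "(x, 0, 1) \<in> Aug" using x by (auto intro: AugI)
  ultimately show ?thesis
    using x by (intro lifted_process.intro exp_utility_mdp_axioms lifted_process_axioms.intro) (auto simp: space_BX)
qed

lemma aug_kernel_eq: "aug_kernel Xs P C \<beta> s a = distr (P (fst s) a) (aug_space Xs) (step s a)"
  by (cases s) (simp add: aug_kernel_def step_def[abs_def])

lemma measurable_step_P:
  assumes "s \<in> Aug" "a \<in> sect D (fst s)"
  shows "step s a \<in> P (fst s) a \<rightarrow>\<^sub>M aug_space Xs"
proof (rule measurable_step)
  show "(\<lambda>x. x) \<in> P (fst s) a \<rightarrow>\<^sub>M BX" using P_facts(2)[OF assms(2)] by (simp add: measurable_ident_sets)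
qed (use assms sectD(3)[OF assms(2)] in \<open>auto simp: space_aug_space space_BA\<close>)

lemma measurable_fst_aug_space: "(fst :: 'x \<times> (real^'i) \<times> (real^'i) \<Rightarrow> 'x) \<in> aug_space Xs \<rightarrow>\<^sub>M BX"
  unfolding aug_space_def using AugD(1)
  by (intro measurable_restrict_space2 measurable_restrict_space1 borel_measurable_continuous_onI continuous_intros)
     (auto simp: space_restrict_space)

lemma lifted_process_aug:
  assumes f: "is_policy (aug_space Xs) BA (aug_sect D) f" and s: "(x, d, z) \<in> Aug"
  shows "lifted_process Xs As D P U C \<beta> c_lo c_hi (aug_space Xs) fst (aug_kernel Xs P C \<beta>) f (x, d, z) d z"
proof -
  have sect: "aug_sect D = (\<lambda>s. sect D (fst s))" by (simp add: aug_sect_def fun_eq_iff)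
  let ?R = "restrict_space ((aug_space Xs :: ('x \<times> (real^'i) \<times> (real^'i)) measure) \<Otimes>\<^sub>M BA) {(s, a). a \<in> sect D (fst s)}"
  have R: "fst \<in> ?R \<rightarrow>\<^sub>M aug_space Xs" "snd \<in> ?R \<rightarrow>\<^sub>M BA"
    by (auto intro!: measurable_restrict_space1)
  have "(\<lambda>\<omega>. distr (P (fst (fst \<omega>)) (snd \<omega>)) (aug_space Xs) (step (fst \<omega>) (snd \<omega>))) \<in> ?R \<rightarrow>\<^sub>M subprob_algebra (aug_space Xs)"
  proof (rule measurable_distr2)
    show "(\<lambda>\<omega>. P (fst (fst \<omega>)) (snd \<omega>)) \<in> ?R \<rightarrow>\<^sub>M subprob_algebra BX"
      by (intro measurable_P measurable_compose[OF R(1) measurable_fst_aug_space] R(2)) (auto simp: space_restrict_space)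
    have "(\<lambda>q. step (fst (fst q)) (snd (fst q)) (snd q)) \<in> ?R \<Otimes>\<^sub>M BX \<rightarrow>\<^sub>M aug_space Xs"
      by (intro measurable_step measurable_compose[OF measurable_fst R(1)] measurable_compose[OF measurable_fst R(2)] measurable_snd)
    then show "(\<lambda>(\<omega>, x'). step (fst \<omega>) (snd \<omega>) x') \<in> ?R \<Otimes>\<^sub>M BX \<rightarrow>\<^sub>M aug_space Xs"
      by (simp add: case_prod_beta)
  qed
  then have "(\<lambda>(s, a). aug_kernel Xs P C \<beta> s a) \<in> ?R \<rightarrow>\<^sub>M subprob_algebra (aug_space Xs)"
    by (simp add: aug_kernel_eq case_prod_beta)
  moreover have "prob_space (aug_kernel Xs P C \<beta> s a)" if "s \<in> space (aug_space Xs)" "a \<in> sect D (fst s)" for s a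
    unfolding aug_kernel_eq using that
    by (intro prob_space.prob_space_distr P_facts(1) measurable_step_P) (auto simp: space_aug_space)
  ultimately have "controlled_process (aug_space Xs) BA (\<lambda>s. sect D (fst s)) (aug_kernel Xs P C \<beta>) f"
    using f unfolding sect by (rule controlled_process.intro)
  moreover have "distr (aug_kernel Xs P C \<beta> s a) BX fst = P (fst s) a"
    if "s \<in> space (aug_space Xs)" "a \<in> sect D (fst s)" for s a
  proof -
    have "distr (aug_kernel Xs P C \<beta> s a) BX fst = distr (P (fst s) a) BX (fst \<circ> step s a)"
      unfolding aug_kernel_eq using that
      by (intro distr_distr measurable_fst_aug_space measurable_step_P) (auto simp: space_aug_space)
    also have "fst \<circ> step s a = (\<lambda>x. x)" by (simp add: step_def fun_eq_iff)
    also have "distr (P (fst s) a) BX (\<lambda>x. x) = P (fst s) a" using P_facts(2)[OF that(2), symmetric] by (rule distr_id2)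
    finally show ?thesis .
  qed
  ultimately show ?thesis
    using s by (intro lifted_process.intro exp_utility_mdp_axioms lifted_process_axioms.intro measurable_fst_aug_space)
      (auto simp: space_aug_space)
qed

lemma optimal_decision_rule:
  assumes "\<And>s. s \<in> Aug \<Longrightarrow> T_g P C \<beta> g Vlim s = T Vlim s" "s \<in> Aug"
  shows "L Vlim s (g s) = Vlim s"
  using assms(1)[OF assms(2)] T_Vlim[OF assms(2)] by (simp add: T_g_eq_L)

lemma V_aug_eq_Vlim:
  assumes s: "s \<in> Aug" shows "V_aug Xs As D P U C \<beta> s = Vlim s"
proof -
  obtain x d z where s_eq: "s = (x, d, z)" by (metis prod.exhaust)
  have sect: "aug_sect D = (\<lambda>s. sect D (fst s))" by (simp add: aug_sect_def fun_eq_iff)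
  obtain g where g: "is_decision_rule Xs As D g" "\<And>s. s \<in> Aug \<Longrightarrow> T_g P C \<beta> g Vlim s = T Vlim s"
    using ex_optimal_decision_rule[OF Vlim_Delta_le] by blast
  have cost: "aug_cost Xs As P U C \<beta> f s = lifted_process.total_cost As U C \<beta> (aug_space Xs) fst (aug_kernel Xs P C \<beta>) f (x, d, z) d z"
    if f: "is_policy (aug_space Xs) BA (aug_sect D) f" for f
  proof -
    interpret lp: lifted_process Xs As D P U C \<beta> c_lo c_hi "aug_space Xs" fst "aug_kernel Xs P C \<beta>" f "(x, d, z)" d z
      using lifted_process_aug[OF f] s by (simp add: s_eq)
    show ?thesis unfolding lp.total_cost_def lp.cost_at_def by (simp add: s_eq aug_cost_def)
  qed
  have ge: "Vlim s \<le> aug_cost Xs As P U C \<beta> f s" if f: "is_policy (aug_space Xs) BA (aug_sect D) f" for f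
  proof -
    interpret lp: lifted_process Xs As D P U C \<beta> c_lo c_hi "aug_space Xs" fst "aug_kernel Xs P C \<beta>" f "(x, d, z)" d z
      using lifted_process_aug[OF f] s by (simp add: s_eq)
    show ?thesis using lp.total_cost_ge cost[OF f] by (simp add: s_eq)
  qed
  \<comment> \<open>\<open>f0\<close> merely gives access to the locale. As \<open>aug\<close> does
    not mention the policy, \<open>lp0.aug\<close> can be used to define the policy
    \<open>?f\<close>, for which the locale is then interpreted again.\<close>
  define f0 :: "nat \<Rightarrow> ('x \<times> (real^'i) \<times> (real^'i), 'a) hist \<Rightarrow> 'a" where "f0 n h = g (fst h n)" for n h
  have state: "(\<lambda>h. fst h n) \<in> hist_space (aug_space Xs :: ('x \<times> (real^'i) \<times> (real^'i)) measure) BA n \<rightarrow>\<^sub>M aug_space Xs" for n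
    unfolding hist_space_def by measurable
  have f0: "is_policy (aug_space Xs) BA (aug_sect D) f0"
    unfolding is_policy_def sect f0_def[abs_def]
    using measurable_compose[OF state decision_ruleD(1)[OF g(1)]]
      decision_ruleD(2)[OF g(1) measurable_space[OF state, unfolded space_aug_space]] by blast
  interpret lp0: lifted_process Xs As D P U C \<beta> c_lo c_hi "aug_space Xs" fst "aug_kernel Xs P C \<beta>" f0 "(x, d, z)" d z
    using lifted_process_aug[OF f0] s by (simp add: s_eq)
  let ?f = "\<lambda>n h. g (lp0.aug n h)"
  have f: "is_policy (aug_space Xs) BA (aug_sect D) ?f"
    unfolding sect by (rule lp0.decision_rule_policy[OF g(1)])
  interpret lp: lifted_process Xs As D P U C \<beta> c_lo c_hi "aug_space Xs" fst "aug_kernel Xs P C \<beta>" ?f "(x, d, z)" d z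
    using lifted_process_aug[OF f] s by (simp add: s_eq)
  have "lp.total_cost = Vlim s"
    using lp.total_cost_eq[OF optimal_decision_rule[OF g(2) lp0.aug_in_Aug]] by (simp add: s_eq)
  then have eq: "aug_cost Xs As P U C \<beta> ?f s = Vlim s" using cost[OF f] by simp
  show ?thesis unfolding V_aug_def
  proof (rule cInf_eq_minimum)
    show "Vlim s \<in> (\<lambda>f. aug_cost Xs As P U C \<beta> f s) ` {f. is_policy (aug_space Xs) BA (aug_sect D) f}"
      using eq f by (intro image_eqI[of _ _ ?f]) auto
  qed (use ge in auto)
qed

lemma optimal_orig:
  assumes g: "is_decision_rule Xs As D g" "\<And>s. s \<in> Aug \<Longrightarrow> T_g P C \<beta> g Vlim s = T Vlim s"
  defines "f \<equiv> \<lambda>n (h :: ('x, 'a) hist). g (fst h n, \<Sum>k<n. \<beta> ^ k * C (fst h k) (snd h k) (fst h (Suc k)), \<beta> ^ n)"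
  shows "is_policy BX BA (sect D) f"
    and "x \<in> Xs \<Longrightarrow> orig_cost Xs As P U C \<beta> f x = V_inf Xs As D P U C \<beta> x"
proof -
  have cost: "orig_cost Xs As P U C \<beta> f x = lifted_process.total_cost As U C \<beta> BX (\<lambda>x. x) P f x 0 1"
    if f: "is_policy BX BA (sect D) f" and x: "x \<in> Xs" for f x
  proof -
    interpret lp: lifted_process Xs As D P U C \<beta> c_lo c_hi BX "\<lambda>x. x" P f x 0 1
      by (rule lifted_process_orig[OF f x])
    show ?thesis unfolding lp.total_cost_def lp.cost_at_def by (simp add: orig_cost_def)
  qed
  have ge: "Vlim (x, 0, 1) \<le> orig_cost Xs As P U C \<beta> f x" if f: "is_policy BX BA (sect D) f" and x: "x \<in> Xs" for f x
  proof -
    interpret lp: lifted_process Xs As D P U C \<beta> c_lo c_hi BX "\<lambda>x. x" P f x 0 1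
      by (rule lifted_process_orig[OF f x])
    show ?thesis using lp.total_cost_ge cost[OF f x] by simp
  qed
  \<comment> \<open>Again an auxiliary policy for entering the locale, now with accumulated cost 0
    and discount 1 inserted at all times.\<close>
  define f0 :: "nat \<Rightarrow> ('x, 'a) hist \<Rightarrow> 'a" where "f0 n h = g (fst h n, 0, 1)" for n h
  have Aug1: "(y, 0, 1) \<in> Aug" if "y \<in> Xs" for y using that by (auto intro: AugI)
  have state: "(\<lambda>h. fst h n) \<in> hist_space BX BA n \<rightarrow>\<^sub>M BX" for n
    unfolding hist_space_def by measurable
  then have "(\<lambda>h. (fst h n, 0 :: real^'i, 1 :: real^'i)) \<in> hist_space BX BA n \<rightarrow>\<^sub>M aug_space Xs" for n
    using measurable_space[OF state] Aug1 by (intro measurable_aug_space) (auto simp: space_BX)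
  from measurable_compose[OF this decision_ruleD(1)[OF g(1)]]
  have f0: "is_policy BX BA (sect D) f0"
    using decision_ruleD(2)[OF g(1) Aug1[OF measurable_space[OF state, unfolded space_BX]]]
    unfolding is_policy_def f0_def[abs_def] fst_conv by blast
  \<comment> \<open>Starting from cost 0 and discount 1, the state recomputed by \<open>aug\<close>
    is exactly the argument at which \<open>f\<close> evaluates \<open>g\<close>.\<close>
  have f_eq: "f = (\<lambda>n h. g (lifted_process.aug C \<beta> (\<lambda>x. x) 0 1 n h))" if x: "x \<in> Xs" for x
  proof -
    interpret lp0: lifted_process Xs As D P U C \<beta> c_lo c_hi BX "\<lambda>x. x" P f0 x 0 1
      by (rule lifted_process_orig[OF f0 x])
    show ?thesis by (simp add: f_def lp0.aug_def lp0.cost_at_def fun_eq_iff)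
  qed
  obtain x0 where x0: "x0 \<in> Xs" using Xs_ne by blast
  interpret lp0: lifted_process Xs As D P U C \<beta> c_lo c_hi BX "\<lambda>x. x" P f0 x0 0 1
    by (rule lifted_process_orig[OF f0 x0])
  show f: "is_policy BX BA (sect D) f"
    unfolding f_eq[OF x0] by (rule lp0.decision_rule_policy[OF g(1)])
  assume x: "x \<in> Xs"
  interpret lp: lifted_process Xs As D P U C \<beta> c_lo c_hi BX "\<lambda>x. x" P f x 0 1
    by (rule lifted_process_orig[OF f x])
  have "L Vlim (lp.aug n h) (f n h) = Vlim (lp.aug n h)" if "h \<in> space (hist_space BX BA n)" for n h
    using optimal_decision_rule[OF g(2) lp.aug_in_Aug[OF that]] by (simp add: f_eq[OF x])
  then have eq: "orig_cost Xs As P U C \<beta> f x = Vlim (x, 0, 1)"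
    unfolding cost[OF f x] by (rule lp.total_cost_eq)
  also have "\<dots> = V_inf Xs As D P U C \<beta> x" unfolding V_inf_def
  proof (rule cInf_eq_minimum[symmetric])
    show "Vlim (x, 0, 1) \<in> (\<lambda>f. orig_cost Xs As P U C \<beta> f x) ` {f. is_policy BX BA (sect D) f}"
      using eq f by (intro image_eqI[of _ _ f]) auto
  qed (use ge x in auto)
  finally show "orig_cost Xs As P U C \<beta> f x = V_inf Xs As D P U C \<beta> x" .
qed

end

section \<open>The empty state space and the transfer from \<open>Vlim\<close> to
  \<open>V_aug\<close>\<close>

lemma aug_states_empty [simp]: "aug_states {} = {}"
  by (simp add: aug_states_def)

lemma Delta_cong:
  assumes "v \<in> Delta Xs U" "\<And>s. s \<in> aug_states Xs \<Longrightarrow> w s = v s"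
  shows "w \<in> Delta Xs U"
proof -
  have "lsc_on (aug_states Xs) w" using assms by (auto simp: Delta_def cong: lsc_on_cong)
  moreover have "continuous_on {(d, z). (x, d, z) \<in> aug_states Xs} (\<lambda>(d, z). w (x, d, z)) \<longleftrightarrow>
      continuous_on {(d, z). (x, d, z) \<in> aug_states Xs} (\<lambda>(d, z). v (x, d, z))" for x
    using assms(2) by (intro continuous_on_cong) auto
  ultimately show ?thesis using assms by (auto simp: Delta_def)
qed

theorem theorem3:
  fixes Xs :: "'x::polish_space set" and As :: "'a::polish_space set"
    and D :: "('x \<times> 'a) set"
    and P :: "'x \<Rightarrow> 'a \<Rightarrow> 'x measure"
    and U :: "(real^'i::finite) \<Rightarrow> real"
    and C :: "'x \<Rightarrow> 'a \<Rightarrow> 'x \<Rightarrow> (real^'i)"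
    and \<beta> :: "(real^'i)"
    and c_lo c_hi :: real
  assumes Xs_borel: "Xs \<in> sets borel" and As_borel: "As \<in> sets borel"
    and D_borel: "D \<in> sets borel" and D_sub: "D \<subseteq> Xs \<times> As"
    and D_ne: "\<forall>x \<in> Xs. sect D x \<noteq> {}"
    and P_kernel: "(\<lambda>(x, a). P x a) \<in> measurable (restrict_space borel D)
                      (subprob_algebra (restrict_space borel Xs))"
    and P_prob: "\<forall>(x, a) \<in> D. prob_space (P x a)"
    and beta: "\<forall>i. 0 < \<beta> $ i \<and> \<beta> $ i < 1"
    and U_cont: "continuous_on {d. \<forall>i. 0 \<le> d $ i} U"
    and U_mono: "\<forall>d d'. (\<forall>i. 0 \<le> d $ i) \<longrightarrow> d \<le> d' \<longrightarrow> U d \<le> U d'"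
    and D_compact: "\<forall>x \<in> Xs. compact (sect D x)"
    and D_acc: "\<forall>xs x as. (\<forall>n. xs n \<in> Xs) \<longrightarrow> x \<in> Xs \<longrightarrow> xs \<longlonglongrightarrow> x \<longrightarrow>
                   (\<forall>n. as n \<in> sect D (xs n)) \<longrightarrow>
                   (\<exists>a \<in> sect D x. \<exists>r. strict_mono r \<and> (as \<circ> r) \<longlonglongrightarrow> a)"
    and C_lsc: "\<forall>i. lsc_on (Xs \<times> As \<times> Xs) (\<lambda>(x, a, x'). C x a x' $ i)"
    and c_pos: "0 < c_lo"
    and C_bounds: "\<forall>x \<in> Xs. \<forall>a \<in> As. \<forall>x' \<in> Xs. \<forall>i. c_lo \<le> C x a x' $ i \<and> C x a x' $ i \<le> c_hi"
    and P_weak: "\<forall>w. continuous_on Xs w \<and> bounded (w ` Xs) \<longrightarrow>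
                   continuous_on D (\<lambda>(x, a). \<integral>x'. (w x' :: real) \<partial>P x a)"
  defines "V \<equiv> V_aug Xs As D P U C \<beta>"
    and "T \<equiv> T_op D P C \<beta>"
    and "b_lo \<equiv> bfun U \<beta> c_lo"
    and "b_hi \<equiv> bfun U \<beta> c_hi"
  shows
    \<comment> \<open>a)\<close>
    "(\<forall>K. compact K \<and> K \<subseteq> {d. \<forall>i. 0 \<le> d $ i} \<longrightarrow>
       (let S = {(x, d, z). x \<in> Xs \<and> d \<in> K \<and> (\<forall>i. 0 < z $ i \<and> z $ i < 1)} in
         (\<forall>n. \<forall>s \<in> S. (T ^^ n) b_lo s \<le> (T ^^ Suc n) b_lo s) \<and>
         uniform_limit S (\<lambda>n. (T ^^ n) b_lo) V sequentially \<and>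
         (\<forall>n. \<forall>s \<in> S. (T ^^ n) (Ufun U) s \<le> (T ^^ Suc n) (Ufun U) s) \<and>
         uniform_limit S (\<lambda>n. (T ^^ n) (Ufun U)) V sequentially \<and>
         (\<forall>n. \<forall>s \<in> S. (T ^^ Suc n) b_hi s \<le> (T ^^ n) b_hi s) \<and>
         uniform_limit S (\<lambda>n. (T ^^ n) b_hi) V sequentially))
     \<and>
    \<comment> \<open>b)\<close>
     (V \<in> Delta Xs U \<and> (\<forall>s \<in> aug_states Xs. V s = T V s) \<and>
      (\<forall>s \<in> aug_states Xs. b_lo s \<le> V s \<and> V s \<le> b_hi s) \<and>
      (\<forall>v. v \<in> Delta Xs U \<and> (\<forall>s \<in> aug_states Xs. v s = T v s) \<and>
           (\<forall>s \<in> aug_states Xs. b_lo s \<le> v s \<and> v s \<le> b_hi s)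
           \<longrightarrow> (\<forall>s \<in> aug_states Xs. v s = V s)))
     \<and>
    \<comment> \<open>c)\<close>
     (\<exists>g. is_decision_rule Xs As D g \<and> (\<forall>s \<in> aug_states Xs. T_g P C \<beta> g V s = T V s))
     \<and>
    \<comment> \<open>d)\<close>
     (\<forall>g. is_decision_rule Xs As D g \<and> (\<forall>s \<in> aug_states Xs. T_g P C \<beta> g V s = T V s) \<longrightarrow>
        (let f = (\<lambda>n h. g (fst h n,
                           \<Sum>k<n. \<beta> ^ k * C (fst h k) (snd h k) (fst h (Suc k)),
                           \<beta> ^ n))
         in is_policy (restrict_space borel Xs) (restrict_space borel As) (sect D) f \<and>
            (\<forall>x \<in> Xs. orig_cost Xs As P U C \<beta> f x = V_inf Xs As D P U C \<beta> x)))"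
proof (cases "Xs = {}")
  case True
  \<comment> \<open>The state index set always contains 0, so without states there are no histories,
    and every policy condition holds vacuously.\<close>
  have empty: "space (hist_space (restrict_space borel Xs) M n) = {}" for n and M :: "'a measure"
    using True by (auto simp: hist_space_def space_pair_measure space_PiM space_restrict_space PiE_def)
  have "is_decision_rule Xs As D (\<lambda>_ :: 'x \<times> (real^'i) \<times> (real^'i). undefined)"
    by (auto simp: is_decision_rule_def aug_space_def measurable_def space_restrict_space True)
  moreover have "is_policy (restrict_space borel Xs) (restrict_space borel As) (sect D) f" for f
    unfolding is_policy_def by (auto simp: measurable_def empty)
  moreover have "V \<in> Delta Xs U" using True by (simp add: Delta_def lsc_on_def)
  ultimately show ?thesis
    using True by (auto simp: uniform_limit_iff Let_def)
next
  case False
  interpret exp_utility_mdp Xs As D P U C \<beta> c_lo c_hi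
    using False D_sub D_ne P_kernel P_prob beta U_cont U_mono D_compact D_acc C_lsc c_pos C_bounds P_weak
    by (rule exp_utility_mdp.intro)
  \<comment> \<open>The two functions are identified on \<open>aug_states Xs\<close> only, hence the
    congruence lemmas for \<open>L\<close>, \<open>T\<close> and \<open>Delta\<close> below.\<close>
  have V: "V s = Vlim s" if "s \<in> aug_states Xs" for s
    using V_aug_eq_Vlim[OF that] by (simp add: V_def)
  have a: "let S = {(x, d, z). x \<in> Xs \<and> d \<in> K \<and> (\<forall>i. 0 < z $ i \<and> z $ i < 1)} in
         (\<forall>n. \<forall>s \<in> S. (T ^^ n) b_lo s \<le> (T ^^ Suc n) b_lo s) \<and>
         uniform_limit S (\<lambda>n. (T ^^ n) b_lo) V sequentially \<and>
         (\<forall>n. \<forall>s \<in> S. (T ^^ n) (Ufun U) s \<le> (T ^^ Suc n) (Ufun U) s) \<and>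
         uniform_limit S (\<lambda>n. (T ^^ n) (Ufun U)) V sequentially \<and>
         (\<forall>n. \<forall>s \<in> S. (T ^^ Suc n) b_hi s \<le> (T ^^ n) b_hi s) \<and>
         uniform_limit S (\<lambda>n. (T ^^ n) b_hi) V sequentially"
    if K: "compact K" "K \<subseteq> {d. \<forall>i. 0 \<le> d $ i}" for K
  proof -
    define S where "S = {(x :: 'x, d, z :: real^'i). x \<in> Xs \<and> d \<in> K \<and> (\<forall>i. 0 < z $ i \<and> z $ i < 1)}"
    have S: "S \<subseteq> aug_states Xs" "\<And>s. s \<in> S \<Longrightarrow> fst (snd s) \<in> K"
      using K(2) by (auto simp: S_def aug_states_def less_imp_le)
    have lim: "uniform_limit S F V sequentially"
      if "\<And>n s. s \<in> S \<Longrightarrow> (T ^^ n) (Ufun U) s \<le> F n s" "\<And>n s. s \<in> S \<Longrightarrow> F n s \<le> (T ^^ n) b_hi s" for F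
      using funpow_T_uniform_limit[OF K(1) S, of F] that S(1) V unfolding T_def b_hi_def
      by (subst uniform_limit_cong'[where g=F and i=Vlim]) auto
    show ?thesis unfolding Let_def S_def[symmetric]
      using S(1) funpow_T_lo_Suc funpow_T_Ufun_Suc funpow_T_hi_Suc
        funpow_T_Ufun_le_lo funpow_T_lo_le_hi funpow_T_Ufun_le_hi
      by (intro conjI lim) (auto simp: T_def b_lo_def b_hi_def simp del: funpow.simps)
  qed
  have V_le: "b_lo s \<le> V s" "V s \<le> b_hi s" if "s \<in> aug_states Xs" for s
    using Vlim_ge_lo[OF that] Vlim_le[OF that, of 0] V[OF that] by (auto simp: b_lo_def b_hi_def)
  have fixpt: "T V s = V s" if "s \<in> aug_states Xs" for s
    using T_cong[OF V that] T_Vlim[OF that] V[OF that] by (simp add: T_def)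
  have Delta: "V \<in> Delta Xs U"
    using Delta_cong[of Vlim] Vlim_Delta_le V by (simp add: Delta_le_def)
  have unique: "v s = V s" if v: "v \<in> Delta Xs U" "\<forall>s\<in>aug_states Xs. v s = T v s"
      "\<forall>s\<in>aug_states Xs. b_lo s \<le> v s \<and> v s \<le> b_hi s" and s: "s \<in> aug_states Xs" for v s
    using T_fixpoint_unique[of v s] v s V[OF s] by (auto simp: Delta_le_def T_def b_hi_def)
  \<comment> \<open>A step from an augmented state along an admissible action ends in an augmented
    state, so minimizing rules for \<open>V\<close> and for \<open>Vlim\<close> are the
    same.\<close>
  have T_g: "T_g P C \<beta> g V s = T V s \<longleftrightarrow> T_g P C \<beta> g Vlim s = T_op D P C \<beta> Vlim s"
    if "is_decision_rule Xs As D g" "s \<in> aug_states Xs" for g s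
    using L_cong[OF V that(2) decision_ruleD(2)[OF that]] T_cong[OF V that(2)] by (simp add: T_g_eq_L T_def)
  have c: "\<exists>g. is_decision_rule Xs As D g \<and> (\<forall>s\<in>aug_states Xs. T_g P C \<beta> g V s = T V s)"
    using ex_optimal_decision_rule[OF Vlim_Delta_le] T_g by blast
  have d: "\<forall>g. is_decision_rule Xs As D g \<and> (\<forall>s \<in> aug_states Xs. T_g P C \<beta> g V s = T V s) \<longrightarrow>
        (let f = (\<lambda>n h. g (fst h n, \<Sum>k<n. \<beta> ^ k * C (fst h k) (snd h k) (fst h (Suc k)), \<beta> ^ n))
         in is_policy (restrict_space borel Xs) (restrict_space borel As) (sect D) f \<and>
            (\<forall>x \<in> Xs. orig_cost Xs As P U C \<beta> f x = V_inf Xs As D P U C \<beta> x))"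
  proof (intro allI impI)
    fix g assume "is_decision_rule Xs As D g \<and> (\<forall>s\<in>aug_states Xs. T_g P C \<beta> g V s = T V s)"
    then have "is_decision_rule Xs As D g" "\<And>s. s \<in> aug_states Xs \<Longrightarrow> T_g P C \<beta> g Vlim s = T_op D P C \<beta> Vlim s"
      using T_g by blast+
    from optimal_orig[OF this]
    show "let f = (\<lambda>n h. g (fst h n, \<Sum>k<n. \<beta> ^ k * C (fst h k) (snd h k) (fst h (Suc k)), \<beta> ^ n))
         in is_policy (restrict_space borel Xs) (restrict_space borel As) (sect D) f \<and>
            (\<forall>x \<in> Xs. orig_cost Xs As P U C \<beta> f x = V_inf Xs As D P U C \<beta> x)"
      unfolding Let_def by blast
  qed
  show ?thesis
  proof (intro conjI)
    show "V \<in> Delta Xs U" by (rule Delta)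
    show "\<forall>s\<in>aug_states Xs. V s = T V s" using fixpt by simp
    show "\<forall>s\<in>aug_states Xs. b_lo s \<le> V s \<and> V s \<le> b_hi s" using V_le by simp
    show "\<forall>v. v \<in> Delta Xs U \<and> (\<forall>s \<in> aug_states Xs. v s = T v s) \<and>
           (\<forall>s \<in> aug_states Xs. b_lo s \<le> v s \<and> v s \<le> b_hi s)
           \<longrightarrow> (\<forall>s \<in> aug_states Xs. v s = V s)" using unique by blast
  qed (use a in blast, rule c, rule d)
qed

end
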